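(* Let $\Omega\subseteq\mathbb{H}$ be a symmetric slice domain and let $f:\Omega\to\mathbb{H}$ be a non-constant regular function. Then its singular set $N_f$ has empty interior. Moreover, for a fixed $q_0=x_0+Iy_0\in N_f$ (with $x_0,y_0\in\mathbb{R}$, $I\in\mathbb{S}$), let $n>1$ be the total multiplicity of $f-f(q_0)$ at $x_0+y_0\mathbb{S}$. Then there exist a neighbourhood $U$ of $q_0$ and a neighbourhood $T$ of $x_0+y_0\mathbb{S}$ such that, for all $q_1\in U$, the sum of the total multiplicities of the zeros of $f-f(q_1)$ in $T$ equals $n$; in particular, for all $q_1\in U\setminus N_f$ the preimage $f^{-1}(f(q_1))$ includes at least two distinct points of $T$.
   Context: $\mathbb{H}$ denotes the quaternions, $\mathbb{S}=\{q\in\mathbb{H}:q^2=-1\}$, and $L_I=\mathbb{R}+I\mathbb{R}\cong\mathbb{C}$ for $I\in\mathbb{S}$. For $x,y\in\mathbb{R}$, $x+y\mathbb{S}=\{x+yI:I\in\mathbb{S}\}$ (a 2-sphere if $y\neq0$, the point $x$ if $y=0$). A symmetric slice domain is a domain $\Omega\subseteq\mathbb{H}$ such that $\Omega\cap\mathbb{R}\ne\emptyset$, $\Omega_I=\Omega\cap L_I$ is open and connected in $L_I$ for every $I\in\mathbb{S}$, and $\Omega$ is axially symmetric with respect to $\mathbb{R}$ (i.e. $x+yI\in\Omega$ for some $I\in\mathbb{S}$ implies $x+y\mathbb{S}\subset\Omega$). A function $f:\Omega\to\mathbb{H}$ is (slice) regular if for all $I\in\mathbb{S}$ the restriction $f_I=f|_{\Omega_I}$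 is holomorphic, i.e. $\frac12\left(\frac{\partial}{\partial x}+I\frac{\partial}{\partial y}\right)f_I(x+Iy)=0$ on $\Omega_I$. Such functions are $C^\infty$; $f_*$ denotes the real differential, and the singular set is $N_f=\{q\in\Omega: f_*\text{ is not invertible at }q\}$. Regular product: identify $L_i$ with $\mathbb{C}$. If on $\Omega_i$ one writes $f_1=g_1+h_1j$, $f_2=g_2+h_2j$ with $g_l,h_l:\Omega_i\to\mathbb{C}$ holomorphic, then $f_1*f_2$ is the unique regular function on $\Omega$ with $f_1*f_2=(g_1g_2-h_1\hat h_2)+(g_1h_2+h_1\hat g_2)j$ on $\Omega_i$, where $\hat g(z)=\overline{g(\bar z)}$. On power series it is $(\sum q^na_n)*(\sum q^nb_n)=\sum q^n\sum_{k=0}^n a_kb_{n-k}$. Multiplicities: if $f\not\equiv0$ is regular on $\Omega$ and $x+y\mathbb{S}\subset\Omega$, there are $m\in\mathbb{N}$ and a regular $\tilde f:\Omega\to\mathbb{H}$, not identically zero on $x+y\mathbb{S}$, with $f(q)=[(q-x)^2+y^2]^m\tilde f(q)$. If $\tilde f$ has a zero $p_1\in x+y\mathbb{S}$, it is unique and there are $n\in\mathbb{N}$, $p_2,\dots,p_n\in x+y\mathbb{S}$ with $p_l\neq\bar p_{l+1}$ and a regular $g$ on $\Omega$ without zeros in $x+y\mathbb{S}$ such that $\tilde f(q)=(q-p_1)*\cdots*(q-p_n)*g(q)$; put $n=0$ if $\tilde f$ has no zero in $x+y\mathbb{S}$. The total multiplicity of $x+y\mathbb{S}$ for $f$ is $2m+n$.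 The "sum of the total multiplicities of the zeros of a function in $T$" is the sum of the total multiplicities of the distinct sets $x+y\mathbb{S}$ containing a zero of the function lying in $T$.
   Formalization: At a real point (y=0) the factor f̃ may vanish there, so the total multiplicity 2m+n is the usual order of the zero; as written, the definition has no value at real zeros of odd order (e.g. f(q)=q at 0). *)

theory Defs
  imports "HOL-Analysis.Analysis"
begin

section \<open>Quaternions\<close>

datatype quat = Quat (qRe: real) (qIm1: real) (qIm2: real) (qIm3: real)

lemma quat_eq_iff:
  "x = y \<longleftrightarrow> qRe x = qRe y \<and> qIm1 x = qIm1 y \<and> qIm2 x = qIm2 y \<and> qIm3 x = qIm3 y"
  by (auto intro: quat.expand)

instantiation quat :: real_vector
begin

definition "0 = Quat 0 0 0 0"
definition "x + y = Quat (qRe x + qRe y) (qIm1 x + qIm1 y) (qIm2 x + qIm2 y) (qIm3 x + qIm3 y)"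
definition "- x = Quat (- qRe x) (- qIm1 x) (- qIm2 x) (- qIm3 x)"
definition "x - y = Quat (qRe x - qRe y) (qIm1 x - qIm1 y) (qIm2 x - qIm2 y) (qIm3 x - qIm3 y)"
definition "r *\<^sub>R x = Quat (r * qRe x) (r * qIm1 x) (r * qIm2 x) (r * qIm3 x)"

instance
  by standard
    (simp_all add: quat_eq_iff zero_quat_def plus_quat_def uminus_quat_def minus_quat_def
      scaleR_quat_def algebra_simps)

end

lemma quat_zero_simps [simp]: "qRe 0 = 0" "qIm1 0 = 0" "qIm2 0 = 0" "qIm3 0 = 0"
  by (simp_all add: zero_quat_def)

lemma quat_add_simps [simp]:
  "qRe (x + y) = qRe x + qRe y" "qIm1 (x + y) = qIm1 x + qIm1 y"
  "qIm2 (x + y) = qIm2 x + qIm2 y" "qIm3 (x + y) = qIm3 x + qIm3 y"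
  by (simp_all add: plus_quat_def)

lemma quat_uminus_simps [simp]:
  "qRe (- x) = - qRe x" "qIm1 (- x) = - qIm1 x" "qIm2 (- x) = - qIm2 x" "qIm3 (- x) = - qIm3 x"
  by (simp_all add: uminus_quat_def)

lemma quat_diff_simps [simp]:
  "qRe (x - y) = qRe x - qRe y" "qIm1 (x - y) = qIm1 x - qIm1 y"
  "qIm2 (x - y) = qIm2 x - qIm2 y" "qIm3 (x - y) = qIm3 x - qIm3 y"
  by (simp_all add: minus_quat_def)

lemma quat_scaleR_simps [simp]:
  "qRe (r *\<^sub>R x) = r * qRe x" "qIm1 (r *\<^sub>R x) = r * qIm1 x"
  "qIm2 (r *\<^sub>R x) = r * qIm2 x" "qIm3 (r *\<^sub>R x) = r * qIm3 x"
  by (simp_all add: scaleR_quat_def)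

instantiation quat :: real_algebra_1
begin

definition "1 = Quat 1 0 0 0"

definition "x * y = Quat
  (qRe x * qRe y - qIm1 x * qIm1 y - qIm2 x * qIm2 y - qIm3 x * qIm3 y)
  (qRe x * qIm1 y + qIm1 x * qRe y + qIm2 x * qIm3 y - qIm3 x * qIm2 y)
  (qRe x * qIm2 y - qIm1 x * qIm3 y + qIm2 x * qRe y + qIm3 x * qIm1 y)
  (qRe x * qIm3 y + qIm1 x * qIm2 y - qIm2 x * qIm1 y + qIm3 x * qRe y)"

instance
  by standard (simp_all add: quat_eq_iff one_quat_def times_quat_def algebra_simps)

end

lemma quat_one_simps [simp]: "qRe 1 = 1" "qIm1 1 = 0" "qIm2 1 = 0" "qIm3 1 = 0"
  by (simp_all add: one_quat_def)

lemma quat_mult_simps [simp]: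
  "qRe (x * y) = qRe x * qRe y - qIm1 x * qIm1 y - qIm2 x * qIm2 y - qIm3 x * qIm3 y"
  "qIm1 (x * y) = qRe x * qIm1 y + qIm1 x * qRe y + qIm2 x * qIm3 y - qIm3 x * qIm2 y"
  "qIm2 (x * y) = qRe x * qIm2 y - qIm1 x * qIm3 y + qIm2 x * qRe y + qIm3 x * qIm1 y"
  "qIm3 (x * y) = qRe x * qIm3 y + qIm1 x * qIm2 y - qIm2 x * qIm1 y + qIm3 x * qRe y"
  by (simp_all add: times_quat_def)

lemma quat_of_real_simps [simp]:
  "qRe (of_real r) = r" "qIm1 (of_real r) = 0" "qIm2 (of_real r) = 0" "qIm3 (of_real r) = 0"
  by (simp_all add: of_real_def)

definition qcnj :: "quat \<Rightarrow> quat"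
  where "qcnj q = Quat (qRe q) (- qIm1 q) (- qIm2 q) (- qIm3 q)"

lemma qcnj_simps [simp]:
  "qRe (qcnj q) = qRe q" "qIm1 (qcnj q) = - qIm1 q"
  "qIm2 (qcnj q) = - qIm2 q" "qIm3 (qcnj q) = - qIm3 q"
  by (simp_all add: qcnj_def)

instantiation quat :: real_inner
begin

definition "inner x y = qRe x * qRe y + qIm1 x * qIm1 y + qIm2 x * qIm2 y + qIm3 x * qIm3 y"
definition norm_quat :: "quat \<Rightarrow> real" where "norm_quat x = sqrt (inner x x)"
definition sgn_quat :: "quat \<Rightarrow> quat" where "sgn_quat x = inverse (norm x) *\<^sub>R x"
definition dist_quat :: "quat \<Rightarrow> quat \<Rightarrow> real" where "dist_quat x y = norm (x - y)"
definition uniformity_quat :: "(quat \<times> quat) filter"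
  where "uniformity_quat = (INF e\<in>{0<..}. principal {(x, y). dist x y < e})"
definition open_quat :: "quat set \<Rightarrow> bool"
  where "open_quat U \<longleftrightarrow> (\<forall>x\<in>U. eventually (\<lambda>(x', y). x' = x \<longrightarrow> y \<in> U) uniformity)"

instance
proof
  fix x y z :: quat and r :: real and U :: "quat set"
  show "dist x y = norm (x - y)"
    by (rule dist_quat_def)
  show "sgn x = x /\<^sub>R norm x"
    by (rule sgn_quat_def)
  show "uniformity = (INF e\<in>{0<..}. principal {(x :: quat, y). dist x y < e})"
    by (rule uniformity_quat_def)
  show "open U \<longleftrightarrow> (\<forall>x\<in>U. \<forall>\<^sub>F (x', y) in uniformity. x' = x \<longrightarrow> y \<in> U)"
    by (rule open_quat_def)
  show "norm x = sqrt (inner x x)"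
    by (rule norm_quat_def)
  show "0 \<le> inner x x"
    by (simp add: inner_quat_def)
  show "inner x x = 0 \<longleftrightarrow> x = 0"
  proof
    assume "inner x x = 0"
    then have "qRe x * qRe x + qIm1 x * qIm1 x + qIm2 x * qIm2 x + qIm3 x * qIm3 x = 0"
      by (simp add: inner_quat_def)
    moreover have "0 \<le> qRe x * qRe x" "0 \<le> qIm1 x * qIm1 x" "0 \<le> qIm2 x * qIm2 x"
      "0 \<le> qIm3 x * qIm3 x"
      by simp_all
    ultimately have "qRe x * qRe x = 0" "qIm1 x * qIm1 x = 0" "qIm2 x * qIm2 x = 0"
      "qIm3 x * qIm3 x = 0"
      by linarith+
    then show "x = 0"
      by (simp add: quat_eq_iff)
  qed (simp add: inner_quat_def)
qed (simp_all add: inner_quat_def algebra_simps)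

end

instantiation quat :: real_normed_div_algebra
begin

definition inverse_quat :: "quat \<Rightarrow> quat"
  where "inverse_quat x = inverse (inner x x) *\<^sub>R qcnj x"

definition divide_quat :: "quat \<Rightarrow> quat \<Rightarrow> quat"
  where "divide_quat x y = x * inverse y"

instance
proof
  fix x y :: quat
  show "x div y = x * inverse y"
    by (rule divide_quat_def)
  show "inverse (0 :: quat) = 0"
    by (simp add: inverse_quat_def)
  have 1: "qcnj x * x = of_real (inner x x)" "x * qcnj x = of_real (inner x x)"
    by (simp_all add: quat_eq_iff inner_quat_def algebra_simps)
  {
    assume "x \<noteq> 0"
    then have 2: "inverse (inner x x) * inner x x = 1"
      by simp
    show "inverse x * x = 1" "x * inverse x = 1"
      unfolding inverse_quat_def mult_scaleR_left mult_scaleR_right 1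
      using 2 by (simp_all add: quat_eq_iff)
  }
  have "inner (x * y) (x * y) = inner x x * inner y y"
    unfolding inner_quat_def quat_mult_simps by algebra
  then show "norm (x * y) = norm x * norm y"
    by (simp add: norm_quat_def real_sqrt_mult)
qed

end

definition quat_i :: quat where "quat_i = Quat 0 1 0 0"
definition quat_j :: quat where "quat_j = Quat 0 0 1 0"
definition quat_k :: quat where "quat_k = Quat 0 0 0 1"

instantiation quat :: euclidean_space
begin

definition "Basis = {1, quat_i, quat_j, quat_k}"

instance
proof
  fix u v x :: quat
  show "(Basis :: quat set) \<noteq> {}" "finite (Basis :: quat set)"
    by (simp_all add: Basis_quat_def)
  have Basis_eq: "Basis = {Quat 1 0 0 0, Quat 0 1 0 0, Quat 0 0 1 0, Quat 0 0 0 1}"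
    unfolding Basis_quat_def quat_i_def quat_j_def quat_k_def one_quat_def ..
  show "inner u v = (if u = v then 1 else 0)" if "u \<in> Basis" "v \<in> Basis"
    using that unfolding Basis_eq inner_quat_def
    by (elim insertE emptyE) simp_all
  show "(\<forall>u\<in>Basis. inner x u = 0) \<longleftrightarrow> x = 0"
    unfolding Basis_eq inner_quat_def quat_eq_iff[of x 0] by simp
qed

end


section \<open>Symmetric slice domains and slice regular functions\<close>

definition imag_units :: "quat set"
  where "imag_units = {q. q\<^sup>2 = - 1}"

definition slice :: "quat \<Rightarrow> quat set"
  where "slice I = {of_real x + of_real y * I | x y. True}"

definition slice_sphere :: "real \<Rightarrow> real \<Rightarrow> quat set"
  where "slice_sphere x y = {of_real x + of_real y * I | I. I \<in> imag_units}"

definition symmetric_slice_domain :: "quat set \<Rightarrow> bool"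
  where "symmetric_slice_domain \<Omega> \<longleftrightarrow>
    open \<Omega> \<and> connected \<Omega> \<and> \<Omega> \<inter> \<real> \<noteq> {} \<and>
    (\<forall>I\<in>imag_units. openin (top_of_set (slice I)) (\<Omega> \<inter> slice I) \<and> connected (\<Omega> \<inter> slice I)) \<and>
    (\<forall>x y. \<forall>I\<in>imag_units. of_real x + of_real y * I \<in> \<Omega> \<longrightarrow> slice_sphere x y \<subseteq> \<Omega>)"

text \<open>
  Functions on \<open>\<Omega>\<close> are total functions of which only the values on \<open>\<Omega>\<close> matter. Holomorphy of the
  restriction to a slice is real differentiability in \<open>(x, y)\<close> together with the Cauchy--Riemann
  equation; \<open>D (1, 0)\<close> and \<open>D (0, 1)\<close> are the partial derivatives with respect to \<open>x\<close> and \<open>y\<close>.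
\<close>

definition slice_regular :: "quat set \<Rightarrow> (quat \<Rightarrow> quat) \<Rightarrow> bool"
  where "slice_regular \<Omega> f \<longleftrightarrow>
    (\<forall>I\<in>imag_units. \<forall>x y. of_real x + of_real y * I \<in> \<Omega> \<longrightarrow>
      (\<exists>D. ((\<lambda>(s, t). f (of_real s + of_real t * I)) has_derivative D) (at (x, y)) \<and>
           (1/2) *\<^sub>R (D (1, 0) + I * D (0, 1)) = 0))"

definition singular_set :: "quat set \<Rightarrow> (quat \<Rightarrow> quat) \<Rightarrow> quat set"
  where "singular_set \<Omega> f = {q \<in> \<Omega>. \<not> bij (frechet_derivative f (at q))}"


section \<open>The regular product\<close>

definition quat_of_complex :: "complex \<Rightarrow> quat"
  where "quat_of_complex z = of_real (Re z) + of_real (Im z) * quat_i"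

text \<open>
  Every quaternion is \<open>a + b j\<close> with \<open>a\<close>, \<open>b\<close> in the slice of \<open>i\<close>. Applied to the values of \<open>f\<close> on
  that slice, this gives the splitting \<open>f = g + h j\<close> (\<open>g = split1 f\<close>, \<open>h = split2 f\<close>).
\<close>

definition split1 :: "(quat \<Rightarrow> quat) \<Rightarrow> complex \<Rightarrow> complex"
  where "split1 f z = Complex (qRe (f (quat_of_complex z))) (qIm1 (f (quat_of_complex z)))"

definition split2 :: "(quat \<Rightarrow> quat) \<Rightarrow> complex \<Rightarrow> complex"
  where "split2 f z = Complex (qIm2 (f (quat_of_complex z))) (qIm3 (f (quat_of_complex z)))"

lemma split_decomposition:
  "f (quat_of_complex z) = quat_of_complex (split1 f z) + quat_of_complex (split2 f z) * quat_j"
  by (simp add: quat_eq_iff quat_of_complex_def split1_def split2_def quat_i_def quat_j_def)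

definition hat :: "(complex \<Rightarrow> complex) \<Rightarrow> complex \<Rightarrow> complex"
  where "hat g z = cnj (g (cnj z))"

text \<open>The value \<open>0\<close> outside \<open>\<Omega>\<close> only serves to make the product unique as a total function.\<close>

definition regular_product ::
    "quat set \<Rightarrow> (quat \<Rightarrow> quat) \<Rightarrow> (quat \<Rightarrow> quat) \<Rightarrow> quat \<Rightarrow> quat"
  where "regular_product \<Omega> f1 f2 = (THE F.
    slice_regular \<Omega> F \<and> (\<forall>q. q \<notin> \<Omega> \<longrightarrow> F q = 0) \<and>
    (\<forall>z. quat_of_complex z \<in> \<Omega> \<longrightarrow>
      F (quat_of_complex z) =
        quat_of_complex (split1 f1 z * split1 f2 z - split2 f1 z * hat (split2 f2) z) +
        quat_of_complex (split1 f1 z * split2 f2 z + split2 f1 z * hat (split1 f2) z) * quat_j))"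


section \<open>Total multiplicities\<close>

text \<open>
  \<open>linear_factors \<Omega> [p1, \<dots>, pn] g\<close> is \<open>(q - p1) * \<dots> * (q - pn) * g(q)\<close>, with regular products.
\<close>

definition linear_factors :: "quat set \<Rightarrow> quat list \<Rightarrow> (quat \<Rightarrow> quat) \<Rightarrow> quat \<Rightarrow> quat"
  where "linear_factors \<Omega> ps g = foldr (\<lambda>p F. regular_product \<Omega> (\<lambda>q. q - p) F) ps g"

definition isolated_multiplicity :: "quat set \<Rightarrow> (quat \<Rightarrow> quat) \<Rightarrow> quat set \<Rightarrow> nat \<Rightarrow> bool"
  where "isolated_multiplicity \<Omega> f C n \<longleftrightarrow>
    (if \<exists>p\<in>C. f p = 0
     then \<exists>ps g. ps \<noteq> [] \<and> length ps = n \<and> set ps \<subseteq> C \<and> f (hd ps) = 0 \<and>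
            (\<forall>l. Suc l < n \<longrightarrow> ps ! l \<noteq> qcnj (ps ! Suc l)) \<and>
            slice_regular \<Omega> g \<and> (\<forall>q\<in>C. g q \<noteq> 0) \<and>
            (\<forall>q\<in>\<Omega>. f q = linear_factors \<Omega> ps g q)
     else n = 0)"

text \<open>
  For \<open>y = 0\<close> the set \<open>x + yS\<close> is the point \<open>x\<close>, and a zero of odd order at \<open>x\<close> forces \<open>ft\<close> to vanish
  there; the condition that \<open>ft\<close> is not identically zero on \<open>x + yS\<close> is therefore imposed only for
  \<open>y \<noteq> 0\<close>. For \<open>y = 0\<close> the condition \<open>ps ! l \<noteq> qcnj (ps ! Suc l)\<close> bounds \<open>n\<close> by \<open>1\<close>, so \<open>2 * m + n\<close> is
  the usual order of the zero: the \<open>N\<close> with \<open>f q = (q - x) ^ N * g q\<close> and \<open>g x \<noteq> 0\<close>.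
\<close>

definition total_multiplicity :: "quat set \<Rightarrow> (quat \<Rightarrow> quat) \<Rightarrow> quat set \<Rightarrow> nat"
  where "total_multiplicity \<Omega> f C = (THE N. \<exists>x y m n ft.
    C = slice_sphere x y \<and> slice_regular \<Omega> ft \<and>
    (y \<noteq> 0 \<longrightarrow> (\<exists>q\<in>C. ft q \<noteq> 0)) \<and>
    (\<forall>q\<in>\<Omega>. f q = ((q - of_real x)\<^sup>2 + of_real (y\<^sup>2)) ^ m * ft q) \<and>
    isolated_multiplicity \<Omega> ft C n \<and> N = 2 * m + n)"

definition zero_spheres :: "quat set \<Rightarrow> (quat \<Rightarrow> quat) \<Rightarrow> quat set \<Rightarrow> quat set set"
  where "zero_spheres \<Omega> f T =
    {C. (\<exists>x y. C = slice_sphere x y) \<and> (\<exists>q\<in>C. q \<in> \<Omega> \<and> q \<in> T \<and> f q = 0)}"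

end

(*
  A slice regular function f is induced by a holomorphic "stem function" F with values in the
  complexified quaternions, f (x + y I) = Re F + I Im F at x + i y; the regular product is the
  pointwise product of stem functions. The symmetrization s = F0^2 + F1^2 + F2^2 + F3^2 is
  multiplicative, equals (z - z0) (z - cnj z0) for the linear factor q - p with p on the sphere of z0,
  and vanishes at z0 iff f has a zero on that sphere. Hence the total multiplicity of a sphere is the
  order of s at z0 (half of it, if z0 is real), and its conservation is Rouche's theorem for the
  symmetrization of f - f(q1), which depends continuously on q1. A direct computation of s'(z0) and of
  the differential of f shows that q is singular iff the multiplicity of f - f(q) at its sphere is at
  least 2; so near q0 a non-singular q1 uses up only 1 of the multiplicity n > 1, which leaves another
  sphere with a preimage of f(q1).
*)

theory Submission
  imports Defs "HOL-Complex_Analysis.Complex_Analysis"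
begin

section \<open>Complexified quaternions\<close>

text \<open>The complexified quaternions have zero divisors, so a stem function can be nonzero where
  its symmetrization vanishes, and a linear factor cannot be cancelled pointwise. Two facts get
  around this. Over a real point the conjugation symmetry makes the stem value an ordinary
  quaternion, and there only 0 has norm 0. The trace of the domain in the complex plane is connected
  and contains a real interval, so an identity between stem functions need only be checked on the
  reals. Spherical factors are scalar stems and can be moved through any product.
  \<open>total_multiplicity\<close> is a definite description, so its value must be shown to exist
  and to be unique. Existence is an induction on the order of the symmetrization; uniqueness holds
  because every admissible factorization determines this order. The real axis is exceptional
  throughout: polar coordinates are not differentiable there, spheres shrink to points, and the two
  conjugate roots of the polynomial of a sphere merge, so that an order at a real point counts every
  factor twice.\<close>

datatype cquat = CQuat (cq0: complex) (cq1: complex) (cq2: complex) (cq3: complex)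

lemma cquat_eq_iff:
  "v = w \<longleftrightarrow> cq0 v = cq0 w \<and> cq1 v = cq1 w \<and> cq2 v = cq2 w \<and> cq3 v = cq3 w"
  by (auto intro: cquat.expand)

instantiation cquat :: ring_1
begin

definition "0 = CQuat 0 0 0 0"
definition "1 = CQuat 1 0 0 0"
definition "v + w = CQuat (cq0 v + cq0 w) (cq1 v + cq1 w) (cq2 v + cq2 w) (cq3 v + cq3 w)"
definition "v - w = CQuat (cq0 v - cq0 w) (cq1 v - cq1 w) (cq2 v - cq2 w) (cq3 v - cq3 w)"
definition "- w = CQuat (- cq0 w) (- cq1 w) (- cq2 w) (- cq3 w)"
definition "v * w = CQuat
  (cq0 v * cq0 w - cq1 v * cq1 w - cq2 v * cq2 w - cq3 v * cq3 w)
  (cq0 v * cq1 w + cq1 v * cq0 w + cq2 v * cq3 w - cq3 v * cq2 w)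
  (cq0 v * cq2 w - cq1 v * cq3 w + cq2 v * cq0 w + cq3 v * cq1 w)
  (cq0 v * cq3 w + cq1 v * cq2 w - cq2 v * cq1 w + cq3 v * cq0 w)"

instance
  by standard
    (simp_all add: cquat_eq_iff zero_cquat_def one_cquat_def plus_cquat_def minus_cquat_def
      uminus_cquat_def times_cquat_def algebra_simps)

end

lemma cquat_simps [simp]:
  "cq0 0 = 0" "cq1 0 = 0" "cq2 0 = 0" "cq3 0 = 0"
  "cq0 1 = 1" "cq1 1 = 0" "cq2 1 = 0" "cq3 1 = 0"
  "cq0 (v + w) = cq0 v + cq0 w" "cq1 (v + w) = cq1 v + cq1 w"
  "cq2 (v + w) = cq2 v + cq2 w" "cq3 (v + w) = cq3 v + cq3 w"
  "cq0 (v - w) = cq0 v - cq0 w" "cq1 (v - w) = cq1 v - cq1 w"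
  "cq2 (v - w) = cq2 v - cq2 w" "cq3 (v - w) = cq3 v - cq3 w"
  "cq0 (v * w) = cq0 v * cq0 w - cq1 v * cq1 w - cq2 v * cq2 w - cq3 v * cq3 w"
  "cq1 (v * w) = cq0 v * cq1 w + cq1 v * cq0 w + cq2 v * cq3 w - cq3 v * cq2 w"
  "cq2 (v * w) = cq0 v * cq2 w - cq1 v * cq3 w + cq2 v * cq0 w + cq3 v * cq1 w"
  "cq3 (v * w) = cq0 v * cq3 w + cq1 v * cq2 w - cq2 v * cq1 w + cq3 v * cq0 w"
  by (simp_all add: zero_cquat_def one_cquat_def plus_cquat_def minus_cquat_def times_cquat_def)

definition cq_scalar :: "complex \<Rightarrow> cquat"
  where "cq_scalar z = CQuat z 0 0 0"

definition cq_of_quat :: "quat \<Rightarrow> cquat"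
  where "cq_of_quat q = CQuat (of_real (qRe q)) (of_real (qIm1 q)) (of_real (qIm2 q)) (of_real (qIm3 q))"

text \<open>Conjugates only the complex coefficients and fixes the quaternion units; it is therefore
  multiplicative and does not reverse products.\<close>

definition cq_cnj :: "cquat \<Rightarrow> cquat"
  where "cq_cnj w = CQuat (cnj (cq0 w)) (cnj (cq1 w)) (cnj (cq2 w)) (cnj (cq3 w))"

definition cq_Re :: "cquat \<Rightarrow> quat"
  where "cq_Re w = Quat (Re (cq0 w)) (Re (cq1 w)) (Re (cq2 w)) (Re (cq3 w))"

definition cq_Im :: "cquat \<Rightarrow> quat"
  where "cq_Im w = Quat (Im (cq0 w)) (Im (cq1 w)) (Im (cq2 w)) (Im (cq3 w))"

text \<open>The complex bilinear extension of the squared norm, not a Hermitian form: being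
  polynomial in the components it keeps holomorphy, at the price of vanishing on zero
  divisors.\<close>

definition cq_norm :: "cquat \<Rightarrow> complex"
  where "cq_norm w = (cq0 w)\<^sup>2 + (cq1 w)\<^sup>2 + (cq2 w)\<^sup>2 + (cq3 w)\<^sup>2"

text \<open>Substituting the imaginary unit \<open>I\<close>, placed on the left, for the central unit \<open>\<i>\<close>.\<close>

definition cq_eval :: "quat \<Rightarrow> cquat \<Rightarrow> quat"
  where "cq_eval I w = cq_Re w + I * cq_Im w"

definition slice_emb :: "quat \<Rightarrow> complex \<Rightarrow> quat"
  where "slice_emb I z = of_real (Re z) + of_real (Im z) * I"

lemma cq_scalar_simps [simp]:
  "cq0 (cq_scalar z) = z" "cq1 (cq_scalar z) = 0" "cq2 (cq_scalar z) = 0" "cq3 (cq_scalar z) = 0"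
  by (simp_all add: cq_scalar_def)

lemma cq_of_quat_simps [simp]:
  "cq0 (cq_of_quat q) = of_real (qRe q)" "cq1 (cq_of_quat q) = of_real (qIm1 q)"
  "cq2 (cq_of_quat q) = of_real (qIm2 q)" "cq3 (cq_of_quat q) = of_real (qIm3 q)"
  by (simp_all add: cq_of_quat_def)

lemma cq_cnj_simps [simp]:
  "cq0 (cq_cnj w) = cnj (cq0 w)" "cq1 (cq_cnj w) = cnj (cq1 w)"
  "cq2 (cq_cnj w) = cnj (cq2 w)" "cq3 (cq_cnj w) = cnj (cq3 w)"
  by (simp_all add: cq_cnj_def)

lemma cq_Re_simps [simp]:
  "qRe (cq_Re w) = Re (cq0 w)" "qIm1 (cq_Re w) = Re (cq1 w)"
  "qIm2 (cq_Re w) = Re (cq2 w)" "qIm3 (cq_Re w) = Re (cq3 w)"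
  by (simp_all add: cq_Re_def)

lemma cq_Im_simps [simp]:
  "qRe (cq_Im w) = Im (cq0 w)" "qIm1 (cq_Im w) = Im (cq1 w)"
  "qIm2 (cq_Im w) = Im (cq2 w)" "qIm3 (cq_Im w) = Im (cq3 w)"
  by (simp_all add: cq_Im_def)

lemma quat_units_simps [simp]:
  "qRe quat_i = 0" "qIm1 quat_i = 1" "qIm2 quat_i = 0" "qIm3 quat_i = 0"
  "qRe quat_j = 0" "qIm1 quat_j = 0" "qIm2 quat_j = 1" "qIm3 quat_j = 0"
  "qRe quat_k = 0" "qIm1 quat_k = 0" "qIm2 quat_k = 0" "qIm3 quat_k = 1"
  by (simp_all add: quat_i_def quat_j_def quat_k_def)

text \<open>The vector part of the square of \<open>I\<close> is \<open>2 * qRe I\<close> times that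
  of \<open>I\<close>; were \<open>qRe I\<close> nonzero, \<open>I\<close> would be real and its
  square could not be negative.\<close>

lemma imag_units_iff:
  "I \<in> imag_units \<longleftrightarrow> qRe I = 0 \<and> (qIm1 I)\<^sup>2 + (qIm2 I)\<^sup>2 + (qIm3 I)\<^sup>2 = 1"
proof -
  have *: "a * b + b * a + c * d - d * c = 2 * (a * b)"
    "a * b - c * d + b * a + d * c = 2 * (a * b)"
    "a * b + c * d - d * c + b * a = 2 * (a * b)" for a b c d :: real
    by (simp_all add: mult.commute)
  have "I \<in> imag_units \<longleftrightarrow>
      qRe I * qRe I - qIm1 I * qIm1 I - qIm2 I * qIm2 I - qIm3 I * qIm3 I = -1 \<and>
      (qRe I = 0 \<or> qIm1 I = 0 \<and> qIm2 I = 0 \<and> qIm3 I = 0)"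
    by (simp only: imag_units_def power2_eq_square quat_eq_iff mem_Collect_eq quat_mult_simps *
      quat_uminus_simps quat_one_simps minus_zero mult_eq_0_iff zero_neq_numeral[symmetric] simp_thms)
      blast
  also have "\<dots> \<longleftrightarrow> qRe I = 0 \<and> (qIm1 I)\<^sup>2 + (qIm2 I)\<^sup>2 + (qIm3 I)\<^sup>2 = 1" (is "?L \<longleftrightarrow> ?R")
  proof
    assume L: ?L
    have "qRe I * qRe I \<noteq> -1"
      by (metis neg_0_le_iff_le not_one_le_zero zero_le_square)
    with L have "qRe I = 0" by (elim conjE disjE) simp_all
    with L show ?R by (simp add: power2_eq_square)
  next
    assume ?R
    then show ?L by (simp add: power2_eq_square)
  qed
  finally show ?thesis .
qed

lemma imag_units_square: "I \<in> imag_units \<Longrightarrow> I * I = -1"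
  by (simp add: imag_units_def power2_eq_square)

lemma imag_units_square_left: "I \<in> imag_units \<Longrightarrow> I * (I * q) = - q"
  by (simp add: mult.assoc[symmetric] imag_units_square)

lemma quat_i_imag_unit [simp]: "quat_i \<in> imag_units"
  by (simp add: imag_units_iff)

lemma imag_units_uminus: "I \<in> imag_units \<Longrightarrow> - I \<in> imag_units"
  by (simp add: imag_units_iff)

lemma imag_units_nonzero: "I \<in> imag_units \<Longrightarrow> I \<noteq> 0"
  by (auto simp: imag_units_iff)

lemma norm_imag_unit: "I \<in> imag_units \<Longrightarrow> norm I = 1"
  by (simp add: imag_units_iff norm_quat_def inner_quat_def power2_eq_square)

lemma quat_of_complex_eq_slice_emb: "quat_of_complex z = slice_emb quat_i z"
  by (simp add: quat_of_complex_def slice_emb_def)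

lemma slice_emb_mult: "I \<in> imag_units \<Longrightarrow> slice_emb I (z * w) = slice_emb I z * slice_emb I w"
  by (simp add: slice_emb_def of_real_def algebra_simps imag_units_square)

lemma slice_emb_add: "slice_emb I (z + w) = slice_emb I z + slice_emb I w"
  by (simp add: slice_emb_def quat_eq_iff algebra_simps)

lemma slice_emb_i: "slice_emb I \<i> = I"
  by (simp add: slice_emb_def)

lemma slice_emb_uminus_cnj: "slice_emb (- I) (cnj z) = slice_emb I z"
  by (simp add: slice_emb_def)

lemma slice_emb_of_real: "slice_emb I (of_real x) = of_real x"
  by (simp add: slice_emb_def)

lemma cq_scalar_mult: "cq_scalar (z * w) = cq_scalar z * cq_scalar w"
  by (simp add: cquat_eq_iff)

lemma cq_scalar_commute: "w * cq_scalar z = cq_scalar z * w"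
  by (simp add: cquat_eq_iff)

lemma cq_scalar_0 [simp]: "cq_scalar 0 = 0" and cq_scalar_1 [simp]: "cq_scalar 1 = 1"
  by (simp_all add: cquat_eq_iff)

lemma cq_scalar_mult_eq_0 [simp]: "cq_scalar z * w = 0 \<longleftrightarrow> z = 0 \<or> w = 0"
  by (auto simp: cquat_eq_iff)

text \<open>Euler's four-square identity is polynomial, so it holds over the complex numbers
  too.\<close>

lemma cq_norm_mult: "cq_norm (v * w) = cq_norm v * cq_norm w"
  by (simp add: cq_norm_def) algebra

lemma cq_norm_scalar: "cq_norm (cq_scalar z) = z\<^sup>2"
  by (simp add: cq_norm_def)

lemma cq_cnj_mult: "cq_cnj (v * w) = cq_cnj v * cq_cnj w"
  by (simp add: cquat_eq_iff)

lemma cq_cnj_diff: "cq_cnj (v - w) = cq_cnj v - cq_cnj w"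
  by (simp add: cquat_eq_iff)

lemma cq_cnj_scalar: "cq_cnj (cq_scalar z) = cq_scalar (cnj z)"
  by (simp add: cquat_eq_iff)

lemma cq_cnj_of_quat: "cq_cnj (cq_of_quat q) = cq_of_quat q"
  by (simp add: cquat_eq_iff)

lemma cq_norm_cnj: "cq_norm (cq_cnj w) = cnj (cq_norm w)"
  by (simp add: cq_norm_def)

lemma cq_eval_diff: "cq_eval I (v - w) = cq_eval I v - cq_eval I w"
  by (simp add: cq_eval_def quat_eq_iff algebra_simps)

lemma cq_eval_of_quat [simp]: "cq_eval I (cq_of_quat q) = q"
  by (simp add: cq_eval_def quat_eq_iff)

lemma cq_eval_0 [simp]: "cq_eval I 0 = 0"
  by (simp add: cq_eval_def quat_eq_iff)

lemma cq_eval_scalar: "cq_eval I (cq_scalar z) = slice_emb I z"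
  by (simp add: cq_eval_def slice_emb_def quat_eq_iff)

lemma cq_eval_uminus_cnj: "cq_eval (- I) (cq_cnj w) = cq_eval I w"
  by (simp add: cq_eval_def quat_eq_iff)

lemma cq_eval_scalar_mult:
  assumes "I \<in> imag_units"
  shows "cq_eval I (cq_scalar z * w) = slice_emb I z * cq_eval I w"
proof -
  have "cq_Re (cq_scalar z * w) = Re z *\<^sub>R cq_Re w - Im z *\<^sub>R cq_Im w"
    "cq_Im (cq_scalar z * w) = Re z *\<^sub>R cq_Im w + Im z *\<^sub>R cq_Re w"
    by (simp_all add: quat_eq_iff algebra_simps)
  then show ?thesis
    using imag_units_square_left[OF assms, of "cq_Im w"]
    by (simp add: cq_eval_def slice_emb_def algebra_simps of_real_def)
qed

lemma cq_eval_real: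
  assumes "cq_cnj w = w"
  shows "cq_eval I w = cq_Re w" "w = cq_of_quat (cq_Re w)"
  using assms by (auto simp: cq_eval_def quat_eq_iff cquat_eq_iff complex_eq_iff)

section \<open>Evaluation at imaginary units and elements of norm 0\<close>

lemma cq_eq_0_iff: "w = 0 \<longleftrightarrow> cq_Re w = 0 \<and> cq_Im w = 0"
  by (auto simp: quat_eq_iff cquat_eq_iff complex_eq_iff)

text \<open>Needed to conclude that an element which evaluates to 0 at two antipodal units is
  0.\<close>

lemma cq_Re_Im_of_eval:
  assumes "I \<in> imag_units"
  shows "2 *\<^sub>R cq_Re w = cq_eval I w + cq_eval (- I) w"
    and "2 *\<^sub>R cq_Im w = - I * (cq_eval I w - cq_eval (- I) w)"
  using imag_units_square_left[OF assms, of "cq_Im w"]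
  by (simp_all add: cq_eval_def algebra_simps scaleR_2)

lemma cq_norm_Re_Im:
  "Re (cq_norm w) = inner (cq_Re w) (cq_Re w) - inner (cq_Im w) (cq_Im w)"
  "Im (cq_norm w) = 2 * inner (cq_Re w) (cq_Im w)"
  by (simp_all add: cq_norm_def inner_quat_def power2_eq_square algebra_simps)

lemma inner_imag_unit_mult:
  assumes "I \<in> imag_units"
  shows "inner (I * p) (I * q) = inner p q" "inner (I * p) p = 0" "inner p (I * p) = 0"
    and "inner (I * p) q = - inner p (I * q)"
proof -
  have I: "qRe I = 0" "(qIm1 I)\<^sup>2 + (qIm2 I)\<^sup>2 + (qIm3 I)\<^sup>2 = 1"
    using assms by (simp_all add: imag_units_iff)
  have "inner (I * p) (I * q) =
      ((qIm1 I)\<^sup>2 + (qIm2 I)\<^sup>2 + (qIm3 I)\<^sup>2) * inner p q"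
    by (simp add: inner_quat_def I(1)) algebra
  then show "inner (I * p) (I * q) = inner p q" using I(2) by simp
  show "inner (I * p) p = 0" "inner p (I * p) = 0" "inner (I * p) q = - inner p (I * q)"
    by (simp_all add: inner_quat_def I(1) algebra_simps)
qed

text \<open>Evaluation to 0 says \<open>cq_Re w = - (I * cq_Im w)\<close>. Left multiplication by an
  imaginary unit is an isometry that turns every vector into an orthogonal one, and norm 0 means
  that the two parts are orthogonal and equally long.\<close>

lemma cq_norm_eq_0_if_eval:
  assumes "I \<in> imag_units" "cq_eval I w = 0"
  shows "cq_norm w = 0"
proof -
  have "cq_Re w = - (I * cq_Im w)"
    using assms(2) by (simp add: cq_eval_def eq_neg_iff_add_eq_0)
  then show ?thesis
    by (simp add: complex_eq_iff cq_norm_Re_Im inner_imag_unit_mult(1-3)[OF assms(1)])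
qed

lemma eval_eq_0_if_cq_norm:
  assumes "cq_norm w = 0"
  shows "\<exists>I\<in>imag_units. cq_eval I w = 0"
proof -
  define a b where "a = cq_Re w" and "b = cq_Im w"
  have ab: "inner a a = inner b b" "inner a b = 0"
    using assms cq_norm_Re_Im[of w] by (simp_all add: a_def b_def)
  show ?thesis
  proof (cases "b = 0")
    case True
    then have "cq_eval quat_i w = 0"
      using ab by (simp add: cq_eval_def a_def b_def)
    then show ?thesis using quat_i_imag_unit by blast
  next
    case False
    \<comment> \<open>The only solution of \<open>a + I * b = 0\<close>: equal lengths of
      \<open>a\<close> and \<open>b\<close> give it norm 1, their orthogonality kills its real
      part.\<close>
    define I where "I = - (a * inverse b)"
    have 1: "I * b = - a"
      using False by (simp add: I_def mult.assoc)
    have "inner b b * qRe I = 0"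
    proof -
      have "inner b b * qRe I = inner (I * b) b"
        by (simp add: inner_quat_def algebra_simps)
      then show ?thesis using ab 1 by simp
    qed
    then have re: "qRe I = 0" using False by simp
    have "norm a = norm b"
      using ab by (simp add: norm_quat_def)
    then have "norm I = 1"
      using False by (simp add: I_def norm_mult norm_inverse)
    then have "I \<in> imag_units"
      using re by (simp add: imag_units_iff norm_quat_def inner_quat_def power2_eq_square)
    moreover have "cq_eval I w = 0"
      using 1 by (simp add: cq_eval_def a_def b_def)
    ultimately show ?thesis by blast
  qed
qed

text \<open>At the point \<open>Complex x y\<close> the linear stem of the conjugate point is
  \<open>y\<close> times \<open>cq_scalar \<i> + cq_of_quat I\<close>, a zero divisor that
  annihilates whatever evaluates to 0 at \<open>I\<close>.\<close>

lemma cq_linear_cnj_mult_eq_0: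
  assumes "I \<in> imag_units" "cq_eval I w = 0"
  shows "(cq_scalar (Complex x y) - cq_of_quat (qcnj (of_real x + of_real y * I))) * w = 0"
proof -
  have re: "cq_Re w = - (I * cq_Im w)"
    using assms(2) by (simp add: cq_eval_def eq_neg_iff_add_eq_0)
  have I: "qRe I = 0" using assms(1) by (simp add: imag_units_iff)
  have lin: "cq_scalar (Complex x y) - cq_of_quat (qcnj (of_real x + of_real y * I)) =
      cq_scalar (of_real y) * (cq_scalar \<i> + cq_of_quat I)"
    by (simp add: cquat_eq_iff I complex_eq_iff)
  have "cq_Re ((cq_scalar \<i> + cq_of_quat I) * w) = I * cq_Re w - cq_Im w"
    "cq_Im ((cq_scalar \<i> + cq_of_quat I) * w) = cq_Re w + I * cq_Im w"
    by (simp_all add: quat_eq_iff)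
  then have "(cq_scalar \<i> + cq_of_quat I) * w = 0"
    using imag_units_square_left[OF assms(1), of "cq_Im w"] re
    by (simp add: cq_eq_0_iff)
  then show ?thesis unfolding lin by (simp add: mult.assoc)
qed

text \<open>The result does not involve \<open>I\<close>: the symmetrization cannot see where on its
  sphere a linear factor vanishes.\<close>

lemma cq_linear_mult_linear_cnj:
  fixes x y :: real
  assumes "I \<in> imag_units"
  defines "p \<equiv> of_real x + of_real y * I"
  shows "(cq_scalar z - cq_of_quat p) * (cq_scalar z - cq_of_quat (qcnj p)) =
      cq_scalar ((z - Complex x y) * (z - Complex x (- y)))" (is ?A)
    and "(cq_scalar z - cq_of_quat (qcnj p)) * (cq_scalar z - cq_of_quat p) =
      cq_scalar ((z - Complex x y) * (z - Complex x (- y)))" (is ?B)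
    and "cq_norm (cq_scalar z - cq_of_quat p) = (z - Complex x y) * (z - Complex x (- y))" (is ?C)
proof -
  have I: "qRe I = 0" "(qIm1 I)\<^sup>2 + (qIm2 I)\<^sup>2 + (qIm3 I)\<^sup>2 = 1"
    using assms by (simp_all add: imag_units_iff)
  have I2: "(complex_of_real (qIm1 I))\<^sup>2 + (of_real (qIm2 I))\<^sup>2 + (of_real (qIm3 I))\<^sup>2 = 1"
    using arg_cong[OF I(2), of complex_of_real] by simp
  have C: "Complex x y = of_real x + \<i> * of_real y" "Complex x (- y) = of_real x - \<i> * of_real y"
    by (simp_all add: complex_eq_iff)
  have D: "(z - Complex x y) * (z - Complex x (- y)) = (z - of_real x)\<^sup>2 + of_real y ^ 2"
    unfolding C using i_squared by algebra
  have "(of_real y * of_real (qIm1 I))\<^sup>2 + (of_real y * of_real (qIm2 I))\<^sup>2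
      + (of_real y * of_real (qIm3 I))\<^sup>2 = of_real y ^ 2 *
      ((complex_of_real (qIm1 I))\<^sup>2 + (of_real (qIm2 I))\<^sup>2 + (of_real (qIm3 I))\<^sup>2)"
    by (simp only: power_mult_distrib distrib_left)
  then have E: "(z - of_real x)\<^sup>2 + (of_real y * of_real (qIm1 I))\<^sup>2 + (of_real y * of_real (qIm2 I))\<^sup>2
      + (of_real y * of_real (qIm3 I))\<^sup>2 = (z - of_real x)\<^sup>2 + of_real y ^ 2"
    unfolding I2 by (simp only: mult_1_right add.assoc)
  show ?C
    unfolding D E[symmetric] by (simp add: p_def cq_norm_def I(1))
  show ?A ?B
    unfolding D E[symmetric]
    by (simp_all add: p_def cquat_eq_iff I(1) power2_eq_square)
qed

section \<open>Stem functions\<close>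

definition cq_has_deriv :: "(complex \<Rightarrow> cquat) \<Rightarrow> cquat \<Rightarrow> complex \<Rightarrow> bool"
  where "cq_has_deriv F F' z \<longleftrightarrow>
    ((\<lambda>w. cq0 (F w)) has_field_derivative cq0 F') (at z) \<and>
    ((\<lambda>w. cq1 (F w)) has_field_derivative cq1 F') (at z) \<and>
    ((\<lambda>w. cq2 (F w)) has_field_derivative cq2 F') (at z) \<and>
    ((\<lambda>w. cq3 (F w)) has_field_derivative cq3 F') (at z)"

definition cq_holomorphic_on :: "(complex \<Rightarrow> cquat) \<Rightarrow> complex set \<Rightarrow> bool"
  where "cq_holomorphic_on F A \<longleftrightarrow>
    (\<lambda>z. cq0 (F z)) holomorphic_on A \<and> (\<lambda>z. cq1 (F z)) holomorphic_on A \<and>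
    (\<lambda>z. cq2 (F z)) holomorphic_on A \<and> (\<lambda>z. cq3 (F z)) holomorphic_on A"

definition cq_deriv :: "(complex \<Rightarrow> cquat) \<Rightarrow> complex \<Rightarrow> cquat"
  where "cq_deriv F z = CQuat (deriv (\<lambda>w. cq0 (F w)) z) (deriv (\<lambda>w. cq1 (F w)) z)
    (deriv (\<lambda>w. cq2 (F w)) z) (deriv (\<lambda>w. cq3 (F w)) z)"

lemma cq_holomorphic_derivI:
  "\<lbrakk>cq_holomorphic_on F A; open A; z \<in> A\<rbrakk> \<Longrightarrow> cq_has_deriv F (cq_deriv F z) z"
  by (auto simp: cq_holomorphic_on_def cq_has_deriv_def cq_deriv_def intro: holomorphic_derivI)

lemma cq_holomorphic_mult:
  "\<lbrakk>cq_holomorphic_on F A; cq_holomorphic_on G A\<rbrakk> \<Longrightarrow> cq_holomorphic_on (\<lambda>z. F z * G z) A"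
  unfolding cq_holomorphic_on_def cquat_simps by (intro conjI holomorphic_intros; simp)

lemma cq_holomorphic_diff:
  "\<lbrakk>cq_holomorphic_on F A; cq_holomorphic_on G A\<rbrakk> \<Longrightarrow> cq_holomorphic_on (\<lambda>z. F z - G z) A"
  unfolding cq_holomorphic_on_def cquat_simps by (intro conjI holomorphic_intros; simp)

lemma cq_holomorphic_const: "cq_holomorphic_on (\<lambda>z. w) A"
  by (simp add: cq_holomorphic_on_def)

lemma cq_holomorphic_scalar:
  "g holomorphic_on A \<Longrightarrow> cq_holomorphic_on (\<lambda>z. cq_scalar (g z)) A"
  by (simp add: cq_holomorphic_on_def)

lemma cq_norm_holomorphic:
  "cq_holomorphic_on F A \<Longrightarrow> (\<lambda>z. cq_norm (F z)) holomorphic_on A"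
  unfolding cq_holomorphic_on_def cq_norm_def by (intro holomorphic_intros; simp)

lemma cq_Re_Im_expand:
  "cq_Re w = Re (cq0 w) *\<^sub>R 1 + Re (cq1 w) *\<^sub>R quat_i + Re (cq2 w) *\<^sub>R quat_j + Re (cq3 w) *\<^sub>R quat_k"
  "cq_Im w = Im (cq0 w) *\<^sub>R 1 + Im (cq1 w) *\<^sub>R quat_i + Im (cq2 w) *\<^sub>R quat_j + Im (cq3 w) *\<^sub>R quat_k"
  by (simp_all add: quat_eq_iff)

lemma
  assumes "cq_has_deriv F F' z"
  shows cq_Re_has_derivative:
      "((\<lambda>w. cq_Re (F w)) has_derivative (\<lambda>h. cq_Re (cq_scalar h * F'))) (at z)"
    and cq_Im_has_derivative:
      "((\<lambda>w. cq_Im (F w)) has_derivative (\<lambda>h. cq_Im (cq_scalar h * F'))) (at z)"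
proof -
  have d: "((\<lambda>w. cq0 (F w)) has_derivative (\<lambda>h. h * cq0 F')) (at z)"
    "((\<lambda>w. cq1 (F w)) has_derivative (\<lambda>h. h * cq1 F')) (at z)"
    "((\<lambda>w. cq2 (F w)) has_derivative (\<lambda>h. h * cq2 F')) (at z)"
    "((\<lambda>w. cq3 (F w)) has_derivative (\<lambda>h. h * cq3 F')) (at z)"
    using assms by (simp_all add: cq_has_deriv_def has_field_derivative_def mult.commute[of _ "cq0 F'"]
        mult.commute[of _ "cq1 F'"] mult.commute[of _ "cq2 F'"] mult.commute[of _ "cq3 F'"])
  have s: "cq0 (cq_scalar h * F') = h * cq0 F'" "cq1 (cq_scalar h * F') = h * cq1 F'"
    "cq2 (cq_scalar h * F') = h * cq2 F'" "cq3 (cq_scalar h * F') = h * cq3 F'" for h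
    by simp_all
  note Re = bounded_linear.has_derivative[OF bounded_linear_Re]
  note Im = bounded_linear.has_derivative[OF bounded_linear_Im]
  show "((\<lambda>w. cq_Re (F w)) has_derivative (\<lambda>h. cq_Re (cq_scalar h * F'))) (at z)"
    unfolding cq_Re_Im_expand s
    by (intro has_derivative_add has_derivative_scaleR_left Re d)
  show "((\<lambda>w. cq_Im (F w)) has_derivative (\<lambda>h. cq_Im (cq_scalar h * F'))) (at z)"
    unfolding cq_Re_Im_expand s
    by (intro has_derivative_add has_derivative_scaleR_left Im d)
qed

lemma cq_eval_has_derivative:
  assumes "cq_has_deriv F F' z"
  shows "((\<lambda>w. cq_eval I (F w)) has_derivative (\<lambda>h. cq_eval I (cq_scalar h * F'))) (at z)"
  unfolding cq_eval_def
  by (intro has_derivative_add has_derivative_mult_right cq_Re_has_derivative[OF assms]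
      cq_Im_has_derivative[OF assms])

lemma bounded_linear_slice_emb: "bounded_linear (slice_emb I)"
  unfolding slice_emb_def
  by (intro bounded_linear_add bounded_linear_of_real[THEN bounded_linear_compose]
      bounded_linear_mult_left[THEN bounded_linear_compose] bounded_linear_Re bounded_linear_Im)

lemma bounded_linear_Complex_pair: "bounded_linear (\<lambda>p. Complex (fst p) (snd p))"
proof -
  have "bounded_linear (\<lambda>p :: real \<times> real. of_real (fst p) + \<i> * of_real (snd p))"
    by (intro bounded_linear_add bounded_linear_of_real[THEN bounded_linear_compose]
      bounded_linear_mult_right[THEN bounded_linear_compose] bounded_linear_fst bounded_linear_snd)
  then show ?thesis by (simp add: Complex_eq)
qed

text \<open>Read off on the slice of \<open>quat_i\<close>; for an axially symmetric set every other
  slice gives the same subset of the plane.\<close>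

definition slice_trace :: "quat set \<Rightarrow> complex set"
  where "slice_trace \<Omega> = {z. quat_of_complex z \<in> \<Omega>}"

text \<open>A stem with components \<open>F0\<close> to \<open>F3\<close> splits on the slice of
  \<open>quat_i\<close> as \<open>g = F0 + \<i> F1\<close>, \<open>h = F2 + \<i> F3\<close>, and its
  conjugation symmetry gives \<open>hat g = F0 - \<i> F1\<close>,
  \<open>hat h = F2 - \<i> F3\<close>. The definition solves these equations for the
  components.\<close>

definition stem_of :: "(quat \<Rightarrow> quat) \<Rightarrow> complex \<Rightarrow> cquat"
  where "stem_of f z = CQuat
    ((split1 f z + hat (split1 f) z) / 2) (- (\<i> / 2) * (split1 f z - hat (split1 f) z))
    ((split2 f z + hat (split2 f) z) / 2) (- (\<i> / 2) * (split2 f z - hat (split2 f) z))"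

text \<open>Polar coordinates \<open>q = Re q + |Im q| I\<close>; on the real axis the unit is chosen arbitrarily.\<close>

definition qvec :: "quat \<Rightarrow> quat"
  where "qvec q = q - of_real (qRe q)"

definition qpolar :: "quat \<Rightarrow> complex"
  where "qpolar q = Complex (qRe q) (norm (qvec q))"

definition qunit :: "quat \<Rightarrow> quat"
  where "qunit q = (if qvec q = 0 then quat_i else sgn (qvec q))"

lemma qunit_imag_unit: "qunit q \<in> imag_units"
proof (cases "qvec q = 0")
  case False
  have "norm (sgn (qvec q)) = 1" using False by (simp add: norm_sgn)
  then have "inner (sgn (qvec q)) (sgn (qvec q)) = 1" by (simp add: norm_eq_1)
  moreover have "qRe (sgn (qvec q)) = 0" by (simp add: sgn_quat_def qvec_def)
  ultimately show ?thesis
    using False by (simp add: qunit_def imag_units_iff inner_quat_def power2_eq_square)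
qed (simp add: qunit_def)

lemma slice_emb_polar: "slice_emb (qunit q) (qpolar q) = q"
proof (cases "qvec q = 0")
  case True
  then show ?thesis by (simp add: slice_emb_def qpolar_def qvec_def)
next
  case False
  then show ?thesis
    by (simp add: slice_emb_def qpolar_def qunit_def sgn_div_norm of_real_def) (simp add: qvec_def of_real_def)
qed

lemma Im_qpolar_nonneg: "Im (qpolar q) \<ge> 0"
  by (simp add: qpolar_def)

lemma qvec_slice_emb:
  assumes "I \<in> imag_units"
  shows "qvec (slice_emb I z) = of_real (Im z) * I" "qRe (slice_emb I z) = Re z"
  using assms by (simp_all add: qvec_def slice_emb_def imag_units_iff)

lemma qpolar_slice_emb:
  assumes "I \<in> imag_units"
  shows "qpolar (slice_emb I z) = Complex (Re z) \<bar>Im z\<bar>"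
  by (simp add: qpolar_def qvec_slice_emb[OF assms] norm_mult norm_imag_unit[OF assms])

lemma qunit_slice_emb:
  assumes "I \<in> imag_units"
  shows "Im z > 0 \<Longrightarrow> qunit (slice_emb I z) = I" "Im z < 0 \<Longrightarrow> qunit (slice_emb I z) = - I"
  using imag_units_nonzero[OF assms] norm_imag_unit[OF assms]
  by (simp_all add: qunit_def qvec_slice_emb[OF assms] sgn_div_norm norm_mult of_real_def)

lemma slice_sphere_eq: "slice_sphere x y = (\<lambda>I. slice_emb I (Complex x y)) ` imag_units"
  by (auto simp: slice_sphere_def slice_emb_def)

lemma slice_sphere_uminus: "slice_sphere x (- y) = slice_sphere x y"
proof -
  have "slice_sphere x (- y) \<subseteq> slice_sphere x y" for y
    unfolding slice_sphere_eq
    by (metis (no_types, lifting) complex_cnj slice_emb_uminus_cnj imag_units_uminus image_subsetI imageI complex_cnj_cnj)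
  from this[of y] this[of "- y"] show ?thesis by simp
qed

lemma mem_slice_sphere_iff: "q \<in> slice_sphere x y \<longleftrightarrow> qpolar q = Complex x \<bar>y\<bar>"
proof
  assume "q \<in> slice_sphere x y"
  then show "qpolar q = Complex x \<bar>y\<bar>"
    by (auto simp: slice_sphere_eq qpolar_slice_emb)
next
  assume "qpolar q = Complex x \<bar>y\<bar>"
  then have "q \<in> slice_sphere x \<bar>y\<bar>"
    unfolding slice_sphere_eq using slice_emb_polar[of q] qunit_imag_unit[of q] by (metis imageI)
  then show "q \<in> slice_sphere x y"
    by (cases "y \<ge> 0") (simp_all add: slice_sphere_uminus)
qed

locale symmetric_slice =
  fixes \<Omega> :: "quat set"
  assumes domain: "symmetric_slice_domain \<Omega>"
begin

abbreviation D :: "complex set"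
  where "D \<equiv> slice_trace \<Omega>"

text \<open>The symmetry makes the evaluations at \<open>(I, z)\<close> and
  \<open>(- I, cnj z)\<close> agree, as they must, since both pairs name the same point.\<close>

definition stem :: "(complex \<Rightarrow> cquat) \<Rightarrow> bool"
  where "stem F \<longleftrightarrow> cq_holomorphic_on F D \<and> (\<forall>z\<in>D. F (cnj z) = cq_cnj (F z))"

definition induces :: "(complex \<Rightarrow> cquat) \<Rightarrow> (quat \<Rightarrow> quat) \<Rightarrow> bool"
  where "induces F f \<longleftrightarrow> stem F \<and> (\<forall>I\<in>imag_units. \<forall>z\<in>D. f (slice_emb I z) = cq_eval I (F z))"

text \<open>The value 0 outside the domain is the one chosen in \<open>regular_product\<close>, so
  that the two can be equal as total functions.\<close>

definition induced :: "(complex \<Rightarrow> cquat) \<Rightarrow> quat \<Rightarrow> quat"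
  where "induced F q = (if q \<in> \<Omega> then cq_eval (qunit q) (F (qpolar q)) else 0)"

lemma open_domain: "open \<Omega>"
  using domain by (simp add: symmetric_slice_domain_def)

lemma slice_emb_mem_iff:
  assumes "I \<in> imag_units"
  shows "slice_emb I z \<in> \<Omega> \<longleftrightarrow> z \<in> D"
proof -
  have *: "slice_emb J z \<in> \<Omega>" if "slice_emb I z \<in> \<Omega>" "I \<in> imag_units" "J \<in> imag_units" for I J
  proof -
    have "slice_sphere (Re z) (Im z) \<subseteq> \<Omega>"
      using domain that unfolding symmetric_slice_domain_def slice_emb_def by blast
    then show ?thesis using that(3) unfolding slice_sphere_eq by auto
  qed
  show ?thesis
    using *[of I quat_i] *[of quat_i I] assms
    by (auto simp: slice_trace_def quat_of_complex_eq_slice_emb)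
qed

lemma mem_iff_qpolar: "q \<in> \<Omega> \<longleftrightarrow> qpolar q \<in> D"
  by (metis slice_emb_mem_iff slice_emb_polar qunit_imag_unit)

lemma slice_sphere_subset_iff: "slice_sphere x y \<subseteq> \<Omega> \<longleftrightarrow> Complex x y \<in> D"
  unfolding slice_sphere_eq using quat_i_imag_unit slice_emb_mem_iff by blast

lemma cnj_mem_D: "cnj z \<in> D \<longleftrightarrow> z \<in> D"
  by (metis complex_cnj_cnj imag_units_uminus quat_i_imag_unit slice_emb_mem_iff slice_emb_uminus_cnj)

lemma cnj_image_D: "cnj ` D = D"
  by (force simp: cnj_mem_D intro: image_eqI[where x = "cnj _"])

lemma open_D: "open D"
proof -
  have "D = slice_emb quat_i -` \<Omega>"
    by (auto simp: slice_trace_def quat_of_complex_eq_slice_emb)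
  then show ?thesis
    using open_domain bounded_linear_slice_emb
    by (metis continuous_on_open_vimage linear_continuous_on open_UNIV Int_UNIV_right)
qed

lemma connected_D: "connected D"
proof -
  define c where "c = (\<lambda>q. Complex (qRe q) (qIm1 q))"
  have c_eq: "c = (\<lambda>q. of_real (inner q 1) + \<i> * of_real (inner q quat_i))"
    by (auto simp: c_def inner_quat_def complex_eq_iff)
  have "D = c ` (\<Omega> \<inter> slice quat_i)"
  proof
    show "D \<subseteq> c ` (\<Omega> \<inter> slice quat_i)"
    proof
      fix z assume "z \<in> D"
      then have "slice_emb quat_i z \<in> \<Omega> \<inter> slice quat_i"
        using slice_emb_mem_iff[OF quat_i_imag_unit, of z] by (auto simp: slice_def slice_emb_def)
      moreover have "c (slice_emb quat_i z) = z" by (simp add: c_def slice_emb_def)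
      ultimately show "z \<in> c ` (\<Omega> \<inter> slice quat_i)" by (metis imageI)
    qed
    show "c ` (\<Omega> \<inter> slice quat_i) \<subseteq> D"
      by (auto simp: slice_def c_def slice_trace_def quat_of_complex_def)
  qed
  moreover have "connected (\<Omega> \<inter> slice quat_i)"
    using domain quat_i_imag_unit unfolding symmetric_slice_domain_def by blast
  moreover have "continuous_on (\<Omega> \<inter> slice quat_i) c"
    unfolding c_eq by (intro continuous_intros)
  ultimately show ?thesis by (metis connected_continuous_image)
qed

lemma ex_real_D: "\<exists>x. complex_of_real x \<in> D"
proof -
  obtain x where "of_real x \<in> \<Omega>"
    using domain unfolding symmetric_slice_domain_def Reals_def by auto
  then have "complex_of_real x \<in> D" by (simp add: slice_trace_def quat_of_complex_def)
  then show ?thesis by blast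
qed

text \<open>The identity theorem: \<open>D\<close> is connected and contains a real point, which the
  reals of the open set \<open>D\<close> accumulate at.\<close>

lemma holomorphic_zero_on_reals:
  assumes "g holomorphic_on D" "\<And>x. of_real x \<in> D \<Longrightarrow> g (of_real x) = 0" "z \<in> D"
  shows "g z = 0"
proof -
  obtain x where x: "complex_of_real x \<in> D" using ex_real_D by blast
  obtain e where e: "e > 0" "ball (of_real x) e \<subseteq> D"
    using open_D x openE by blast
  show ?thesis
  proof (rule analytic_continuation[OF assms(1) open_D connected_D _ x _ _ assms(3)])
    show "D \<inter> \<real> \<subseteq> D" by simp
    show "complex_of_real x islimpt D \<inter> \<real>"
      unfolding islimpt_approachable
    proof (intro allI impI)
      fix d :: real assume "d > 0"
      define y where "y = x + min d e / 2"
      have "complex_of_real y - of_real x = of_real (min d e / 2)" by (simp add: y_def)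
      then have "dist (complex_of_real y) (of_real x) = min d e / 2"
        using e \<open>d > 0\<close> by (simp only: dist_norm norm_of_real)
      moreover have "min d e / 2 < d" "min d e / 2 < e" "min d e / 2 > 0" using e \<open>d > 0\<close> by auto
      ultimately show "\<exists>x'\<in>D \<inter> \<real>. x' \<noteq> complex_of_real x \<and> dist x' (complex_of_real x) < d"
        using e(2) by (intro bexI[of _ "of_real y"]) (auto simp: dist_commute)
    qed
  qed (use assms(2) in \<open>auto elim: Reals_cases\<close>)
qed

lemma holomorphic_hat: "g holomorphic_on D \<Longrightarrow> hat g holomorphic_on D"
  using holomorphic_on_compose_cnj_cnj[of g D] open_D
  by (simp add: cnj_image_D o_def hat_def[abs_def])

lemma stem_mult: "\<lbrakk>stem F; stem G\<rbrakk> \<Longrightarrow> stem (\<lambda>z. F z * G z)"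
  by (simp add: stem_def cq_holomorphic_mult cq_cnj_mult)

lemma stem_diff: "\<lbrakk>stem F; stem G\<rbrakk> \<Longrightarrow> stem (\<lambda>z. F z - G z)"
  by (simp add: stem_def cq_holomorphic_diff cq_cnj_diff)

lemma stem_of_quat: "stem (\<lambda>z. cq_of_quat q)"
  by (simp add: stem_def cq_holomorphic_const cq_cnj_of_quat)

lemma stem_scalar:
  "\<lbrakk>g holomorphic_on D; \<And>z. z \<in> D \<Longrightarrow> g (cnj z) = cnj (g z)\<rbrakk> \<Longrightarrow> stem (\<lambda>z. cq_scalar (g z))"
  by (simp add: stem_def cq_holomorphic_scalar cq_cnj_scalar)

lemma stem_cnj: "\<lbrakk>stem F; z \<in> D\<rbrakk> \<Longrightarrow> F (cnj z) = cq_cnj (F z)"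
  by (simp add: stem_def)

lemma stem_real:
  assumes "stem F" "z \<in> D" "Im z = 0"
  shows "cq_cnj (F z) = F z" "F z = cq_of_quat (cq_Re (F z))" "cq_eval I (F z) = cq_Re (F z)"
proof -
  have "cnj z = z" using assms(3) by (simp add: complex_eq_iff)
  then show *: "cq_cnj (F z) = F z" using stem_cnj[OF assms(1,2)] by simp
  show "F z = cq_of_quat (cq_Re (F z))" "cq_eval I (F z) = cq_Re (F z)"
    using cq_eval_real[OF *] by simp_all
qed

text \<open>\<open>qpolar\<close> always lands in the closed upper half plane. Below the real axis
  the pair \<open>(I, z)\<close> is exchanged for \<open>(- I, cnj z)\<close>; on it the unit is
  lost, but the stem value is real and evaluates alike at all units.\<close>

lemma induced_slice_emb:
  assumes "stem F" "I \<in> imag_units" "z \<in> D"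
  shows "induced F (slice_emb I z) = cq_eval I (F z)"
proof -
  have mem: "slice_emb I z \<in> \<Omega>" using assms slice_emb_mem_iff by simp
  consider "Im z > 0" | "Im z = 0" | "Im z < 0" by linarith
  then show ?thesis
  proof cases
    case 1
    then have "qpolar (slice_emb I z) = z" by (simp add: qpolar_slice_emb[OF assms(2)] complex_eq_iff)
    then show ?thesis using mem 1 by (simp add: induced_def qunit_slice_emb[OF assms(2)])
  next
    case 2
    then have "qpolar (slice_emb I z) = z" by (simp add: qpolar_slice_emb[OF assms(2)] complex_eq_iff)
    then show ?thesis using mem stem_real(3)[OF assms(1,3) 2] by (simp add: induced_def)
  next
    case 3
    then have "qpolar (slice_emb I z) = cnj z"
      by (simp add: qpolar_slice_emb[OF assms(2)] complex_eq_iff)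
    then show ?thesis
      using mem 3 stem_cnj[OF assms(1,3)]
      by (simp add: induced_def qunit_slice_emb[OF assms(2)] cq_eval_uminus_cnj)
  qed
qed

lemma induces_induced: "stem F \<Longrightarrow> induces F (induced F)"
  by (simp add: induces_def induced_slice_emb)

lemma induces_stem: "induces F f \<Longrightarrow> stem F"
  by (simp add: induces_def)

lemma induces_eval: "\<lbrakk>induces F f; I \<in> imag_units; z \<in> D\<rbrakk> \<Longrightarrow> f (slice_emb I z) = cq_eval I (F z)"
  by (simp add: induces_def)

lemma induces_polar: "\<lbrakk>induces F f; q \<in> \<Omega>\<rbrakk> \<Longrightarrow> f q = cq_eval (qunit q) (F (qpolar q))"
  using induces_eval[of F f "qunit q" "qpolar q"]
  by (simp add: qunit_imag_unit mem_iff_qpolar slice_emb_polar)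

lemma induces_cong:
  assumes "induces F f" "stem G" "\<And>z. z \<in> D \<Longrightarrow> F z = G z" "\<And>q. q \<in> \<Omega> \<Longrightarrow> f q = g q"
  shows "induces G g"
  unfolding induces_def
proof (intro conjI ballI assms(2))
  fix I z assume "I \<in> imag_units" "z \<in> D"
  then show "g (slice_emb I z) = cq_eval I (G z)"
    using assms(3) assms(4)[of "slice_emb I z"] induces_eval[OF assms(1)]
    by (simp add: slice_emb_mem_iff)
qed

section \<open>Regular functions correspond to stem functions\<close>

lemma slice_regular_if_induces:
  assumes "induces F f"
  shows "slice_regular \<Omega> f"
  unfolding slice_regular_def
proof (intro ballI allI impI)
  fix I x y assume I: "I \<in> imag_units" and "of_real x + of_real y * I \<in> \<Omega>"
  then have z: "Complex x y \<in> D"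
    using slice_emb_mem_iff[OF I, of "Complex x y"] by (simp add: slice_emb_def)
  have hol: "cq_holomorphic_on F D" using assms by (simp add: induces_def stem_def)
  define F' where "F' = cq_deriv F (Complex x y)"
  define c where "c = (\<lambda>p :: real \<times> real. Complex (fst p) (snd p))"
  have "((\<lambda>w. cq_eval I (F w)) has_derivative (\<lambda>h. cq_eval I (cq_scalar h * F')))
      (at (c (x, y)) within range c)"
    unfolding F'_def c_def using cq_eval_has_derivative[OF cq_holomorphic_derivI[OF hol open_D z]]
    by (auto intro: has_derivative_at_withinI)
  then have "((\<lambda>w. cq_eval I (F w)) \<circ> c has_derivative (\<lambda>h. cq_eval I (cq_scalar h * F')) \<circ> c) (at (x, y))"
    unfolding c_def
    by (intro diff_chain_within bounded_linear_imp_has_derivative bounded_linear_Complex_pair)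
  moreover have "open (c -` D)"
    using open_D bounded_linear_Complex_pair
    unfolding c_def by (metis (no_types, lifting) continuous_on_open_vimage linear_continuous_on open_UNIV Int_UNIV_right)
  moreover have "(x, y) \<in> c -` D" using z by (simp add: c_def)
  moreover have "((\<lambda>w. cq_eval I (F w)) \<circ> c) p = (\<lambda>(s, t). f (of_real s + of_real t * I)) p"
    if "p \<in> c -` D" for p
    using that induces_eval[OF assms I, of "c p"] by (auto simp: c_def slice_emb_def split: prod.splits)
  ultimately have "((\<lambda>(s, t). f (of_real s + of_real t * I)) has_derivative
      (\<lambda>h. cq_eval I (cq_scalar h * F')) \<circ> c) (at (x, y))"
    using has_derivative_transform_within_open by blast
  \<comment> \<open>Evaluation turns the central \<open>\<i>\<close> into left multiplication by
    \<open>I\<close>, so the derivative along \<open>y\<close> is \<open>I\<close> times the one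
    along \<open>x\<close>.\<close>
  moreover have "(1/2) *\<^sub>R (((\<lambda>h. cq_eval I (cq_scalar h * F')) \<circ> c) (1, 0) +
      I * ((\<lambda>h. cq_eval I (cq_scalar h * F')) \<circ> c) (0, 1)) = 0"
    by (simp add: c_def cq_eval_scalar_mult[OF I] slice_emb_def imag_units_square_left[OF I])
  ultimately show "\<exists>D. ((\<lambda>(s, t). f (of_real s + of_real t * I)) has_derivative D) (at (x, y)) \<and>
      (1/2) *\<^sub>R (D (1, 0) + I * D (0, 1)) = 0"
    by blast
qed

text \<open>Pairing with \<open>u\<close> and \<open>I * u\<close> is complex linear when
  \<open>\<i>\<close> acts as left multiplication by \<open>I\<close>, so it turns regularity on the
  slice into ordinary holomorphy. On the slice of \<open>quat_i\<close> the choices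
  \<open>u = 1\<close> and \<open>u = quat_j\<close> are the two splitting functions.\<close>

lemma slice_component_holomorphic:
  assumes "slice_regular \<Omega> f" "I \<in> imag_units"
  shows "(\<lambda>z. Complex (inner (f (slice_emb I z)) u) (inner (f (slice_emb I z)) (I * u))) holomorphic_on D"
  unfolding holomorphic_on_def
proof
  fix z assume "z \<in> D"
  define \<Lambda> where "\<Lambda> = (\<lambda>q. Complex (inner q u) (inner q (I * u)))"
  have \<Lambda>_eq: "\<Lambda> = (\<lambda>q. of_real (inner q u) + \<i> * of_real (inner q (I * u)))"
    by (simp add: \<Lambda>_def Complex_eq)
  have bl: "bounded_linear \<Lambda>"
    unfolding \<Lambda>_eq by (intro bounded_linear_add bounded_linear_of_real[THEN bounded_linear_compose]
      bounded_linear_mult_right[THEN bounded_linear_compose] bounded_linear_inner_left)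
  have I_mult: "\<Lambda> (I * q) = \<i> * \<Lambda> q" for q
    by (simp add: \<Lambda>_def complex_eq_iff inner_imag_unit_mult[OF assms(2)]
        imag_units_square_left[OF assms(2)])
  have "of_real (Re z) + of_real (Im z) * I \<in> \<Omega>"
    using \<open>z \<in> D\<close> slice_emb_mem_iff[OF assms(2), of z] by (simp add: slice_emb_def)
  then obtain E where E: "((\<lambda>(s, t). f (of_real s + of_real t * I)) has_derivative E) (at (Re z, Im z))"
    and CR: "(1/2) *\<^sub>R (E (1, 0) + I * E (0, 1)) = 0"
    using assms unfolding slice_regular_def by meson
  have "((\<lambda>z. (Re z, Im z)) has_derivative (\<lambda>z. (Re z, Im z))) (at z)"
    by (intro bounded_linear_imp_has_derivative bounded_linear_Pair bounded_linear_Re bounded_linear_Im)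
  then have "((\<lambda>(s, t). f (of_real s + of_real t * I)) \<circ> (\<lambda>z. (Re z, Im z)) has_derivative
      E \<circ> (\<lambda>z. (Re z, Im z))) (at z)"
    using E by (intro diff_chain_within) (auto intro: has_derivative_at_withinI)
  then have "((\<lambda>z. \<Lambda> (f (slice_emb I z))) has_derivative (\<lambda>h. \<Lambda> (E (Re h, Im h)))) (at z)"
    using bounded_linear.has_derivative[OF bl] by (simp add: o_def slice_emb_def)
  moreover have "\<Lambda> (E (Re h, Im h)) = \<Lambda> (E (1, 0)) * h" for h
  proof -
    have "linear E" using E has_derivative_linear by blast
    then have "E (Re h *\<^sub>R (1, 0) + Im h *\<^sub>R (0, 1)) = Re h *\<^sub>R E (1, 0) + Im h *\<^sub>R E (0, 1)"
      by (simp only: linear_add linear_scale)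
    moreover have "I * (E (1, 0) + I * E (0, 1)) = 0" using CR by simp
    then have "E (0, 1) = I * E (1, 0)"
      using imag_units_square_left[OF assms(2), of "E (0, 1)"] by (simp add: distrib_left)
    ultimately have "\<Lambda> (E (Re h, Im h)) = Re h *\<^sub>R \<Lambda> (E (1, 0)) + Im h *\<^sub>R (\<i> * \<Lambda> (E (1, 0)))"
      using bounded_linear.linear[OF bl] by (simp add: linear_add linear_scale I_mult)
    then show ?thesis by (simp add: complex_eq_iff algebra_simps)
  qed
  ultimately have "((\<lambda>z. \<Lambda> (f (slice_emb I z))) has_field_derivative \<Lambda> (E (1, 0))) (at z)"
    by (simp add: has_field_derivative_def)
  then show "(\<lambda>z. Complex (inner (f (slice_emb I z)) u) (inner (f (slice_emb I z)) (I * u)))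
      field_differentiable at z within D"
    unfolding \<Lambda>_def field_differentiable_def using has_field_derivative_at_within by blast
qed

lemma split_holomorphic:
  assumes "slice_regular \<Omega> f"
  shows "split1 f holomorphic_on D" "split2 f holomorphic_on D"
  using slice_component_holomorphic[OF assms quat_i_imag_unit, of 1]
    slice_component_holomorphic[OF assms quat_i_imag_unit, of quat_j]
  by (simp_all add: split1_def[abs_def] split2_def[abs_def] inner_quat_def quat_of_complex_eq_slice_emb)

lemma stem_stem_of:
  assumes "slice_regular \<Omega> f"
  shows "stem (stem_of f)"
proof -
  note hol = split_holomorphic[OF assms]
  note hol' = hol[THEN holomorphic_hat]
  have "cq_holomorphic_on (stem_of f) D"
    unfolding cq_holomorphic_on_def stem_of_def cquat.sel
    by (intro conjI holomorphic_intros hol hol'; simp)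
  then show ?thesis
    by (simp add: stem_def stem_of_def cquat_eq_iff hat_def algebra_simps)
qed

lemma stem_of_eval:
  "f (slice_emb quat_i z) = cq_eval quat_i (stem_of f z)"
  by (simp add: cq_eval_def quat_eq_iff stem_of_def split1_def split2_def hat_def
      quat_of_complex_eq_slice_emb field_simps)

lemma split_of_induces:
  assumes "induces F f" "z \<in> D"
  shows "split1 f z = cq0 (F z) + \<i> * cq1 (F z)" "split2 f z = cq2 (F z) + \<i> * cq3 (F z)"
    "hat (split1 f) z = cq0 (F z) - \<i> * cq1 (F z)" "hat (split2 f) z = cq2 (F z) - \<i> * cq3 (F z)"
proof -
  have s: "split1 f z = cq0 (F z) + \<i> * cq1 (F z)" "split2 f z = cq2 (F z) + \<i> * cq3 (F z)" if "z \<in> D" for z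
    using induces_eval[OF assms(1) quat_i_imag_unit that]
    by (simp_all add: split1_def split2_def quat_of_complex_eq_slice_emb cq_eval_def complex_eq_iff)
  show "split1 f z = cq0 (F z) + \<i> * cq1 (F z)" "split2 f z = cq2 (F z) + \<i> * cq3 (F z)"
    using s assms(2) by auto
  have "F (cnj z) = cq_cnj (F z)" "cnj z \<in> D"
    using assms by (auto simp: induces_def stem_def cnj_mem_D)
  then show "hat (split1 f) z = cq0 (F z) - \<i> * cq1 (F z)" "hat (split2 f) z = cq2 (F z) - \<i> * cq3 (F z)"
    using s[of "cnj z"] by (simp_all add: hat_def)
qed

lemma induces_unique:
  assumes "induces F f" "z \<in> D"
  shows "F z = stem_of f z"
  by (simp only: stem_of_def cquat_eq_iff cquat.sel split_of_induces[OF assms]) (simp add: algebra_simps)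

text \<open>The representation formula: on every slice the two sides are holomorphic and agree on the
  real axis.\<close>

theorem induces_stem_of:
  assumes "slice_regular \<Omega> f"
  shows "induces (stem_of f) f"
  unfolding induces_def
proof (intro conjI ballI stem_stem_of[OF assms])
  fix I z assume I: "I \<in> imag_units" and "z \<in> D"
  define g where "g = induced (stem_of f)"
  have g: "induces (stem_of f) g"
    unfolding g_def by (rule induces_induced[OF stem_stem_of[OF assms]])
  have reg: "slice_regular \<Omega> g" by (rule slice_regular_if_induces[OF g])
  have "inner (f (slice_emb I z)) u = inner (g (slice_emb I z)) u" for u
  proof -
    define c where "c = (\<lambda>f z. Complex (inner (f (slice_emb I z)) u) (inner (f (slice_emb I z)) (I * u)))"
    have "c f z - c g z = 0"
    proof (rule holomorphic_zero_on_reals[OF _ _ \<open>z \<in> D\<close>])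
      show "(\<lambda>z. c f z - c g z) holomorphic_on D"
        unfolding c_def by (intro holomorphic_on_diff slice_component_holomorphic assms reg I)
      fix x assume x: "complex_of_real x \<in> D"
      have "f (slice_emb quat_i (of_real x)) = g (slice_emb quat_i (of_real x))"
        using stem_of_eval[of f "of_real x"] induces_eval[OF g quat_i_imag_unit x] by simp
      then show "c f (of_real x) - c g (of_real x) = 0"
        by (simp add: c_def slice_emb_of_real)
    qed
    then show ?thesis by (simp add: c_def complex_eq_iff)
  qed
  then have "f (slice_emb I z) = g (slice_emb I z)"
    by (metis vector_eq_rdot)
  then show "f (slice_emb I z) = cq_eval I (stem_of f z)"
    using induces_eval[OF g I \<open>z \<in> D\<close>] by simp
qed

end

section \<open>Products, division and multiplicities\<close>

lemma non_zero_frequently: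
  assumes "f holomorphic_on A" "open A" "connected A" "z \<in> A" "\<beta> \<in> A" "f \<beta> \<noteq> 0"
  shows "\<forall>\<^sub>F w in at z. f w \<noteq> 0" "\<exists>\<^sub>F w in at z. f w \<noteq> 0"
proof -
  show *: "\<forall>\<^sub>F w in at z. f w \<noteq> 0"
    using non_zero_neighbour_alt[OF assms] by (rule eventually_mono) simp
  show "\<exists>\<^sub>F w in at z. f w \<noteq> 0"
    by (rule eventually_frequently[OF _ *]) simp
qed

text \<open>Orders add, and a factor vanishing at \<open>z\<close> has positive order. The strict
  drop drives the induction behind the factorization; the witness \<open>\<beta>\<close> excludes
  the zero function, which has no meaningful order.\<close>

lemma zorder_mult_vanishing:
  assumes "g holomorphic_on A" "k holomorphic_on A" "open A" "connected A" "z \<in> A" "g z = 0"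
    and "\<beta> \<in> A" "g \<beta> * k \<beta> \<noteq> 0"
  shows "0 \<le> zorder k z" "zorder k z < zorder (\<lambda>w. g w * k w) z"
proof -
  have an: "g analytic_on {z}" "k analytic_on {z}"
    using assms(1,2,3,5) analytic_at by blast+
  have nz: "g \<beta> \<noteq> 0" "k \<beta> \<noteq> 0" using assms(8) by auto
  note fg = non_zero_frequently[OF assms(1,3,4,5,7) nz(1)]
  note fk = non_zero_frequently[OF assms(2,3,4,5,7) nz(2)]
  show "0 \<le> zorder k z" by (rule zorder_ge_0[OF an(2) fk(2)])
  have "zorder g z > 0" using zorder_pos_iff'[OF an(1) fg(2)] assms(6) by simp
  moreover have "\<forall>\<^sub>F w in at z. g w * k w \<noteq> 0"
    using fg(1) fk(1) by eventually_elim simp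
  then have "zorder (\<lambda>w. g w * k w) z = zorder g z + zorder k z"
    using zorder_times_analytic[OF an] by simp
  ultimately show "zorder k z < zorder (\<lambda>w. g w * k w) z" by simp
qed

lemma holomorphic_divide_linear:
  assumes "g holomorphic_on A" "open A" "a \<in> A" "g a = 0"
  shows "\<exists>h. h holomorphic_on A \<and> (\<forall>z\<in>A. g z = (z - a) * h z)"
proof -
  define h where "h = (\<lambda>z. if z = a then deriv g a else g z / (z - a))"
  have "h holomorphic_on A"
    by (rule pole_theorem_open_0[OF assms(1,2), where a = a]) (simp_all add: h_def assms(4))
  then show ?thesis
    by (intro exI[of _ h]) (auto simp: h_def assms(4))
qed

text \<open>The real polynomial of the sphere, split into its roots. For \<open>y = 0\<close> they
  merge into a double root.\<close>

definition sphere_poly :: "real \<Rightarrow> real \<Rightarrow> complex \<Rightarrow> complex"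
  where "sphere_poly x y z = (z - Complex x y) * (z - Complex x (- y))"

lemma sphere_poly_cnj: "sphere_poly x y (cnj z) = cnj (sphere_poly x y z)"
  by (simp add: sphere_poly_def complex_eq_iff)

lemma sphere_poly_holomorphic: "sphere_poly x y holomorphic_on A"
  unfolding sphere_poly_def[abs_def] by (intro holomorphic_intros)

lemma sphere_poly_zero [simp]: "sphere_poly x y (Complex x y) = 0"
  by (simp add: sphere_poly_def)

lemma sphere_poly_altdef: "sphere_poly x y z = (z - of_real x)\<^sup>2 + of_real (y\<^sup>2)"
  by (simp add: sphere_poly_def complex_eq_iff power2_eq_square) (simp add: algebra_simps)

lemma slice_sphere_eq_iff:
  "slice_sphere x y = slice_sphere x' y' \<longleftrightarrow> x = x' \<and> \<bar>y\<bar> = \<bar>y'\<bar>"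
proof
  assume *: "slice_sphere x y = slice_sphere x' y'"
  have "slice_emb quat_i (Complex x y) \<in> slice_sphere x y"
    by (auto simp: slice_sphere_eq)
  then have "qpolar (slice_emb quat_i (Complex x y)) = Complex x \<bar>y\<bar>"
    "qpolar (slice_emb quat_i (Complex x y)) = Complex x' \<bar>y'\<bar>"
    using * by (simp_all only: flip: mem_slice_sphere_iff)
  then show "x = x' \<and> \<bar>y\<bar> = \<bar>y'\<bar>" by simp
next
  assume "x = x' \<and> \<bar>y\<bar> = \<bar>y'\<bar>"
  then show "slice_sphere x y = slice_sphere x' y'"
    by (auto simp: mem_slice_sphere_iff)
qed

definition linear_stem :: "quat list \<Rightarrow> complex \<Rightarrow> cquat \<Rightarrow> cquat"
  where "linear_stem ps z w = foldr (\<lambda>p w. (cq_scalar z - cq_of_quat p) * w) ps w"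

lemma linear_stem_simps [simp]:
  "linear_stem [] z w = w"
  "linear_stem (p # ps) z w = (cq_scalar z - cq_of_quat p) * linear_stem ps z w"
  by (simp_all add: linear_stem_def)

lemma cq_norm_linear_stem:
  assumes "set ps \<subseteq> slice_sphere x y"
  shows "cq_norm (linear_stem ps z w) = sphere_poly x y z ^ length ps * cq_norm w"
  using assms
proof (induction ps)
  case (Cons p ps)
  then obtain I where "I \<in> imag_units" "p = of_real x + of_real y * I"
    by (auto simp: slice_sphere_def)
  then have "cq_norm (cq_scalar z - cq_of_quat p) = sphere_poly x y z"
    using cq_linear_mult_linear_cnj(3)[of I z x y] by (simp add: sphere_poly_def)
  with Cons show ?case by (simp add: cq_norm_mult)
qed simp

context symmetric_slice
begin

lemma stem_of_cong:
  assumes "\<And>z. z \<in> D \<Longrightarrow> f (quat_of_complex z) = g (quat_of_complex z)" "z \<in> D"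
  shows "stem_of f z = stem_of g z"
  using assms(1)[OF assms(2)] assms(1)[of "cnj z"] assms(2)
  by (simp add: stem_of_def split1_def split2_def hat_def cnj_mem_D)

text \<open>\<open>stem_of\<close> reads a function on the slice of \<open>quat_i\<close> only, and
  the stem determines the function on the whole domain. This gives the uniqueness demanded by
  \<open>regular_product\<close>.\<close>

lemma slice_regular_eqI:
  assumes "slice_regular \<Omega> f" "slice_regular \<Omega> g"
    and "\<And>z. z \<in> D \<Longrightarrow> f (quat_of_complex z) = g (quat_of_complex z)" "q \<in> \<Omega>"
  shows "f q = g q"
proof -
  have "stem_of f (qpolar q) = stem_of g (qpolar q)"
    using stem_of_cong[of f g] assms(3,4) mem_iff_qpolar by simp
  then show ?thesis
    using induces_polar[OF induces_stem_of[OF assms(1)] assms(4)]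
      induces_polar[OF induces_stem_of[OF assms(2)] assms(4)] by simp
qed

text \<open>Expressed in stem components, with \<open>g = F0 + \<i> F1\<close> and
  \<open>hat g = F0 - \<i> F1\<close>, the formula that defines the regular product is quaternion
  multiplication.\<close>

lemma induces_regular_product:
  assumes "induces F f" "induces G g"
  shows "induces (\<lambda>z. F z * G z) (regular_product \<Omega> f g)"
proof -
  define P where "P = induced (\<lambda>z. F z * G z)"
  have stem: "stem (\<lambda>z. F z * G z)" using assms by (intro stem_mult) (simp_all add: induces_def)
  have P: "induces (\<lambda>z. F z * G z) P" unfolding P_def by (rule induces_induced[OF stem])
  have formula: "P (quat_of_complex z) =
      quat_of_complex (split1 f z * split1 g z - split2 f z * hat (split2 g) z) +
      quat_of_complex (split1 f z * split2 g z + split2 f z * hat (split1 g) z) * quat_j"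
    if "quat_of_complex z \<in> \<Omega>" for z
  proof -
    have z: "z \<in> D" using that by (simp add: slice_trace_def)
    have "split1 P z = split1 f z * split1 g z - split2 f z * hat (split2 g) z"
      "split2 P z = split1 f z * split2 g z + split2 f z * hat (split1 g) z"
      unfolding split_of_induces[OF assms(1) z] split_of_induces[OF assms(2) z]
        split_of_induces[OF P z]
      by (simp_all add: algebra_simps)
    then show ?thesis by (simp only: split_decomposition[of P])
  qed
  have "regular_product \<Omega> f g = P"
    unfolding regular_product_def
  proof (rule the_equality, intro conjI allI impI)
    show "slice_regular \<Omega> P" by (rule slice_regular_if_induces[OF P])
    show "P q = 0" if "q \<notin> \<Omega>" for q using that by (simp add: P_def induced_def)
  next
    fix z assume "quat_of_complex z \<in> \<Omega>"
    then show "P (quat_of_complex z) =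
      quat_of_complex (split1 f z * split1 g z - split2 f z * hat (split2 g) z) +
      quat_of_complex (split1 f z * split2 g z + split2 f z * hat (split1 g) z) * quat_j"
      by (rule formula)
  next
    fix Q assume Q: "slice_regular \<Omega> Q \<and> (\<forall>q. q \<notin> \<Omega> \<longrightarrow> Q q = 0) \<and>
      (\<forall>z. quat_of_complex z \<in> \<Omega> \<longrightarrow> Q (quat_of_complex z) =
        quat_of_complex (split1 f z * split1 g z - split2 f z * hat (split2 g) z) +
        quat_of_complex (split1 f z * split2 g z + split2 f z * hat (split1 g) z) * quat_j)"
    show "Q = P"
    proof
      fix q show "Q q = P q"
      proof (cases "q \<in> \<Omega>")
        case True
        show ?thesis
        proof (rule slice_regular_eqI[OF _ slice_regular_if_induces[OF P] _ True])
          show "slice_regular \<Omega> Q" using Q by blast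
          show "Q (quat_of_complex z) = P (quat_of_complex z)" if "z \<in> D" for z
            using Q formula that by (simp add: slice_trace_def)
        qed
      next
        case False
        then show ?thesis using Q by (simp add: P_def induced_def)
      qed
    qed
  qed
  then show ?thesis using P by simp
qed

lemma induces_diff_const:
  assumes "induces F f"
  shows "induces (\<lambda>z. F z - cq_of_quat c) (\<lambda>q. f q - c)"
  using assms by (simp add: induces_def stem_diff stem_of_quat cq_eval_diff)

lemma induces_linear: "induces (\<lambda>z. cq_scalar z - cq_of_quat p) (\<lambda>q. q - p)"
  by (auto simp: induces_def cq_eval_diff cq_eval_scalar
      intro!: stem_diff stem_of_quat stem_scalar holomorphic_intros)

lemma induces_linear_factors:
  assumes "induces G g"
  shows "induces (\<lambda>z. linear_stem ps z (G z)) (linear_factors \<Omega> ps g)"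
proof (induction ps)
  case Nil
  then show ?case using assms by (simp add: linear_factors_def)
next
  case (Cons p ps)
  then show ?case
    using induces_regular_product[OF induces_linear[of p] Cons] by (simp add: linear_factors_def)
qed

lemma stem_sphere_poly_power: "stem (\<lambda>z. cq_scalar (sphere_poly x y z ^ m))"
  by (intro stem_scalar holomorphic_intros sphere_poly_holomorphic) (simp add: sphere_poly_cnj)

text \<open>The polynomial has real coefficients, so its stem is scalar; this is why the plain
  pointwise product in \<open>total_multiplicity\<close> fits the calculus of stems.\<close>

lemma induces_sphere_poly_mult:
  assumes "induces F f"
  shows "induces (\<lambda>z. cq_scalar (sphere_poly x y z ^ m) * F z)
    (\<lambda>q. ((q - of_real x)\<^sup>2 + of_real (y\<^sup>2)) ^ m * f q)"
  unfolding induces_def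
proof (intro conjI ballI)
  show "stem (\<lambda>z. cq_scalar (sphere_poly x y z ^ m) * F z)"
    by (intro stem_mult stem_sphere_poly_power induces_stem[OF assms])
  fix I z assume I: "I \<in> imag_units" and z: "z \<in> D"
  have pow: "slice_emb I (w ^ k) = slice_emb I w ^ k" for w k
    by (induction k) (simp_all add: slice_emb_mult[OF I] slice_emb_of_real[of I 1, simplified])
  have diff: "slice_emb I (z - of_real x) = slice_emb I z - of_real x"
    by (simp add: slice_emb_def)
  have "slice_emb I (sphere_poly x y z) = (slice_emb I z - of_real x)\<^sup>2 + of_real (y\<^sup>2)"
    unfolding sphere_poly_altdef slice_emb_add pow diff slice_emb_of_real ..
  then show "((slice_emb I z - of_real x)\<^sup>2 + of_real (y\<^sup>2)) ^ m * f (slice_emb I z) =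
      cq_eval I (cq_scalar (sphere_poly x y z ^ m) * F z)"
    using induces_eval[OF assms I z] by (simp add: cq_eval_scalar_mult[OF I] pow)
qed

text \<open>All points of the sphere evaluate the same stem value; only the unit varies.\<close>

lemma zero_on_sphere_iff:
  assumes "induces F f" "Complex x y \<in> D"
  shows "(\<exists>p\<in>slice_sphere x y. f p = 0) \<longleftrightarrow> cq_norm (F (Complex x y)) = 0"
  unfolding slice_sphere_eq
  using induces_eval[OF assms(1) _ assms(2)] cq_norm_eq_0_if_eval[of _ "F (Complex x y)"]
    eval_eq_0_if_cq_norm[of "F (Complex x y)"]
  by auto

section \<open>Division of stem functions\<close>

lemma stem_symmetrize:
  assumes "stem F" "\<And>z. z \<in> D \<Longrightarrow> \<delta> (cnj z) = cnj (\<delta> z)"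
    and "h0 holomorphic_on D" "h1 holomorphic_on D" "h2 holomorphic_on D" "h3 holomorphic_on D"
    and "\<And>z. z \<in> D \<Longrightarrow> cq0 (F z) = \<delta> z * h0 z" "\<And>z. z \<in> D \<Longrightarrow> cq1 (F z) = \<delta> z * h1 z"
    and "\<And>z. z \<in> D \<Longrightarrow> cq2 (F z) = \<delta> z * h2 z" "\<And>z. z \<in> D \<Longrightarrow> cq3 (F z) = \<delta> z * h3 z"
  shows "\<exists>G. stem G \<and> (\<forall>z\<in>D. F z = cq_scalar (\<delta> z) * G z)"
proof -
  \<comment> \<open>Componentwise quotients are not known to have the conjugation symmetry.
    Conjugating the identity shows that \<open>hat h0\<close> is also a quotient of
    \<open>cq0 (F z)\<close> by \<open>\<delta> z\<close>, and the mean of both is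
    symmetric.\<close>
  define G where "G = (\<lambda>z. CQuat ((h0 z + hat h0 z) / 2) ((h1 z + hat h1 z) / 2)
    ((h2 z + hat h2 z) / 2) ((h3 z + hat h3 z) / 2))"
  have "cq_holomorphic_on G D"
    unfolding G_def cq_holomorphic_on_def cquat.sel
    by (intro conjI holomorphic_intros holomorphic_hat assms(3-6)) simp_all
  then have "stem G"
    by (simp add: stem_def G_def cquat_eq_iff hat_def add.commute)
  moreover have "F z = cq_scalar (\<delta> z) * G z" if "z \<in> D" for z
  proof -
    have *: "w = d * ((a + cnj b) / 2)" if "w = d * a" "cnj w = cnj d * b" for w d a b
    proof -
      have "w = d * cnj b" using arg_cong[OF that(2), of cnj] by simp
      with that(1) have "w + w = d * a + d * cnj b" by simp
      then show ?thesis by (simp add: field_simps)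
    qed
    have c: "cnj z \<in> D" using that by (simp add: cnj_mem_D)
    have F: "F (cnj z) = cq_cnj (F z)" using stem_cnj[OF assms(1) that] .
    have e: "cnj (cq0 (F z)) = cnj (\<delta> z) * h0 (cnj z)" "cnj (cq1 (F z)) = cnj (\<delta> z) * h1 (cnj z)"
      "cnj (cq2 (F z)) = cnj (\<delta> z) * h2 (cnj z)" "cnj (cq3 (F z)) = cnj (\<delta> z) * h3 (cnj z)"
      using assms(7-10)[OF c] by (simp_all only: F cq_cnj_simps assms(2)[OF that])
    note *[OF assms(7)[OF that] e(1)] *[OF assms(8)[OF that] e(2)]
      *[OF assms(9)[OF that] e(3)] *[OF assms(10)[OF that] e(4)]
    then show ?thesis
      by (simp only: cquat_eq_iff cquat_simps cq_scalar_simps G_def hat_def cquat.sel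
          mult_zero_left diff_0_right add_0_right add_0_left simp_thms)
  qed
  ultimately show ?thesis by blast
qed

lemma stem_divide_real:
  assumes "stem F" "z0 \<in> D" "Im z0 = 0" "F z0 = 0"
  shows "\<exists>G. stem G \<and> (\<forall>z\<in>D. F z = cq_scalar (z - z0) * G z)"
proof -
  have hol: "cq_holomorphic_on F D" using assms by (simp add: stem_def)
  have dv: "\<exists>h. h holomorphic_on D \<and> (\<forall>z\<in>D. g z = (z - z0) * h z)" if "g holomorphic_on D" "g z0 = 0" for g
    by (rule holomorphic_divide_linear[OF that(1) open_D assms(2) that(2)])
  note hol' = hol[unfolded cq_holomorphic_on_def]
  obtain h0 where h0: "h0 holomorphic_on D" "\<And>z. z \<in> D \<Longrightarrow> cq0 (F z) = (z - z0) * h0 z"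
    using dv[of "\<lambda>z. cq0 (F z)"] hol' assms(4) by auto
  obtain h1 where h1: "h1 holomorphic_on D" "\<And>z. z \<in> D \<Longrightarrow> cq1 (F z) = (z - z0) * h1 z"
    using dv[of "\<lambda>z. cq1 (F z)"] hol' assms(4) by auto
  obtain h2 where h2: "h2 holomorphic_on D" "\<And>z. z \<in> D \<Longrightarrow> cq2 (F z) = (z - z0) * h2 z"
    using dv[of "\<lambda>z. cq2 (F z)"] hol' assms(4) by auto
  obtain h3 where h3: "h3 holomorphic_on D" "\<And>z. z \<in> D \<Longrightarrow> cq3 (F z) = (z - z0) * h3 z"
    using dv[of "\<lambda>z. cq3 (F z)"] hol' assms(4) by auto
  show ?thesis
    by (rule stem_symmetrize[OF assms(1) _ h0(1) h1(1) h2(1) h3(1) h0(2) h1(2) h2(2) h3(2)]) (simp add: assms(3) complex_eq_iff)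
qed

text \<open>The conjugation symmetry makes \<open>F\<close> vanish at the conjugate point too; for
  \<open>y \<noteq> 0\<close> the two roots are distinct and can be divided out one after the
  other.\<close>

lemma stem_divide_sphere:
  assumes "stem F" "Complex x y \<in> D" "y \<noteq> 0" "F (Complex x y) = 0"
  shows "\<exists>G. stem G \<and> (\<forall>z\<in>D. F z = cq_scalar (sphere_poly x y z) * G z)"
proof -
  have hol: "cq_holomorphic_on F D" using assms by (simp add: stem_def)
  have c: "cnj (Complex x y) = Complex x (- y)" by (simp add: complex_eq_iff)
  have cD: "Complex x (- y) \<in> D" using assms(2) cnj_mem_D[of "Complex x y"] c by simp
  have F': "F (Complex x (- y)) = 0"
    using stem_cnj[OF assms(1,2)] assms(4) unfolding c by (simp add: cquat_eq_iff)
  have dv: "\<exists>h. h holomorphic_on D \<and> (\<forall>z\<in>D. g z = sphere_poly x y z * h z)"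
    if g: "g holomorphic_on D" "g (Complex x y) = 0" "g (Complex x (- y)) = 0" for g
  proof -
    obtain h where h: "h holomorphic_on D" "\<And>z. z \<in> D \<Longrightarrow> g z = (z - Complex x y) * h z"
      using holomorphic_divide_linear[OF g(1) open_D assms(2) g(2)] by blast
    have "h (Complex x (- y)) = 0"
      using h(2)[OF cD] g(3) assms(3) by simp
    then obtain k where "k holomorphic_on D" "\<And>z. z \<in> D \<Longrightarrow> h z = (z - Complex x (- y)) * k z"
      using holomorphic_divide_linear[OF h(1) open_D cD] by blast
    with h(2) show ?thesis by (intro exI[of _ k]) (simp add: sphere_poly_def)
  qed
  note hol' = hol[unfolded cq_holomorphic_on_def]
  obtain h0 where h0: "h0 holomorphic_on D" "\<And>z. z \<in> D \<Longrightarrow> cq0 (F z) = sphere_poly x y z * h0 z"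
    using dv[of "\<lambda>z. cq0 (F z)"] hol' assms(4) F' by auto
  obtain h1 where h1: "h1 holomorphic_on D" "\<And>z. z \<in> D \<Longrightarrow> cq1 (F z) = sphere_poly x y z * h1 z"
    using dv[of "\<lambda>z. cq1 (F z)"] hol' assms(4) F' by auto
  obtain h2 where h2: "h2 holomorphic_on D" "\<And>z. z \<in> D \<Longrightarrow> cq2 (F z) = sphere_poly x y z * h2 z"
    using dv[of "\<lambda>z. cq2 (F z)"] hol' assms(4) F' by auto
  obtain h3 where h3: "h3 holomorphic_on D" "\<And>z. z \<in> D \<Longrightarrow> cq3 (F z) = sphere_poly x y z * h3 z"
    using dv[of "\<lambda>z. cq3 (F z)"] hol' assms(4) F' by auto
  show ?thesis
    by (rule stem_symmetrize[OF assms(1) _ h0(1) h1(1) h2(1) h3(1) h0(2) h1(2) h2(2) h3(2)]) (simp add: sphere_poly_cnj)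
qed

lemma stem_zero_on_reals:
  assumes "stem E" "\<And>r. of_real r \<in> D \<Longrightarrow> E (of_real r) = 0" "z \<in> D"
  shows "E z = 0"
proof -
  have *: "g (E z) = 0" if "(\<lambda>z. g (E z)) holomorphic_on D" "g 0 = 0" for g :: "cquat \<Rightarrow> complex"
    by (rule holomorphic_zero_on_reals[OF that(1) _ assms(3)]) (simp add: assms(2) that(2))
  show ?thesis
    using *[of cq0] *[of cq1] *[of cq2] *[of cq3] assms(1)
    by (simp add: cquat_eq_iff stem_def cq_holomorphic_on_def)
qed

text \<open>If \<open>f\<close> vanishes at \<open>p\<close>, then \<open>(q - qcnj p) * f\<close> vanishes on the whole sphere of \<open>p\<close> and is
  therefore divisible by \<open>(q - qcnj p) * (q - p)\<close>.\<close>

lemma stem_divide_linear: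
  assumes "stem F" "I \<in> imag_units" "Complex x y \<in> D" "cq_eval I (F (Complex x y)) = 0"
  shows "\<exists>G. stem G \<and> (\<forall>z\<in>D. F z = (cq_scalar z - cq_of_quat (of_real x + of_real y * I)) * G z)"
proof (cases "y = 0")
  case True
  \<comment> \<open>Here the sphere is a single real point, where the stem value is a quaternion
    equal to its evaluation, so \<open>F\<close> itself vanishes.\<close>
  have "cq_Re (F (Complex x y)) = 0"
    using stem_real(3)[OF assms(1,3)] assms(4) True by simp
  then have "F (Complex x y) = cq_of_quat 0"
    using stem_real(2)[OF assms(1,3)] True by simp
  then have "F (Complex x y) = 0" by (simp add: cquat_eq_iff)
  then obtain G where "stem G" "\<forall>z\<in>D. F z = cq_scalar (z - Complex x y) * G z"
    using stem_divide_real[OF assms(1,3)] True by auto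
  moreover have "cq_scalar (z - Complex x y) = cq_scalar z - cq_of_quat (of_real x + of_real y * I)" for z
    using True by (simp add: cquat_eq_iff complex_eq_iff)
  ultimately show ?thesis by auto
next
  case False
  define p where "p = of_real x + of_real y * I"
  define L where "L = (\<lambda>p z. cq_scalar z - cq_of_quat p)"
  have L: "stem (L p)" for p using induces_stem[OF induces_linear[of p]] by (simp add: L_def)
  have LL: "L p z * L (qcnj p) z = cq_scalar (sphere_poly x y z)" for z
    using cq_linear_mult_linear_cnj(1)[OF assms(2)] by (simp add: L_def p_def sphere_poly_def)
  have "L (qcnj p) (Complex x y) * F (Complex x y) = 0"
    unfolding L_def p_def by (rule cq_linear_cnj_mult_eq_0[OF assms(2,4)])
  then obtain G where G: "stem G" "\<And>z. z \<in> D \<Longrightarrow> L (qcnj p) z * F z = cq_scalar (sphere_poly x y z) * G z"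
    using stem_divide_sphere[OF stem_mult[OF L assms(1)] assms(3) False] by blast
  \<comment> \<open>The defect of the wanted factorization. \<open>L (qcnj p)\<close> cannot be
    cancelled at the roots of \<open>sphere_poly\<close>, where it is a zero divisor; but
    \<open>sphere_poly\<close> has no real root and kills \<open>E\<close>, so \<open>E\<close>
    vanishes on the reals and hence on all of \<open>D\<close>.\<close>
  define E where "E = (\<lambda>z. F z - L p z * G z)"
  have "stem E" unfolding E_def by (intro stem_diff stem_mult L G assms)
  have E0: "cq_scalar (sphere_poly x y z) * E z = 0" if "z \<in> D" for z
  proof -
    have "cq_scalar (sphere_poly x y z) * (L p z * G z) = L p z * (cq_scalar (sphere_poly x y z) * G z)"
      by (simp only: mult.assoc[symmetric] cq_scalar_commute)
    also have "\<dots> = (L p z * L (qcnj p) z) * F z"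
      using G(2)[OF that] by (simp add: mult.assoc)
    finally show ?thesis by (simp add: E_def LL right_diff_distrib)
  qed
  have "E (of_real r) = 0" if "of_real r \<in> D" for r
  proof -
    have "sphere_poly x y (of_real r) \<noteq> 0"
      using False by (auto simp: sphere_poly_def complex_eq_iff)
    then show ?thesis using E0[OF that] by simp
  qed
  then have "E z = 0" if "z \<in> D" for z
    using stem_zero_on_reals[OF \<open>stem E\<close>] that by blast
  then show ?thesis using G(1) by (intro exI[of _ G]) (auto simp: E_def L_def p_def)
qed

section \<open>Normal form of the factorization at a sphere\<close>

definition divisible :: "real \<Rightarrow> real \<Rightarrow> (complex \<Rightarrow> cquat) \<Rightarrow> bool"
  where "divisible x y F \<longleftrightarrow> (\<exists>G. stem G \<and> (\<forall>z\<in>D. F z = cq_scalar (sphere_poly x y z) * G z))"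

lemma not_divisible_imp_nonzero:
  assumes "stem F" "Complex x y \<in> D" "\<not> divisible x y F" "y \<noteq> 0"
  shows "F (Complex x y) \<noteq> 0"
  using stem_divide_sphere[OF assms(1,2,4)] assms(3) by (auto simp: divisible_def)

text \<open>The data required by \<open>isolated_multiplicity\<close>, on the level of stems:
  nonzero norm of \<open>G\<close> says that the induced function has no zero on the sphere, and the
  last clause provides the zero at the head of the list.\<close>

definition normal_factorization ::
    "real \<Rightarrow> real \<Rightarrow> (complex \<Rightarrow> cquat) \<Rightarrow> quat list \<Rightarrow> (complex \<Rightarrow> cquat) \<Rightarrow> bool"
  where "normal_factorization x y F ps G \<longleftrightarrow> stem G \<and> cq_norm (G (Complex x y)) \<noteq> 0 \<and>
    set ps \<subseteq> slice_sphere x y \<and> (\<forall>z\<in>D. F z = linear_stem ps z (G z)) \<and>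
    (\<forall>l. Suc l < length ps \<longrightarrow> ps ! l \<noteq> qcnj (ps ! Suc l)) \<and>
    (ps \<noteq> [] \<longrightarrow> induced F (hd ps) = 0)"

text \<open>An adjacent pair \<open>p\<close>, \<open>qcnj p\<close> contributes the factor \<open>sphere_poly x y\<close>; hence it cannot occur
  once all such factors have been split off.\<close>

lemma normal_factorization_Cons:
  assumes "normal_factorization x y F1 ps G" "stem F" "stem F1" "I \<in> imag_units" "Complex x y \<in> D"
    and "cq_eval I (F (Complex x y)) = 0" "p = of_real x + of_real y * I"
    and "\<And>z. z \<in> D \<Longrightarrow> F z = (cq_scalar z - cq_of_quat p) * F1 z" "\<not> divisible x y F"
  shows "normal_factorization x y F (p # ps) G"
proof -
  have p: "p \<in> slice_sphere x y" using assms(4,7) by (auto simp: slice_sphere_def)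
  have "(p # ps) ! l \<noteq> qcnj ((p # ps) ! Suc l)" if l: "Suc l < length (p # ps)" for l
  proof (cases l)
    case 0
    then obtain p2 ps2 where ps: "ps = p2 # ps2" using l by (cases ps) auto
    show ?thesis
    proof
      assume "(p # ps) ! l = qcnj ((p # ps) ! Suc l)"
      then have p2: "p2 = qcnj p" using 0 ps by (simp add: quat_eq_iff)
      define F2 where "F2 = (\<lambda>z. linear_stem ps2 z (G z))"
      have "stem G" using assms(1) by (simp add: normal_factorization_def)
      then have "stem F2"
        using induces_stem[OF induces_linear_factors[OF induces_induced]] by (simp add: F2_def)
      moreover have "F z = cq_scalar (sphere_poly x y z) * F2 z" if "z \<in> D" for z
      proof -
        have "F z = (cq_scalar z - cq_of_quat p) * ((cq_scalar z - cq_of_quat (qcnj p)) * F2 z)"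
          using assms(1) assms(8)[OF that] that by (simp add: normal_factorization_def ps p2 F2_def)
        also have "\<dots> = cq_scalar (sphere_poly x y z) * F2 z"
          using cq_linear_mult_linear_cnj(1)[OF assms(4), of z x y]
          by (simp add: mult.assoc[symmetric] assms(7) sphere_poly_def)
        finally show ?thesis .
      qed
      ultimately show False using assms(9) by (auto simp: divisible_def)
    qed
  next
    case (Suc k)
    then show ?thesis using assms(1) l by (simp add: normal_factorization_def)
  qed
  moreover have "induced F p = 0"
    using induced_slice_emb[OF assms(2,4,5)] assms(6,7) by (simp add: slice_emb_def)
  ultimately show ?thesis
    using assms(1,8) p by (simp add: normal_factorization_def)
qed

text \<open>Induction on the order of the symmetrization at the sphere. Spherical factors are split
  off as long as there are any; then a zero yields a linear factor, and the induction hypothesis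
  treats the cofactor. Each step lowers the order.\<close>

lemma exists_normal_factorization:
  assumes "stem F" "\<beta> \<in> D" "cq_norm (F \<beta>) \<noteq> 0" "Complex x y \<in> D"
  shows "\<exists>m F1 ps G. stem F1 \<and> \<not> divisible x y F1 \<and> normal_factorization x y F1 ps G \<and>
    (\<forall>z\<in>D. F z = cq_scalar (sphere_poly x y z ^ m) * F1 z)"
  using assms(1,3)
proof (induction "nat (zorder (\<lambda>z. cq_norm (F z)) (Complex x y))" arbitrary: F rule: less_induct)
  case less
  have hol: "(\<lambda>z. cq_norm (F z)) holomorphic_on D" if "stem F" for F
    using that by (intro cq_norm_holomorphic) (simp add: stem_def)
  have cong: "zorder g (Complex x y) = zorder h (Complex x y)" if "\<And>z. z \<in> D \<Longrightarrow> g z = h z" for g h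
    by (intro zorder_cong refl eventually_at_in_open'[OF open_D assms(4), THEN eventually_mono] that)
  have decr: "nat (zorder k (Complex x y)) < nat (zorder (\<lambda>z. cq_norm (F z)) (Complex x y))"
    if k: "k holomorphic_on D" "\<And>z. z \<in> D \<Longrightarrow> cq_norm (F z) = sphere_poly x y z * k z"
      "k \<beta> \<noteq> 0" "stem F" "cq_norm (F \<beta>) \<noteq> 0" for k F
  proof -
    have nz: "sphere_poly x y \<beta> * k \<beta> \<noteq> 0" using k assms(2) by auto
    show ?thesis
      using zorder_mult_vanishing[OF sphere_poly_holomorphic k(1) open_D connected_D assms(4) _ assms(2) nz]
        cong[of "\<lambda>z. cq_norm (F z)" "\<lambda>z. sphere_poly x y z * k z"] k(2) by simp
  qed
  show ?case
  proof (cases "divisible x y F")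
    case True
    then obtain F1 where F1: "stem F1" "\<And>z. z \<in> D \<Longrightarrow> F z = cq_scalar (sphere_poly x y z) * F1 z"
      by (auto simp: divisible_def)
    \<comment> \<open>A spherical factor is a scalar and enters the norm squared; removing one of
      the two copies already lowers the order strictly.\<close>
    have n: "cq_norm (F z) = sphere_poly x y z * (sphere_poly x y z * cq_norm (F1 z))" if "z \<in> D" for z
      using F1(2)[OF that] by (simp add: cq_norm_mult cq_norm_scalar power2_eq_square)
    have nz: "sphere_poly x y \<beta> \<noteq> 0" "cq_norm (F1 \<beta>) \<noteq> 0"
      using n[OF assms(2)] less.prems(2) by auto
    have "nat (zorder (\<lambda>z. sphere_poly x y z * cq_norm (F1 z)) (Complex x y)) <
        nat (zorder (\<lambda>z. cq_norm (F z)) (Complex x y))"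
      by (rule decr[OF _ n _ less.prems]) (auto intro!: holomorphic_intros sphere_poly_holomorphic hol F1 simp: nz)
    moreover have "zorder (\<lambda>z. cq_norm (F1 z)) (Complex x y) \<le>
        zorder (\<lambda>z. sphere_poly x y z * cq_norm (F1 z)) (Complex x y)"
      using zorder_mult_vanishing[OF sphere_poly_holomorphic hol[OF F1(1)] open_D connected_D assms(4) _ assms(2)] nz
      by (simp add: order_less_imp_le)
    ultimately have "nat (zorder (\<lambda>z. cq_norm (F1 z)) (Complex x y)) <
        nat (zorder (\<lambda>z. cq_norm (F z)) (Complex x y))"
      by linarith
    from less.hyps[OF this F1(1) nz(2)] obtain m F2 ps G where
      F2: "stem F2" "\<not> divisible x y F2" "normal_factorization x y F2 ps G"
        "\<And>z. z \<in> D \<Longrightarrow> F1 z = cq_scalar (sphere_poly x y z ^ m) * F2 z"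
      by blast
    have "F z = cq_scalar (sphere_poly x y z ^ Suc m) * F2 z" if "z \<in> D" for z
      using F1(2)[OF that] F2(4)[OF that] by (simp add: cq_scalar_mult mult.assoc)
    with F2 show ?thesis by blast
  next
    case not_div: False
    show ?thesis
    proof (cases "cq_norm (F (Complex x y)) = 0")
      case False
      then have "normal_factorization x y F [] F"
        using less.prems(1) by (simp add: normal_factorization_def)
      then show ?thesis using not_div less.prems(1) by (intro exI[of _ 0] exI[of _ F]) auto
    next
      case True
      then obtain I where I: "I \<in> imag_units" "cq_eval I (F (Complex x y)) = 0"
        using eval_eq_0_if_cq_norm by blast
      define p where "p = of_real x + of_real y * I"
      obtain F1 where F1: "stem F1" "\<And>z. z \<in> D \<Longrightarrow> F z = (cq_scalar z - cq_of_quat p) * F1 z"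
        using stem_divide_linear[OF less.prems(1) I(1) assms(4) I(2)] unfolding p_def by blast
      have n: "cq_norm (F z) = sphere_poly x y z * cq_norm (F1 z)" if "z \<in> D" for z
        using F1(2)[OF that] cq_linear_mult_linear_cnj(3)[OF I(1)]
        by (simp add: cq_norm_mult p_def sphere_poly_def)
      have nz: "cq_norm (F1 \<beta>) \<noteq> 0" using n[OF assms(2)] less.prems(2) by auto
      from less.hyps[OF decr[OF hol[OF F1(1)] n nz less.prems] F1(1) nz] obtain m F2 ps G where
        F2: "stem F2" "normal_factorization x y F2 ps G"
          "\<And>z. z \<in> D \<Longrightarrow> F1 z = cq_scalar (sphere_poly x y z ^ m) * F2 z"
        by blast
      \<comment> \<open>A spherical factor of the cofactor would commute past the linear factor and
        divide \<open>F\<close>, which has none left.\<close>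
      have "m = 0"
      proof (rule ccontr)
        assume "m \<noteq> 0"
        then obtain k where k: "m = Suc k" by (cases m) auto
        define H where "H = (\<lambda>z. (cq_scalar z - cq_of_quat p) * (cq_scalar (sphere_poly x y z ^ k) * F2 z))"
        have "stem H"
          unfolding H_def
          by (intro stem_mult stem_sphere_poly_power F2 induces_stem[OF induces_linear])
        moreover have "F z = cq_scalar (sphere_poly x y z) * H z" if "z \<in> D" for z
        proof -
          have "F z = (cq_scalar z - cq_of_quat p) * cq_scalar (sphere_poly x y z) *
              (cq_scalar (sphere_poly x y z ^ k) * F2 z)"
            using F1(2)[OF that] F2(3)[OF that] by (simp add: k cq_scalar_mult mult.assoc)
          then show ?thesis
            unfolding H_def by (simp only: cq_scalar_commute mult.assoc)
        qed
        ultimately show False using not_div by (auto simp: divisible_def)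
      qed
      \<comment> \<open>For \<open>m = 0\<close> the stems \<open>F1\<close> and \<open>F2\<close>
        agree on \<open>D\<close>, and \<open>induced\<close> consults no values outside
        \<open>D\<close>.\<close>
      then have "normal_factorization x y F1 ps G"
        using F2(2,3) by (simp add: normal_factorization_def) 
          (metis F1(1) F2(1) assms(4) induced_def mem_iff_qpolar mult_1_left)
      then have "normal_factorization x y F (p # ps) G"
        using normal_factorization_Cons[OF _ less.prems(1) F1(1) I(1) assms(4) I(2) p_def F1(2) not_div]
        by blast
      then show ?thesis using not_div less.prems(1) by (intro exI[of _ 0] exI[of _ F]) auto
    qed
  qed
qed

text \<open>The restriction to a slice of the symmetrization \<open>f * f\<^sup>c\<close>.\<close>

definition symm :: "(quat \<Rightarrow> quat) \<Rightarrow> complex \<Rightarrow> complex"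
  where "symm f z = cq_norm (stem_of f z)"

lemma symm_eq: "\<lbrakk>induces F f; z \<in> D\<rbrakk> \<Longrightarrow> symm f z = cq_norm (F z)"
  using induces_unique[of F f z] by (simp add: symm_def)

lemma symm_holomorphic: "slice_regular \<Omega> f \<Longrightarrow> symm f holomorphic_on D"
  unfolding symm_def[abs_def] using stem_stem_of[of f] by (simp add: stem_def cq_norm_holomorphic)

section \<open>Total multiplicity as an order of vanishing\<close>

definition mult_witness :: "(quat \<Rightarrow> quat) \<Rightarrow> quat set \<Rightarrow> nat \<Rightarrow> bool"
  where "mult_witness f C N \<longleftrightarrow> (\<exists>x y m n ft.
    C = slice_sphere x y \<and> slice_regular \<Omega> ft \<and>
    (y \<noteq> 0 \<longrightarrow> (\<exists>q\<in>C. ft q \<noteq> 0)) \<and>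
    (\<forall>q\<in>\<Omega>. f q = ((q - of_real x)\<^sup>2 + of_real (y\<^sup>2)) ^ m * ft q) \<and>
    isolated_multiplicity \<Omega> ft C n \<and> N = 2 * m + n)"

lemma mult_witness_symm:
  assumes "slice_regular \<Omega> f" "Complex x y \<in> D" "mult_witness f (slice_sphere x y) N"
  shows "\<exists>u. u holomorphic_on D \<and> u (Complex x y) \<noteq> 0 \<and> (\<forall>z\<in>D. symm f z = sphere_poly x y z ^ N * u z)"
proof -
  obtain x' y' m n ft where *: "slice_sphere x y = slice_sphere x' y'" "slice_regular \<Omega> ft"
      "\<forall>q\<in>\<Omega>. f q = ((q - of_real x')\<^sup>2 + of_real (y'\<^sup>2)) ^ m * ft q"
      "isolated_multiplicity \<Omega> ft (slice_sphere x y) n" and N: "N = 2 * m + n"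
    using assms(3) unfolding mult_witness_def by metis
  \<comment> \<open>The sphere determines \<open>y\<close> up to sign only, which its polynomial
    does not see.\<close>
  have x': "x' = x" "y'\<^sup>2 = y\<^sup>2" using *(1) by (auto simp: slice_sphere_eq_iff) (metis power2_abs)
  note ft = induces_stem_of[OF *(2)]
  have "induces (\<lambda>z. cq_scalar (sphere_poly x y z ^ m) * stem_of ft z) f"
    using induces_cong[OF induces_sphere_poly_mult[OF ft, of x y m] induces_stem[OF induces_sphere_poly_mult[OF ft, of x y m]]]
      *(3) x' by simp
  from symm_eq[OF this] have symm: "symm f z = sphere_poly x y z ^ (2 * m) * symm ft z" if "z \<in> D" for z
    using that by (simp add: symm_def cq_norm_mult cq_norm_scalar mult.commute flip: power_mult)
  have "\<exists>u. u holomorphic_on D \<and> u (Complex x y) \<noteq> 0 \<and> (\<forall>z\<in>D. symm ft z = sphere_poly x y z ^ n * u z)"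
  proof (cases "\<exists>p\<in>slice_sphere x y. ft p = 0")
    case True
    then obtain ps g where g: "length ps = n" "set ps \<subseteq> slice_sphere x y" "slice_regular \<Omega> g"
        "\<forall>q\<in>slice_sphere x y. g q \<noteq> 0" "\<forall>q\<in>\<Omega>. ft q = linear_factors \<Omega> ps g q"
      using *(4) unfolding isolated_multiplicity_def by auto
    note gi = induces_stem_of[OF g(3)]
    have "induces (\<lambda>z. linear_stem ps z (stem_of g z)) ft"
      using induces_cong[OF induces_linear_factors[OF gi, of ps] induces_stem[OF induces_linear_factors[OF gi, of ps]]]
        g(5) by simp
    from symm_eq[OF this] have "symm ft z = sphere_poly x y z ^ n * symm g z" if "z \<in> D" for z
      using that cq_norm_linear_stem[OF g(2)] g(1) by (simp add: symm_def)
    moreover have "symm g (Complex x y) \<noteq> 0"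
      using zero_on_sphere_iff[OF gi assms(2)] g(4) by (auto simp: symm_def)
    ultimately show ?thesis using symm_holomorphic[OF g(3)] by blast
  next
    case False
    then have "n = 0" using *(4) by (auto simp: isolated_multiplicity_def)
    moreover have "symm ft (Complex x y) \<noteq> 0"
      using zero_on_sphere_iff[OF ft assms(2)] False by (auto simp: symm_def)
    ultimately show ?thesis using symm_holomorphic[OF *(2)] by (intro exI[of _ "symm ft"]) simp
  qed
  then obtain u where "u holomorphic_on D" "u (Complex x y) \<noteq> 0"
    "\<forall>z\<in>D. symm ft z = sphere_poly x y z ^ n * u z" by blast
  with symm show ?thesis
    by (intro exI[of _ u]) (simp add: N power_add)
qed

lemma exists_mult_witness:
  assumes "slice_regular \<Omega> f" "Complex x y \<in> D" "\<beta> \<in> D" "symm f \<beta> \<noteq> 0"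
  shows "\<exists>N. mult_witness f (slice_sphere x y) N"
proof -
  note f = induces_stem_of[OF assms(1)]
  obtain m F1 ps G where F1: "stem F1" "\<not> divisible x y F1" "normal_factorization x y F1 ps G"
      "\<And>z. z \<in> D \<Longrightarrow> stem_of f z = cq_scalar (sphere_poly x y z ^ m) * F1 z"
    using exists_normal_factorization[OF stem_stem_of[OF assms(1)] assms(3) _ assms(2)] assms(4)
    by (auto simp: symm_def)
  define ft where "ft = induced F1"
  define g where "g = induced G"
  have ft: "induces F1 ft" unfolding ft_def by (rule induces_induced[OF F1(1)])
  have G: "stem G" using F1(3) by (simp add: normal_factorization_def)
  have g: "induces G g" unfolding g_def by (rule induces_induced[OF G])
  have sub: "slice_sphere x y \<subseteq> \<Omega>" using assms(2) by (simp add: slice_sphere_subset_iff)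
  have "\<forall>q\<in>\<Omega>. f q = ((q - of_real x)\<^sup>2 + of_real (y\<^sup>2)) ^ m * ft q"
  proof
    fix q assume q: "q \<in> \<Omega>"
    then have "qpolar q \<in> D" using mem_iff_qpolar by simp
    then show "f q = ((q - of_real x)\<^sup>2 + of_real (y\<^sup>2)) ^ m * ft q"
      using induces_polar[OF f q] induces_polar[OF induces_sphere_poly_mult[OF ft, of x y m] q] F1(4)
      by simp
  qed
  moreover have "\<exists>q\<in>slice_sphere x y. ft q \<noteq> 0" if "y \<noteq> 0"
  proof (rule ccontr)
    assume none: "\<not> (\<exists>q\<in>slice_sphere x y. ft q \<noteq> 0)"
    \<comment> \<open>Vanishing at the units \<open>quat_i\<close> and \<open>- quat_i\<close>
      already makes the stem value 0, and then \<open>F1\<close> would be divisible by the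
      polynomial of the sphere.\<close>
    have 0: "cq_eval I (F1 (Complex x y)) = 0" if "I \<in> imag_units" for I
      using none induces_eval[OF ft that assms(2)] that by (auto simp: slice_sphere_eq)
    have "F1 (Complex x y) = 0"
      using cq_Re_Im_of_eval[OF quat_i_imag_unit, of "F1 (Complex x y)"]
        0[OF quat_i_imag_unit] 0[OF imag_units_uminus[OF quat_i_imag_unit]]
      by (simp add: cq_eq_0_iff)
    then show False using not_divisible_imp_nonzero[OF F1(1) assms(2) F1(2) that] by simp
  qed
  moreover have "isolated_multiplicity \<Omega> ft (slice_sphere x y) (length ps)"
  proof -
    have gz: "\<forall>q\<in>slice_sphere x y. g q \<noteq> 0"
      using zero_on_sphere_iff[OF g assms(2)] F1(3) by (auto simp: normal_factorization_def)
    have lin: "\<forall>q\<in>\<Omega>. ft q = linear_factors \<Omega> ps g q"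
      using induces_polar[OF ft] induces_polar[OF induces_linear_factors[OF g, of ps]] F1(3)
      by (simp add: normal_factorization_def mem_iff_qpolar)
    show ?thesis
    proof (cases "ps = []")
      case True
      then have "\<not> (\<exists>p\<in>slice_sphere x y. ft p = 0)"
        using lin gz sub by (auto simp: linear_factors_def)
      with True show ?thesis by (simp add: isolated_multiplicity_def)
    next
      case False
      then have hd: "ft (hd ps) = 0" "hd ps \<in> slice_sphere x y"
        using F1(3) by (auto simp: normal_factorization_def ft_def)
      have "slice_regular \<Omega> g" by (rule slice_regular_if_induces[OF g])
      then show ?thesis
        unfolding isolated_multiplicity_def using hd False gz lin F1(3)
        by (auto simp: normal_factorization_def)
    qed
  qed
  ultimately have "mult_witness f (slice_sphere x y) (2 * m + length ps)"
    unfolding mult_witness_def using slice_regular_if_induces[OF ft] by blast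
  then show ?thesis by blast
qed

text \<open>At \<open>Complex x y\<close> only one root of \<open>sphere_poly\<close> counts if the
  two differ, and both count if they coincide.\<close>

lemma zorder_sphere_poly_power:
  assumes "Complex x y \<in> D" "u holomorphic_on D" "u (Complex x y) \<noteq> 0"
    and "\<And>z. z \<in> D \<Longrightarrow> s z = sphere_poly x y z ^ N * u z"
  shows "zorder s (Complex x y) = int N * (if y = 0 then 2 else 1)"
proof (cases "y = 0")
  case True
  show ?thesis
    by (rule zorder_eqI[OF open_D assms(1,2,3)])
      (simp add: assms(4) True sphere_poly_def power_int_def nat_mult_distrib power_mult mult.commute power2_eq_square
        power_mult_distrib)
next
  case False
  show ?thesis
  proof (rule zorder_eqI[OF open_D assms(1), where g = "\<lambda>z. (z - Complex x (- y)) ^ N * u z"])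
    show "(\<lambda>z. (z - Complex x (- y)) ^ N * u z) holomorphic_on D"
      by (intro holomorphic_intros assms)
    show "(Complex x y - Complex x (- y)) ^ N * u (Complex x y) \<noteq> 0"
      using False assms(3) by simp
  qed (simp add: assms(4) False sphere_poly_def power_int_def power_mult_distrib)
qed

theorem total_multiplicity_symm:
  assumes "slice_regular \<Omega> f" "Complex x y \<in> D" "\<beta> \<in> D" "symm f \<beta> \<noteq> 0"
  defines "N \<equiv> total_multiplicity \<Omega> f (slice_sphere x y)"
  shows "zorder (symm f) (Complex x y) = int N * (if y = 0 then 2 else 1)"
    and "\<exists>u. u holomorphic_on D \<and> u (Complex x y) \<noteq> 0 \<and> (\<forall>z\<in>D. symm f z = sphere_poly x y z ^ N * u z)"
proof -
  have zorder: "zorder (symm f) (Complex x y) = int M * (if y = 0 then 2 else 1)"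
    if "mult_witness f (slice_sphere x y) M" for M
    using mult_witness_symm[OF assms(1,2) that] zorder_sphere_poly_power[OF assms(2)] by metis
  obtain M where M: "mult_witness f (slice_sphere x y) M"
    using exists_mult_witness[OF assms(1-4)] by blast
  have "N = (THE M. mult_witness f (slice_sphere x y) M)"
    by (simp add: N_def total_multiplicity_def mult_witness_def)
  also have "\<dots> = M"
  proof (rule the_equality[where P = "mult_witness f (slice_sphere x y)", OF M])
    fix K assume "mult_witness f (slice_sphere x y) K"
    from zorder[OF this] zorder[OF M] show "K = M" by (auto split: if_splits)
  qed
  finally have "N = M" .
  with M zorder mult_witness_symm[OF assms(1,2)]
  show "zorder (symm f) (Complex x y) = int N * (if y = 0 then 2 else 1)"
    "\<exists>u. u holomorphic_on D \<and> u (Complex x y) \<noteq> 0 \<and> (\<forall>z\<in>D. symm f z = sphere_poly x y z ^ N * u z)"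
    by blast+
qed

end

section \<open>The singular set\<close>

lemma inner_mult_common_right: "inner (p * b) (q * b) = inner b b * inner p (q :: quat)"
  by (simp add: inner_quat_def algebra_simps)

lemma inner_mult_common_left: "inner (b * p) (b * q) = inner b b * inner p (q :: quat)"
  by (simp add: inner_quat_def algebra_simps)

lemma exists_imag_orthogonal: "\<exists>w. w \<noteq> 0 \<and> qRe w = 0 \<and> inner w I = 0"
proof (cases "qIm1 I = 0 \<and> qIm2 I = 0")
  case True
  then show ?thesis by (intro exI[of _ quat_i]) (simp add: quat_eq_iff inner_quat_def)
next
  case False
  then show ?thesis
    by (intro exI[of _ "Quat 0 (- qIm2 I) (qIm1 I) 0"]) (auto simp: quat_eq_iff inner_quat_def)
qed

definition slice_component :: "quat \<Rightarrow> quat \<Rightarrow> complex"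
  where "slice_component I v = Complex (qRe v) (inner v I)"

text \<open>The component orthogonal to the slice of \<open>I\<close>, that is, tangent to the
  spheres through its non-real points.\<close>

definition slice_orth :: "quat \<Rightarrow> quat \<Rightarrow> quat"
  where "slice_orth I v = qvec v - inner v I *\<^sub>R I"

lemma slice_decomposition: "v = slice_emb I (slice_component I v) + slice_orth I v"
  by (simp add: slice_component_def slice_orth_def slice_emb_def qvec_def of_real_def)

lemma slice_orth_orthogonal:
  assumes "I \<in> imag_units"
  shows "qRe (slice_orth I v) = 0" "inner (slice_orth I v) I = 0"
proof -
  have I: "qRe I = 0" "inner I I = 1"
    using assms norm_imag_unit[OF assms] by (simp_all add: imag_units_iff norm_eq_1)
  show "qRe (slice_orth I v) = 0" by (simp add: slice_orth_def qvec_def I)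
  have "inner (qvec v) I = inner v I" by (simp add: inner_quat_def qvec_def I(1))
  then show "inner (slice_orth I v) I = 0" by (simp add: slice_orth_def inner_diff_left I(2))
qed

lemma inner_slice_emb_orthogonal:
  assumes "qRe w = 0" "inner w I = 0"
  shows "inner w (slice_emb I z) = 0"
  using assms by (simp add: slice_emb_def inner_add_right of_real_def) (simp add: inner_quat_def)

text \<open>The slice is multiplied by \<open>d\<close>, its orthogonal complement by
  \<open>b\<close>. For \<open>b \<noteq> 0\<close> a kernel exists exactly when
  \<open>d * inverse b\<close> lies in the complement, which is stable under multiplication by slice
  elements; pairing this quotient with \<open>1\<close> and \<open>I\<close> gives the two
  conditions.\<close>

lemma bij_slice_differential_iff:
  fixes y :: real
  defines "L \<equiv> \<lambda>I y d b v. slice_emb I (slice_component I v) * d + (1 / y) *\<^sub>R (slice_orth I v * b)"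
  assumes I: "I \<in> imag_units" and y: "y \<noteq> 0" and linear: "linear (L I y d b)"
  shows "bij (L I y d b) \<longleftrightarrow> \<not> (inner d b = 0 \<and> inner d (I * b) = 0)"
proof -
  have bij: "bij (L I y d b) \<longleftrightarrow> (\<forall>v. L I y d b v = 0 \<longrightarrow> v = 0)"
    using linear_injective_0[OF linear] linear_injective_imp_surjective[OF linear] by (auto simp: bij_def)
  have I0: "qRe I = 0" using I by (simp add: imag_units_iff)
  show ?thesis
  proof
    assume "bij (L I y d b)"
    show "\<not> (inner d b = 0 \<and> inner d (I * b) = 0)"
    proof
      assume *: "inner d b = 0 \<and> inner d (I * b) = 0"
      have "\<exists>v. v \<noteq> 0 \<and> L I y d b v = 0"
      proof (cases "b = 0")
        case True
        \<comment> \<open>For \<open>b = 0\<close> every direction orthogonal to the slice lies in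
          the kernel.\<close>
        obtain w where w: "w \<noteq> 0" "qRe w = 0" "inner w I = 0" using exists_imag_orthogonal by blast
        then have "slice_component I w = 0" by (simp add: slice_component_def complex_eq_iff)
        then show ?thesis using w True by (intro exI[of _ w]) (simp add: L_def slice_emb_def)
      next
        case False
        define p where "p = d * inverse b"
        have p: "p * b = d" using False by (simp add: p_def mult.assoc)
        have "inner b b * inner p 1 = 0" "inner b b * inner p I = 0"
          using * inner_mult_common_right[of p b 1] inner_mult_common_right[of p b I] by (simp_all add: p)
        then have p0: "qRe p = 0" "inner p I = 0"
          using False by (simp_all add: inner_quat_def[of p 1])
        \<comment> \<open>The slice part \<open>1\<close> contributes \<open>d\<close>, and the
          orthogonal part \<open>- y *\<^sub>R p\<close> contributes
          \<open>- (p * b) = - d\<close>.\<close>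
        define v where "v = 1 - y *\<^sub>R p"
        have "slice_component I v = 1"
          using p0 I0 by (simp add: v_def slice_component_def complex_eq_iff inner_diff_left inner_quat_def[of 1])
        moreover have "slice_orth I v = - y *\<^sub>R p"
          using calculation p0 by (simp add: v_def slice_orth_def slice_component_def complex_eq_iff qvec_def of_real_def)
        ultimately have "L I y d b v = 0" using y p by (simp add: L_def slice_emb_def)
        moreover have "qRe v = 1" using p0 by (simp add: v_def)
        then have "v \<noteq> 0" by auto
        ultimately show ?thesis by blast
      qed
      then show False using \<open>bij (L I y d b)\<close> bij by blast
    qed
  next
    assume nz: "\<not> (inner d b = 0 \<and> inner d (I * b) = 0)"
    then have "b \<noteq> 0" by auto
    have "v = 0" if v: "L I y d b v = 0" for v
    proof -
      define s w where "s = slice_emb I (slice_component I v)" and "w = slice_orth I v"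
      have w: "qRe w = 0" "inner w I = 0" using slice_orth_orthogonal[OF I] by (simp_all add: w_def)
      have v_eq: "v = s + w" unfolding s_def w_def by (rule slice_decomposition)
      have sd: "s * d = - (1 / y) *\<^sub>R (w * b)" using v by (simp add: L_def s_def w_def eq_neg_iff_add_eq_0)
      \<comment> \<open>On the kernel \<open>s * d\<close> is a multiple of \<open>w * b\<close>.
        Pairing with \<open>s * b\<close> removes the common right factor \<open>b\<close> and
        leaves a pairing of \<open>w\<close> with an element of the slice.\<close>
      have "inner s s * inner d b = inner (s * d) (s * b)" by (simp add: inner_mult_common_left)
      also have "\<dots> = - (1 / y) * (inner b b * inner w s)" by (simp add: sd inner_mult_common_right)
      also have "\<dots> = 0" using inner_slice_emb_orthogonal[OF w] by (simp add: s_def)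
      finally have 1: "inner s s * inner d b = 0" .
      have "inner s s * inner d (I * b) = inner (s * d) (s * (I * b))" by (simp add: inner_mult_common_left)
      also have "\<dots> = - (1 / y) * (inner b b * inner w (s * I))"
        by (simp add: sd inner_mult_common_right flip: mult.assoc)
      also have "s * I = slice_emb I (slice_component I v * \<i>)"
        by (simp add: s_def slice_emb_mult[OF I] slice_emb_i)
      also have "inner w \<dots> = 0" by (rule inner_slice_emb_orthogonal[OF w])
      finally have "inner s s * inner d (I * b) = 0" by simp
      with 1 nz have "s = 0" by auto
      with sd y \<open>b \<noteq> 0\<close> have "w = 0" by simp
      with \<open>s = 0\<close> v_eq show "v = 0" by simp
    qed
    then show "bij (L I y d b)" using bij by blast
  qed
qed

section \<open>Polar coordinates and the differential of a regular function\<close>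

lemma bounded_linear_qvec: "bounded_linear qvec"
proof -
  have "qvec = (\<lambda>q. q - inner q 1 *\<^sub>R 1)"
    by (auto simp: qvec_def inner_quat_def of_real_def)
  moreover have "bounded_linear (\<lambda>q :: quat. q - inner q 1 *\<^sub>R 1)"
    by (intro bounded_linear_sub bounded_linear_ident
        bounded_linear_scaleR_left[THEN bounded_linear_compose] bounded_linear_inner_left)
  ultimately show ?thesis by simp
qed

lemma qvec_eq_0_iff: "qvec q = 0 \<longleftrightarrow> Im (qpolar q) = 0"
  by (simp add: qpolar_def)

lemma norm_qvec_has_derivative:
  assumes "qvec q \<noteq> 0"
  shows "((\<lambda>q. norm (qvec q)) has_derivative (\<lambda>v. inner v (qunit q))) (at q)"
proof -
  have "((norm \<circ> qvec) has_derivative (\<lambda>h. inner h (sgn (qvec q))) \<circ> qvec) (at q)"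
    using has_derivative_norm[OF assms] bounded_linear_imp_has_derivative[OF bounded_linear_qvec]
    by (intro diff_chain_within) (auto intro: has_derivative_at_withinI)
  moreover have "inner (qvec v) (sgn (qvec q)) = inner v (qunit q)" for v
  proof -
    have "qRe (sgn (qvec q)) = 0" by (simp add: sgn_quat_def qvec_def)
    then show ?thesis using assms by (simp add: qunit_def inner_quat_def) (simp add: qvec_def)
  qed
  ultimately show ?thesis by (simp add: o_def)
qed

lemma qpolar_has_derivative:
  assumes "qvec q \<noteq> 0"
  shows "(qpolar has_derivative slice_component (qunit q)) (at q)"
proof -
  have eq: "qpolar = (\<lambda>q. of_real (inner q 1) + \<i> * of_real (norm (qvec q)))"
    "slice_component I = (\<lambda>v. of_real (inner v 1) + \<i> * of_real (inner v I))" for I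
    by (auto simp: qpolar_def slice_component_def inner_quat_def[of _ 1] Complex_eq)
  have "((\<lambda>q::quat. inner q 1) has_derivative (\<lambda>v. inner v 1)) (at q)"
    by (intro bounded_linear_imp_has_derivative bounded_linear_inner_left)
  then show ?thesis
    unfolding eq
    by (intro has_derivative_add has_derivative_of_real has_derivative_mult_right
        norm_qvec_has_derivative[OF assms])
qed

lemma continuous_qpolar: "continuous_on A qpolar"
proof -
  have eq: "qpolar = (\<lambda>q. of_real (inner q 1) + \<i> * of_real (norm (qvec q)))"
    by (auto simp: qpolar_def inner_quat_def[of _ 1] Complex_eq)
  show ?thesis
    unfolding eq
    by (intro continuous_intros linear_continuous_on bounded_linear_qvec)
qed

lemma bij_mult_right_iff: "bij (\<lambda>v. v * k) \<longleftrightarrow> (k :: quat) \<noteq> 0"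
proof
  assume "bij (\<lambda>v. v * k)"
  then have "(1 :: quat) * k \<noteq> 0 * k" unfolding bij_def inj_def by (metis zero_neq_one)
  then show "k \<noteq> 0" by auto
next
  assume "k \<noteq> 0"
  then show "bij (\<lambda>v. v * k)"
    by (intro bijI') (auto intro!: exI[of _ "_ * inverse k"] simp: mult.assoc)
qed

lemma derivative_linear_mult:
  assumes "k field_differentiable at a"
  shows "((\<lambda>z. (z - a) * k z) has_field_derivative k a) (at a)"
proof -
  have "(k has_field_derivative deriv k a) (at a)"
    using assms by (simp add: DERIV_deriv_iff_field_differentiable)
  then show ?thesis by (auto intro!: derivative_eq_intros)
qed

text \<open>The derivative of the quadratic form pairs \<open>F z - c\<close> with
  \<open>F'\<close>. As \<open>c\<close> is the value at \<open>I\<close>, that difference has the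
  parts \<open>- (I * b)\<close> and \<open>b\<close>, and the result consists of the two pairings
  that decide bijectivity in \<open>bij_slice_differential_iff\<close>.\<close>

lemma cq_norm_diff_derivative:
  assumes "cq_has_deriv F F' z" "I \<in> imag_units"
  defines "c \<equiv> cq_eval I (F z)" and "d \<equiv> cq_eval I F'" and "b \<equiv> cq_Im (F z)"
  shows "((\<lambda>w. cq_norm (F w - cq_of_quat c)) has_field_derivative
    2 * Complex (- inner d (I * b)) (inner d b)) (at z)"
proof -
  have d: "((\<lambda>w. cq0 (F w)) has_field_derivative cq0 F') (at z)"
    "((\<lambda>w. cq1 (F w)) has_field_derivative cq1 F') (at z)"
    "((\<lambda>w. cq2 (F w)) has_field_derivative cq2 F') (at z)"
    "((\<lambda>w. cq3 (F w)) has_field_derivative cq3 F') (at z)"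
    using assms(1) by (simp_all add: cq_has_deriv_def)
  define W where "W = F z - cq_of_quat c"
  have "((\<lambda>w. cq_norm (F w - cq_of_quat c)) has_field_derivative
      2 * (cq0 W * cq0 F' + cq1 W * cq1 F' + cq2 W * cq2 F' + cq3 W * cq3 F')) (at z)"
    unfolding cq_norm_def W_def cquat_simps
    by (rule derivative_eq_intros d refl)+ (simp add: algebra_simps)
  moreover have "cq0 W * cq0 F' + cq1 W * cq1 F' + cq2 W * cq2 F' + cq3 W * cq3 F' =
      Complex (- inner d (I * b)) (inner d b)"
  proof -
    have W: "cq_Re W = - (I * b)" "cq_Im W = b"
      by (simp_all add: W_def c_def cq_eval_def b_def quat_eq_iff)
    have "cq0 W * cq0 F' + cq1 W * cq1 F' + cq2 W * cq2 F' + cq3 W * cq3 F' =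
        Complex (inner (cq_Re W) (cq_Re F') - inner (cq_Im W) (cq_Im F'))
          (inner (cq_Re W) (cq_Im F') + inner (cq_Im W) (cq_Re F'))"
      by (simp add: complex_eq_iff inner_quat_def)
    also have "\<dots> = Complex (- inner d (I * b)) (inner d b)"
      unfolding W d_def cq_eval_def inner_add_left inner_imag_unit_mult[OF assms(2)]
      by (simp add: inner_commute imag_units_square_left[OF assms(2)])
    finally show ?thesis .
  qed
  ultimately show ?thesis by simp
qed

lemma singular_set_iff:
  assumes "(f has_derivative L) (at q)" "q \<in> \<Omega>"
  shows "q \<in> singular_set \<Omega> f \<longleftrightarrow> \<not> bij L"
  using frechet_derivative_at[OF assms(1)] assms(2) by (simp add: singular_set_def)

context symmetric_slice
begin

text \<open>Motion inside the slice gives the slice derivative. Motion orthogonal to it turns the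
  unit of a point at distance \<open>Im z\<close> from the real axis, hence the factor
  \<open>1 / Im z\<close> before the imaginary part of the stem.\<close>

lemma slice_regular_has_derivative:
  assumes "induces F f" "q \<in> \<Omega>" "qvec q \<noteq> 0"
  defines "I \<equiv> qunit q" and "z \<equiv> qpolar q"
  shows "(f has_derivative (\<lambda>v. slice_emb I (slice_component I v) * cq_eval I (cq_deriv F z) +
    (1 / Im z) *\<^sub>R (slice_orth I v * cq_Im (F z)))) (at q)"
proof -
  have I: "I \<in> imag_units" unfolding I_def by (rule qunit_imag_unit)
  have z: "z \<in> D" using assms(2) mem_iff_qpolar by (simp add: z_def)
  define y where "y = norm (qvec q)"
  have y: "y \<noteq> 0" "Im z = y" using assms(3) by (simp_all add: y_def z_def qpolar_def)
  have qvec_q: "qvec q = y *\<^sub>R I" using assms(3) by (simp add: I_def y_def qunit_def sgn_div_norm)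
  have "cq_holomorphic_on F D" using assms(1) by (simp add: induces_def stem_def)
  then have F': "cq_has_deriv F (cq_deriv F z) z"
    by (rule cq_holomorphic_derivI[OF _ open_D z])
  define F' where "F' = cq_deriv F z"
  note F' = F'[folded F'_def]
  have pol: "(qpolar has_derivative slice_component I) (at q)"
    using qpolar_has_derivative[OF assms(3)] by (simp add: I_def)
  have chain: "((\<lambda>q. g (qpolar q)) has_derivative (\<lambda>v. g' (slice_component I v))) (at q)"
    if "(g has_derivative g') (at z)" for g g' :: "complex \<Rightarrow> quat"
    using diff_chain_at[OF pol, of g g'] that by (simp add: o_def z_def)
  note dRe = chain[OF cq_Re_has_derivative[OF F']]
  note dIm = chain[OF cq_Im_has_derivative[OF F']]
  have dinv: "((\<lambda>q. inverse (norm (qvec q))) has_derivative (\<lambda>v. - (inverse y * inner v I * inverse y))) (at q)"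
    using Deriv.has_derivative_inverse[OF _ norm_qvec_has_derivative[OF assms(3)]] y
    by (simp add: y_def I_def)
  have dvec: "(qvec has_derivative qvec) (at q)"
    by (rule bounded_linear_imp_has_derivative[OF bounded_linear_qvec])
  have "((\<lambda>q. cq_Re (F (qpolar q)) + inverse (norm (qvec q)) *\<^sub>R (qvec q * cq_Im (F (qpolar q))))
      has_derivative (\<lambda>v. cq_Re (cq_scalar (slice_component I v) * F') +
        (inverse y *\<^sub>R (qvec q * cq_Im (cq_scalar (slice_component I v) * F') + qvec v * cq_Im (F z)) +
        (- (inverse y * inner v I * inverse y)) *\<^sub>R (qvec q * cq_Im (F z))))) (at q)"
    using has_derivative_add[OF dRe has_derivative_scaleR[OF dinv has_derivative_mult[OF dvec dIm]]]
    by (simp add: y_def z_def)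
  moreover have "cq_Re (cq_scalar (slice_component I v) * F') +
        (inverse y *\<^sub>R (qvec q * cq_Im (cq_scalar (slice_component I v) * F') + qvec v * cq_Im (F z)) +
        (- (inverse y * inner v I * inverse y)) *\<^sub>R (qvec q * cq_Im (F z))) =
      slice_emb I (slice_component I v) * cq_eval I F' +
      (1 / Im z) *\<^sub>R (slice_orth I v * cq_Im (F z))" for v
  proof -
    define X where "X = cq_scalar (slice_component I v) * F'"
    \<comment> \<open>The term from differentiating \<open>inverse (norm (qvec q))\<close> removes
      the component of \<open>qvec v\<close> along \<open>I\<close> and leaves
      \<open>slice_orth I v\<close>.\<close>
    have "cq_Re X + (inverse y *\<^sub>R (qvec q * cq_Im X + qvec v * cq_Im (F z)) +
        (- (inverse y * inner v I * inverse y)) *\<^sub>R (qvec q * cq_Im (F z))) =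
        cq_eval I X + (1 / Im z) *\<^sub>R (slice_orth I v * cq_Im (F z))"
      unfolding cq_eval_def qvec_q y(2)
      using y(1) by (simp add: slice_orth_def algebra_simps inverse_eq_divide)
    then show ?thesis by (simp only: X_def cq_eval_scalar_mult[OF I])
  qed
  ultimately have d: "((\<lambda>q. cq_Re (F (qpolar q)) + inverse (norm (qvec q)) *\<^sub>R (qvec q * cq_Im (F (qpolar q))))
      has_derivative (\<lambda>v. slice_emb I (slice_component I v) * cq_eval I F' +
        (1 / Im z) *\<^sub>R (slice_orth I v * cq_Im (F z)))) (at q)"
    by simp
  have op: "open (\<Omega> \<inter> qvec -` (- {0}))"
    by (intro open_Int open_domain open_vimage open_Compl closed_singleton
        linear_continuous_on bounded_linear_qvec)
  have eq: "cq_Re (F (qpolar p)) + inverse (norm (qvec p)) *\<^sub>R (qvec p * cq_Im (F (qpolar p))) = f p"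
    if "p \<in> \<Omega> \<inter> qvec -` (- {0})" for p
    using that induces_polar[OF assms(1), of p] by (simp add: cq_eval_def qunit_def sgn_div_norm)
  have "q \<in> \<Omega> \<inter> qvec -` (- {0})" using assms(2,3) by simp
  from has_derivative_transform_within_open[OF d op this eq] show ?thesis by (simp only: F'_def)
qed

lemma singular_nonreal_iff:
  assumes "induces F f" "q \<in> \<Omega>" "qvec q \<noteq> 0"
  defines "I \<equiv> qunit q" and "z \<equiv> qpolar q"
  shows "q \<in> singular_set \<Omega> f \<longleftrightarrow>
    inner (cq_eval I (cq_deriv F z)) (cq_Im (F z)) = 0 \<and>
    inner (cq_eval I (cq_deriv F z)) (I * cq_Im (F z)) = 0"
proof -
  note deriv = slice_regular_has_derivative[OF assms(1-3), folded I_def z_def]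
  have "Im z \<noteq> 0" using assms(3) by (simp add: z_def qvec_eq_0_iff)
  moreover have "I \<in> imag_units" unfolding I_def by (rule qunit_imag_unit)
  ultimately show ?thesis
    using singular_set_iff[OF deriv assms(2)]
      bij_slice_differential_iff[OF _ _ has_derivative_linear[OF deriv]] by blast
qed

lemma stem_real_quotient:
  assumes "induces F f" "of_real x \<in> D"
  obtains G where "stem G"
    "\<And>z. z \<in> D \<Longrightarrow> F z - cq_of_quat (f (of_real x)) = cq_scalar (z - of_real x) * G z"
proof -
  have "f (of_real x) = cq_eval quat_i (F (of_real x))"
    using induces_eval[OF assms(1) quat_i_imag_unit assms(2)] by (simp add: slice_emb_of_real)
  then have "F (of_real x) - cq_of_quat (f (of_real x)) = 0"
    using stem_real(2,3)[OF induces_stem[OF assms(1)] assms(2)] by simp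
  then show ?thesis
    using stem_divide_real[OF induces_stem[OF induces_diff_const[OF assms(1), of "f (of_real x)"]] assms(2)]
      that by auto
qed

text \<open>Polar coordinates are not differentiable on the real axis. Instead the increment of
  \<open>f\<close> at the real point is \<open>(q - of_real x) * k q\<close> with \<open>k\<close>
  continuous there, so the differential is right multiplication by the limit of
  \<open>k\<close>.\<close>

lemma slice_regular_has_derivative_real:
  assumes "induces F f" "of_real x \<in> D" "stem G"
    and "\<And>z. z \<in> D \<Longrightarrow> F z - cq_of_quat (f (of_real x)) = cq_scalar (z - of_real x) * G z"
  shows "(f has_derivative (\<lambda>v. v * cq_Re (G (of_real x)))) (at (of_real x))"
proof -
  define k where "k = (\<lambda>q. cq_eval (qunit q) (G (qpolar q)))"
  define k0 where "k0 = cq_Re (G (of_real x))"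
  have pol_x: "qpolar (of_real x) = of_real x" by (simp add: qpolar_def qvec_def complex_eq_iff)
  have f_eq: "f q - f (of_real x) = (q - of_real x) * k q" if q: "q \<in> \<Omega>" for q
  proof -
    have "f q - f (of_real x) = cq_eval (qunit q) (F (qpolar q) - cq_of_quat (f (of_real x)))"
      using induces_polar[OF assms(1) q] by (simp add: cq_eval_diff)
    also have "\<dots> = slice_emb (qunit q) (qpolar q - of_real x) * k q"
      using q assms(4)[of "qpolar q"]
      by (simp add: mem_iff_qpolar cq_eval_scalar_mult[OF qunit_imag_unit] k_def)
    also have "slice_emb (qunit q) (qpolar q - of_real x) = q - of_real x"
      using slice_emb_polar[of q] by (simp add: slice_emb_def)
    finally show ?thesis .
  qed
  have "cq_holomorphic_on G D" using assms(3) by (simp add: stem_def)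
  then have G': "cq_has_deriv G (cq_deriv G (of_real x)) (of_real x)"
    by (rule cq_holomorphic_derivI[OF _ open_D assms(2)])
  \<comment> \<open>\<open>qunit q\<close> has no limit at a real point; this does no harm because
    it multiplies a term that tends to 0.\<close>
  have Im0: "cq_Im (G (of_real x)) = 0"
    using stem_real(1)[OF assms(3,2)] by (simp add: quat_eq_iff cquat_eq_iff complex_eq_iff)
  have cont: "((\<lambda>q. g (qpolar q)) \<longlongrightarrow> g (of_real x)) (at (of_real x))"
    if "(g has_derivative g') (at (of_real x))" for g g' :: "complex \<Rightarrow> quat"
  proof -
    have "isCont g (qpolar (of_real x))" using has_derivative_continuous[OF that] pol_x by simp
    moreover have "isCont qpolar (of_real x)"
      using continuous_qpolar[of UNIV] continuous_on_eq_continuous_at[of UNIV qpolar] by simp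
    ultimately have "isCont (\<lambda>q. g (qpolar q)) (of_real x)" by (rule isCont_o2[rotated])
    then show ?thesis by (simp add: isCont_def pol_x)
  qed
  have "((\<lambda>q. norm (cq_Re (G (qpolar q)) - k0) + norm (cq_Im (G (qpolar q)))) \<longlongrightarrow>
      norm (cq_Re (G (of_real x)) - k0) + norm (cq_Im (G (of_real x)))) (at (of_real x))"
    by (intro tendsto_intros cont[OF cq_Re_has_derivative[OF G']] cont[OF cq_Im_has_derivative[OF G']])
  then have lim: "((\<lambda>q. norm (cq_Re (G (qpolar q)) - k0) + norm (cq_Im (G (qpolar q)))) \<longlongrightarrow> 0) (at (of_real x))"
    by (simp add: k0_def Im0)
  have "of_real x \<in> \<Omega>"
    using assms(2) slice_emb_mem_iff[OF quat_i_imag_unit, of "of_real x"]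
    by (simp add: slice_emb_of_real)
  then obtain e where e: "e > 0" "ball (of_real x) e \<subseteq> \<Omega>" using open_domain openE by blast
  show ?thesis
    unfolding k0_def[symmetric]
  proof (rule has_derivativeI_sandwich[OF e(1) _ _ lim])
    show "bounded_linear (\<lambda>v. v * k0)" by (rule bounded_linear_mult_left)
    fix q :: quat assume q: "q \<noteq> of_real x" "dist q (of_real x) < e"
    then have "q \<in> \<Omega>" using e(2) by (auto simp: dist_commute)
    then have "f q - f (of_real x) - (q - of_real x) * k0 = (q - of_real x) * (k q - k0)"
      by (simp add: f_eq right_diff_distrib)
    then have "norm (f q - f (of_real x) - (q - of_real x) * k0) / norm (q - of_real x) = norm (k q - k0)"
      using q by (simp add: norm_mult)
    also have "k q - k0 = (cq_Re (G (qpolar q)) - k0) + qunit q * cq_Im (G (qpolar q))"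
      by (simp add: k_def cq_eval_def)
    also have "norm \<dots> \<le> norm (cq_Re (G (qpolar q)) - k0) + norm (cq_Im (G (qpolar q)))"
      using norm_triangle_ineq[of "cq_Re (G (qpolar q)) - k0" "qunit q * cq_Im (G (qpolar q))"]
      by (simp add: norm_mult norm_imag_unit[OF qunit_imag_unit])
    finally show "norm (f q - f (of_real x) - (q - of_real x) * k0) / norm (q - of_real x) \<le>
      norm (cq_Re (G (qpolar q)) - k0) + norm (cq_Im (G (qpolar q)))" .
  qed
qed

lemma slice_regular_continuous:
  assumes "slice_regular \<Omega> f" "q \<in> \<Omega>"
  shows "isCont f q"
proof (cases "qvec q = 0")
  case True
  then have q: "q = of_real (qRe q)" by (simp add: qvec_def)
  then have "qpolar q = of_real (qRe q)" using True by (simp add: qpolar_def complex_eq_iff)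
  then have "of_real (qRe q) \<in> D" using assms(2) mem_iff_qpolar by metis
  then show ?thesis
    using stem_real_quotient[OF induces_stem_of[OF assms(1)]] has_derivative_continuous q
      slice_regular_has_derivative_real[OF induces_stem_of[OF assms(1)]] by metis
next
  case False
  then show ?thesis
    using has_derivative_continuous[OF slice_regular_has_derivative[OF induces_stem_of[OF assms(1)] assms(2)]]
    by simp
qed

text \<open>At a real point the stem value is a quaternion, where norm 0 forces 0; so if the
  symmetrization vanished, the stem would vanish on the reals and hence on all of
  \<open>D\<close>.\<close>

lemma symm_diff_const_nonzero:
  assumes "slice_regular \<Omega> f" "\<not> f constant_on \<Omega>"
  shows "\<exists>\<beta>\<in>D. symm (\<lambda>q. f q - c) \<beta> \<noteq> 0"
proof (rule ccontr)
  assume *: "\<not> ?thesis"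
  define F where "F = (\<lambda>z. stem_of f z - cq_of_quat c)"
  note f = induces_stem_of[OF assms(1)]
  have F: "induces F (\<lambda>q. f q - c)" unfolding F_def by (rule induces_diff_const[OF f])
  have "F (of_real r) = 0" if r: "of_real r \<in> D" for r
  proof -
    have real: "F (of_real r) = cq_of_quat (cq_Re (F (of_real r)))"
      using stem_real(2)[OF induces_stem[OF F] r] by simp
    have "cq_norm (F (of_real r)) = 0" using * r symm_eq[OF F r] by auto
    then obtain I where "cq_eval I (F (of_real r)) = 0" using eval_eq_0_if_cq_norm by blast
    then have "cq_Re (F (of_real r)) = 0" using real cq_eval_of_quat by metis
    then show ?thesis using real by (simp add: cquat_eq_iff)
  qed
  then have "F z = 0" if "z \<in> D" for z
    using stem_zero_on_reals[OF induces_stem[OF F] _ that] by blast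
  then have "f q = c" if "q \<in> \<Omega>" for q
    using induces_polar[OF F that] that mem_iff_qpolar by simp
  then show False using assms(2) by (auto simp: constant_on_def)
qed

lemma slice_regular_diff_const: "slice_regular \<Omega> f \<Longrightarrow> slice_regular \<Omega> (\<lambda>q. f q - c)"
  by (rule slice_regular_if_induces[OF induces_diff_const[OF induces_stem_of]])

lemma symm_diff_const:
  assumes "slice_regular \<Omega> f" "z \<in> D"
  shows "symm (\<lambda>q. f q - c) z = cq_norm (stem_of f z - cq_of_quat c)"
  using symm_eq[OF induces_diff_const[OF induces_stem_of[OF assms(1)]] assms(2)] by simp

lemma symm_zero_at_value:
  assumes "slice_regular \<Omega> f" "q \<in> \<Omega>"
  shows "symm (\<lambda>p. f p - f q) (qpolar q) = 0"
proof -
  have z: "qpolar q \<in> D" using assms(2) mem_iff_qpolar by simp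
  have "cq_eval (qunit q) (stem_of f (qpolar q) - cq_of_quat (f q)) = 0"
    using induces_polar[OF induces_stem_of[OF assms(1)] assms(2)] by (simp add: cq_eval_diff)
  then show ?thesis
    using cq_norm_eq_0_if_eval[OF qunit_imag_unit] symm_diff_const[OF assms(1) z] by simp
qed

text \<open>Write \<open>N = Suc M\<close>. Off the real axis the derivative of the symmetrization
  vanishes at \<open>z\<close> iff \<open>M \<noteq> 0\<close>, and its parts are, up to sign and a
  factor 2, the pairings in \<open>singular_nonreal_iff\<close>. At a real point the root is double
  and the derivative says nothing; there the norm of the difference quotient \<open>G\<close> is
  compared with the symmetrization divided by the square of \<open>w - z\<close>.\<close>

lemma singular_iff_multiplicity:
  assumes "slice_regular \<Omega> f" "\<not> f constant_on \<Omega>" "q \<in> \<Omega>"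
  shows "q \<in> singular_set \<Omega> f \<longleftrightarrow>
    total_multiplicity \<Omega> (\<lambda>p. f p - f q) (slice_sphere (Re (qpolar q)) (Im (qpolar q))) \<ge> 2"
proof -
  define x y z N s where "x = Re (qpolar q)" and "y = Im (qpolar q)" and "z = qpolar q"
    and "N = total_multiplicity \<Omega> (\<lambda>p. f p - f q) (slice_sphere x y)" and "s = symm (\<lambda>p. f p - f q)"
  note f = induces_stem_of[OF assms(1)]
  have z_eq: "Complex x y = z" by (simp add: x_def y_def z_def)
  have z: "z \<in> D" using assms(3) mem_iff_qpolar by (simp add: z_def)
  obtain \<beta> where \<beta>: "\<beta> \<in> D" "s \<beta> \<noteq> 0"
    using symm_diff_const_nonzero[OF assms(1,2)] unfolding s_def by blast
  obtain u where u: "u holomorphic_on D" "u z \<noteq> 0"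
      "\<And>w. w \<in> D \<Longrightarrow> s w = sphere_poly x y w ^ N * u w"
    using total_multiplicity_symm(2)[OF slice_regular_diff_const[OF assms(1)] _ \<beta>(1), of x y "f q"]
      \<beta>(2) z z_eq unfolding N_def s_def by metis
  have "s z = 0" unfolding s_def z_def by (rule symm_zero_at_value[OF assms(1,3)])
  have "N \<noteq> 0" using u(3)[OF z] u(2) \<open>s z = 0\<close> by auto
  then obtain M where M: "N = Suc M" by (cases N) auto
  have s_eq: "s w = cq_norm (stem_of f w - cq_of_quat (f q))" if "w \<in> D" for w
    unfolding s_def by (rule symm_diff_const[OF assms(1) that])
  have "q \<in> singular_set \<Omega> f \<longleftrightarrow> M \<noteq> 0"
  proof (cases "y = 0")
    case False
    define I d b where "I = qunit q" and "d = cq_eval I (cq_deriv (stem_of f) z)" and "b = cq_Im (stem_of f z)"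
    have qv: "qvec q \<noteq> 0" using False by (simp add: qvec_eq_0_iff y_def)
    define k where "k = (\<lambda>w. (w - Complex x (- y)) * sphere_poly x y w ^ M * u w)"
    have "k holomorphic_on D"
      unfolding k_def by (intro holomorphic_intros sphere_poly_holomorphic u)
    then have d1: "((\<lambda>w. (w - z) * k w) has_field_derivative k z) (at z)"
      using z open_D by (intro derivative_linear_mult) (rule holomorphic_on_imp_differentiable_at)
    have d2: "(w - z) * k w = cq_norm (stem_of f w - cq_of_quat (f q))" if "w \<in> D" for w
      using u(3)[OF that] s_eq[OF that]
      by (simp add: k_def M) (simp add: sphere_poly_def z_eq)
    have d3: "((\<lambda>w. cq_norm (stem_of f w - cq_of_quat (f q))) has_field_derivative k z) (at z)"
      by (rule has_field_derivative_transform_within_open[OF d1 open_D z d2])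
    have fq: "f q = cq_eval I (stem_of f z)"
      using induces_polar[OF f assms(3)] by (simp add: I_def z_def)
    have "cq_has_deriv (stem_of f) (cq_deriv (stem_of f) z) z"
      using stem_stem_of[OF assms(1)] by (intro cq_holomorphic_derivI[OF _ open_D z]) (simp add: stem_def)
    then have "k z = 2 * Complex (- inner d (I * b)) (inner d b)"
      using DERIV_unique[OF d3] cq_norm_diff_derivative[OF _ qunit_imag_unit, of "stem_of f" _ z q]
      unfolding fq d_def b_def I_def by blast
    moreover have "k z = 0 \<longleftrightarrow> M \<noteq> 0"
      using u(2) False z_eq sphere_poly_zero[of x y] by (auto simp: k_def complex_eq_iff)
    ultimately show ?thesis
      using singular_nonreal_iff[OF f assms(3) qv, folded I_def z_def, folded d_def b_def]
      by (auto simp: complex_eq_iff)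
  next
    case True
    then have zx: "z = of_real x" using z_eq by (simp add: complex_eq_iff flip: z_eq)
    have qx: "q = of_real x"
      using slice_emb_polar[of q] True by (simp add: x_def y_def slice_emb_def)
    obtain G where G: "stem G"
        "\<And>w. w \<in> D \<Longrightarrow> stem_of f w - cq_of_quat (f q) = cq_scalar (w - z) * G w"
      using stem_real_quotient[OF f] z unfolding zx qx by blast
    have sing: "q \<in> singular_set \<Omega> f \<longleftrightarrow> cq_Re (G z) = 0"
      using singular_set_iff[OF slice_regular_has_derivative_real[OF f _ G(1)], of x \<Omega>]
        z G(2) assms(3) by (simp add: zx qx bij_mult_right_iff)
    have nG: "cq_norm (G w) = sphere_poly x y w ^ M * u w" if "w \<in> D" "w \<noteq> z" for w
    proof -
      have sp: "sphere_poly x y w = (w - z)\<^sup>2"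
        using True z_eq by (simp add: sphere_poly_def power2_eq_square)
      have "(w - z)\<^sup>2 * cq_norm (G w) = (w - z)\<^sup>2 * (sphere_poly x y w ^ M * u w)"
        using s_eq[OF that(1)] u(3)[OF that(1)] G(2)[OF that(1)]
        by (simp add: cq_norm_mult cq_norm_scalar M) (auto simp: sp)
      then show ?thesis using that(2) by simp
    qed
    \<comment> \<open>Cancelling the square works for \<open>w \<noteq> z\<close> only; a
      holomorphic function that vanishes on a punctured neighbourhood of \<open>z\<close> vanishes
      at \<open>z\<close>.\<close>
    define E where "E = (\<lambda>w. cq_norm (G w) - sphere_poly x y w ^ M * u w)"
    have "E holomorphic_on D"
      unfolding E_def using G(1)
      by (intro holomorphic_intros sphere_poly_holomorphic u cq_norm_holomorphic) (simp add: stem_def)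
    have "E z = 0"
    proof (rule ccontr)
      assume "E z \<noteq> 0"
      from non_zero_frequently(1)[OF \<open>E holomorphic_on D\<close> open_D connected_D z z this]
      have "\<forall>\<^sub>F w in at z. E w \<noteq> 0" .
      moreover have "\<forall>\<^sub>F w in at z. w \<in> D - {z}"
        using eventually_at_in_open[OF open_D z] .
      ultimately have "\<forall>\<^sub>F w in at z. False"
        by eventually_elim (auto simp: E_def nG)
      then show False by simp
    qed
    then have "cq_norm (G z) = 0 \<longleftrightarrow> M \<noteq> 0"
      using u(2) sphere_poly_zero[of x y] by (auto simp: E_def z_eq)
    moreover have "cq_norm (G z) = 0 \<longleftrightarrow> cq_Re (G z) = 0"
    proof -
      have real: "G z = cq_of_quat (cq_Re (G z))" using stem_real(2)[OF G(1) z] zx by simp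
      have "cq_Im (G z) = 0" by (subst real) (simp add: quat_eq_iff)
      then have "Re (cq_norm (G z)) = inner (cq_Re (G z)) (cq_Re (G z))" "Im (cq_norm (G z)) = 0"
        by (simp_all add: cq_norm_Re_Im)
      then show ?thesis by (auto simp: complex_eq_iff)
    qed
    ultimately show ?thesis using sing by simp
  qed
  then show ?thesis unfolding N_def[symmetric, unfolded x_def y_def] M by auto
qed

end

section \<open>The interior of the singular set\<close>

text \<open>On the great circle through \<open>I\<close> and an orthogonal unit \<open>w\<close>,
  the parameters \<open>t\<close> and \<open>- t\<close> both give the value \<open>c\<close> when
  \<open>t\<close> is small. The odd part yields \<open>L w = 0\<close>, the even part
  \<open>cos t * c = c\<close>, hence \<open>c = 0\<close>.\<close>

lemma linear_constant_near_imag_unit: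
  fixes L :: "quat \<Rightarrow> real"
  assumes L: "linear L" and I: "I \<in> imag_units" and A: "open A" "I \<in> A"
    and const: "\<And>J. \<lbrakk>J \<in> imag_units; J \<in> A\<rbrakk> \<Longrightarrow> L J = c"
  shows "c = 0" "qRe w = 0 \<Longrightarrow> L w = 0"
proof -
  have I0: "qRe I = 0" "inner I I = 1"
    using I norm_imag_unit[OF I] by (simp_all add: imag_units_iff norm_eq_1)
  have LI: "L I = c" using const I A by blast
  have unit: "L w = 0 \<and> c = 0" if w: "qRe w = 0" "inner w I = 0" "norm w = 1" for w
  proof -
    define J where "J = (\<lambda>t. cos t *\<^sub>R I + sin t *\<^sub>R w)"
    have w1: "inner w w = 1" using w(3) by (simp add: norm_eq_1)
    have J: "J t \<in> imag_units" for t
    proof -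
      have "inner (J t) (J t) = (cos t)\<^sup>2 * inner I I + 2 * cos t * sin t * inner w I + (sin t)\<^sup>2 * inner w w"
        by (simp add: J_def inner_add_left inner_add_right inner_commute power2_eq_square algebra_simps)
      then have "inner (J t) (J t) = 1" using w1 w(2) I0 by simp
      moreover have "qRe (J t) = 0" using w I0 by (simp add: J_def)
      ultimately show ?thesis by (simp add: imag_units_iff inner_quat_def power2_eq_square)
    qed
    have "continuous_on UNIV J" unfolding J_def by (intro continuous_intros)
    then have "open (J -` A)" using A(1) continuous_on_open_vimage[of UNIV J] by auto
    moreover have "0 \<in> J -` A" using A(2) by (simp add: J_def)
    ultimately obtain e where e: "e > 0" "ball 0 e \<subseteq> J -` A" using openE by blast
    \<comment> \<open>Small enough for both points to stay in \<open>A\<close>, and in the range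
      where \<open>sin t > 0\<close>, which also gives \<open>cos t \<noteq> 1\<close>.\<close>
    define t where "t = min e 1 / 2"
    have t: "0 < t" "t < e" "t \<le> 1 / 2" using e(1) by (auto simp: t_def)
    then have tA: "J t \<in> A" "J (- t) \<in> A" using e(2) by (auto simp: subset_iff)
    have eq: "cos t * c + sin t * L w = c" "cos t * c - sin t * L w = c"
      using const[OF J tA(1)] const[OF J tA(2)] LI L
      by (simp_all add: J_def linear_add linear_diff linear_scale)
    have sin: "sin t > 0" using t pi_gt3 by (intro sin_gt_zero) auto
    have "sin t * L w = 0" using eq by linarith
    then have "L w = 0" using sin by simp
    have "(cos t)\<^sup>2 < 1" using sin by (simp add: cos_squared_eq)
    then have "cos t \<noteq> 1" by auto
    then have "c = 0" using eq(1) \<open>L w = 0\<close> by simp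
    with \<open>L w = 0\<close> show ?thesis by simp
  qed
  have orth: "L w = 0 \<and> c = 0" if w: "qRe w = 0" "inner w I = 0" "w \<noteq> 0" for w
  proof -
    have "L ((1 / norm w) *\<^sub>R w) = 0 \<and> c = 0"
      using w by (intro unit) simp_all
    then show ?thesis using w(3) L by (simp add: linear_scale)
  qed
  obtain w0 where "w0 \<noteq> 0" "qRe w0 = 0" "inner w0 I = 0" using exists_imag_orthogonal by blast
  then show c: "c = 0" using orth by blast
  assume "qRe w = 0"
  then have "w = inner w I *\<^sub>R I + slice_orth I w" by (simp add: slice_orth_def qvec_def)
  moreover have "L (inner w I *\<^sub>R I + slice_orth I w) = inner w I * c + L (slice_orth I w)"
    using L LI by (simp add: linear_add linear_scale)
  moreover have "L (slice_orth I w) = 0"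
    using orth[of "slice_orth I w"] slice_orth_orthogonal[OF I, of w] L
    by (cases "slice_orth I w = 0") (auto simp: linear_0)
  ultimately show "L w = 0" using c by simp
qed

text \<open>\<open>b\<close> is orthogonal to every left multiple of \<open>a\<close>, and for
  \<open>a \<noteq> 0\<close> one of these multiples is \<open>b\<close> itself.\<close>

lemma eq_0_if_orthogonal_to_all_multiples:
  fixes a b :: quat
  assumes "inner a b = 0" "\<And>w. qRe w = 0 \<Longrightarrow> inner (w * a) b = 0"
  shows "a = 0 \<or> b = 0"
proof (rule ccontr)
  assume *: "\<not> (a = 0 \<or> b = 0)"
  define p where "p = b * inverse a"
  have "p = qRe p *\<^sub>R 1 + qvec p" by (simp add: qvec_def of_real_def)
  then have "inner (p * a) b = qRe p * inner a b + inner (qvec p * a) b"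
    by (metis distrib_right inner_add_left inner_scaleR_left mult_1_left scaleR_conv_of_real mult_scaleR_left)
  also have "\<dots> = 0" using assms by (simp add: qvec_def)
  finally show False using * by (simp add: p_def mult.assoc)
qed

lemma continuous_slice_emb: "continuous_on A (\<lambda>p. slice_emb (snd p) (fst p))"
  unfolding slice_emb_def by (intro continuous_intros)

context symmetric_slice
begin

lemma stem_constant_if_deriv_zero:
  assumes "stem F" "open A" "A \<noteq> {}" "A \<subseteq> D" "\<And>z. z \<in> A \<Longrightarrow> cq_deriv F z = 0"
  shows "\<exists>w. \<forall>z\<in>D. F z = w"
proof -
  have const: "\<exists>c. \<forall>z\<in>D. g z = c"
    if g: "g holomorphic_on D" "\<And>z. z \<in> A \<Longrightarrow> deriv g z = 0" for g
  proof -
    obtain a where a: "a \<in> A" using assms(3) by blast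
    have "deriv g z = 0" if "z \<in> D" for z
    proof (rule analytic_continuation[OF _ open_D connected_D assms(4) _ _ g(2) that])
      show "deriv g holomorphic_on D" using g(1) open_D by (rule holomorphic_deriv)
      show "a \<in> D" using a assms(4) by blast
      show "a islimpt A" using assms(2) a by (rule interior_limit_point[OF subsetD[OF eq_refl[OF interior_open[symmetric]]]])
    qed
    then have "(g has_field_derivative 0) (at z)" if "z \<in> D" for z
      using holomorphic_derivI[OF g(1) open_D that] that by simp
    then show ?thesis
      using DERIV_zero_connected_constant[OF connected_D open_D finite.emptyI
          holomorphic_on_imp_continuous_on[OF g(1)]] by (metis DiffD1)
  qed
  have hol: "cq_holomorphic_on F D" using assms(1) by (simp add: stem_def)
  obtain c0 where c0: "\<forall>z\<in>D. cq0 (F z) = c0"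
    using const[of "\<lambda>z. cq0 (F z)"] hol assms(5) by (auto simp: cq_holomorphic_on_def cq_deriv_def cquat_eq_iff)
  obtain c1 where c1: "\<forall>z\<in>D. cq1 (F z) = c1"
    using const[of "\<lambda>z. cq1 (F z)"] hol assms(5) by (auto simp: cq_holomorphic_on_def cq_deriv_def cquat_eq_iff)
  obtain c2 where c2: "\<forall>z\<in>D. cq2 (F z) = c2"
    using const[of "\<lambda>z. cq2 (F z)"] hol assms(5) by (auto simp: cq_holomorphic_on_def cq_deriv_def cquat_eq_iff)
  obtain c3 where c3: "\<forall>z\<in>D. cq3 (F z) = c3"
    using const[of "\<lambda>z. cq3 (F z)"] hol assms(5) by (auto simp: cq_holomorphic_on_def cq_deriv_def cquat_eq_iff)
  show ?thesis
    using c0 c1 c2 c3 by (intro exI[of _ "CQuat c0 c1 c2 c3"]) (simp add: cquat_eq_iff)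
qed

lemma eventually_cq_deriv_nonzero:
  assumes "stem F" "z \<in> D" "cq_deriv F z \<noteq> 0"
  shows "\<forall>\<^sub>F w in nhds z. cq_deriv F w \<noteq> 0"
proof -
  have ev: "\<forall>\<^sub>F w in nhds z. deriv g w \<noteq> 0" if g: "g holomorphic_on D" "deriv g z \<noteq> 0" for g
  proof -
    have "continuous_on D (deriv g)"
      using holomorphic_deriv[OF g(1) open_D] by (rule holomorphic_on_imp_continuous_on)
    then have "isCont (deriv g) z" using open_D assms(2) continuous_on_eq_continuous_at by blast
    then have "(deriv g \<longlongrightarrow> deriv g z) (nhds z)" by (simp add: continuous_at tendsto_at_iff_tendsto_nhds)
    then show ?thesis using g(2) by (rule tendsto_imp_eventually_ne)
  qed
  have hol: "cq_holomorphic_on F D" using assms(1) by (simp add: stem_def)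
  consider "cq0 (cq_deriv F z) \<noteq> 0" | "cq1 (cq_deriv F z) \<noteq> 0" | "cq2 (cq_deriv F z) \<noteq> 0" | "cq3 (cq_deriv F z) \<noteq> 0"
    using assms(3) by (auto simp: cquat_eq_iff)
  then show ?thesis
  proof cases
    case 1
    with hol have "\<forall>\<^sub>F w in nhds z. deriv (\<lambda>w. cq0 (F w)) w \<noteq> 0"
      by (intro ev) (simp_all add: cq_holomorphic_on_def cq_deriv_def)
    then show ?thesis by eventually_elim (auto simp: cq_deriv_def cquat_eq_iff)
  next
    case 2
    with hol have "\<forall>\<^sub>F w in nhds z. deriv (\<lambda>w. cq1 (F w)) w \<noteq> 0"
      by (intro ev) (simp_all add: cq_holomorphic_on_def cq_deriv_def)
    then show ?thesis by eventually_elim (auto simp: cq_deriv_def cquat_eq_iff)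
  next
    case 3
    with hol have "\<forall>\<^sub>F w in nhds z. deriv (\<lambda>w. cq2 (F w)) w \<noteq> 0"
      by (intro ev) (simp_all add: cq_holomorphic_on_def cq_deriv_def)
    then show ?thesis by eventually_elim (auto simp: cq_deriv_def cquat_eq_iff)
  next
    case 4
    with hol have "\<forall>\<^sub>F w in nhds z. deriv (\<lambda>w. cq3 (F w)) w \<noteq> 0"
      by (intro ev) (simp_all add: cq_holomorphic_on_def cq_deriv_def)
    then show ?thesis by eventually_elim (auto simp: cq_deriv_def cquat_eq_iff)
  qed
qed

text \<open>A complex linear map with real values is 0; testing the differential on \<open>1\<close>
  and \<open>\<i>\<close> shows it.\<close>

lemma cq_deriv_zero_if_real_valued:
  assumes "stem F" "open A" "z \<in> A" "A \<subseteq> D" "\<And>w. w \<in> A \<Longrightarrow> cq_Im (F w) = 0"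
  shows "cq_deriv F z = 0"
proof -
  have z: "z \<in> D" using assms by blast
  have "cq_holomorphic_on F D" using assms(1) by (simp add: stem_def)
  then have "cq_has_deriv F (cq_deriv F z) z" by (rule cq_holomorphic_derivI[OF _ open_D z])
  note d = cq_Im_has_derivative[OF this]
  have "((\<lambda>w. 0) has_derivative (\<lambda>h. cq_Im (cq_scalar h * cq_deriv F z))) (at z)"
    by (rule has_derivative_transform_within_open[OF d assms(2,3)]) (simp add: assms(5))
  then have "(\<lambda>h. cq_Im (cq_scalar h * cq_deriv F z)) = (\<lambda>h. 0)"
    using has_derivative_unique has_derivative_const by blast
  from fun_cong[OF this, of 1] fun_cong[OF this, of \<i>] show ?thesis
    by (simp add: quat_eq_iff cquat_eq_iff complex_eq_iff)
qed

text \<open>At a non-real singular point \<open>x + y I\<close> two expressions affine in \<open>I\<close> vanish. If this holds for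
  all \<open>I\<close> in an open subset of the sphere, all coefficients vanish.\<close>

theorem interior_singular_set:
  assumes "slice_regular \<Omega> f" "\<not> f constant_on \<Omega>"
  shows "interior (singular_set \<Omega> f) = {}"
proof (rule ccontr)
  assume "interior (singular_set \<Omega> f) \<noteq> {}"
  then obtain B q where B: "open B" "q \<in> B" "B \<subseteq> singular_set \<Omega> f"
    by (auto simp: interior_def)
  define F where "F = stem_of f"
  have f: "induces F f" unfolding F_def by (rule induces_stem_of[OF assms(1)])
  note F = induces_stem[OF f]
  \<comment> \<open>The criterion by two pairings applies off the real axis, so such a point of
    \<open>B\<close> is chosen.\<close>
  have "\<exists>p\<in>B. qvec p \<noteq> 0"
  proof (cases "qvec q = 0")
    case True
    obtain e where e: "e > 0" "ball q e \<subseteq> B" using B openE by blast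
    define p where "p = q + (e / 2) *\<^sub>R quat_i"
    have "norm quat_i = 1" by (rule norm_imag_unit) simp
    then have "dist q p = e / 2" using e(1) by (simp add: p_def dist_norm)
    then have "p \<in> B" using e by auto
    moreover have "qIm1 (qvec q) = qIm1 q" by (simp add: qvec_def)
    then have "qIm1 (qvec p) \<noteq> 0" using True e(1) by (simp add: p_def qvec_def)
    then have "qvec p \<noteq> 0" by auto
    ultimately show ?thesis by blast
  qed (use B in blast)
  then obtain p where p: "p \<in> B" "qvec p \<noteq> 0" by blast
  define I z where "I = qunit p" and "z = qpolar p"
  have I: "I \<in> imag_units" unfolding I_def by (rule qunit_imag_unit)
  \<comment> \<open>Pulling \<open>B\<close> back to pairs \<open>(w, J)\<close> yields a product
    neighbourhood: one open set \<open>A2\<close> of units serves for all \<open>w\<close> near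
    \<open>z\<close>.\<close>
  have "open ((\<lambda>p. slice_emb (snd p) (fst p)) -` B)"
    using continuous_on_open_vimage[of UNIV "\<lambda>p. slice_emb (snd p) (fst p)"] B(1) continuous_slice_emb
    by auto
  moreover have "(z, I) \<in> (\<lambda>p. slice_emb (snd p) (fst p)) -` B"
    using slice_emb_polar[of p] p by (simp add: I_def z_def)
  ultimately obtain A1 A2 where A: "open A1" "open A2" "(z, I) \<in> A1 \<times> A2"
    "A1 \<times> A2 \<subseteq> (\<lambda>p. slice_emb (snd p) (fst p)) -` B"
    by (rule open_prod_elim) 
  define A where "A = A1 \<inter> {w. Im w > 0}"
  have openA: "open A" unfolding A_def by (intro open_Int A open_halfspace_Im_gt)
  have zA: "z \<in> A"
    using A(3) p(2) Im_qpolar_nonneg[of p] qvec_eq_0_iff[of p] by (auto simp: A_def z_def)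
  have sing: "slice_emb J w \<in> singular_set \<Omega> f" if "w \<in> A" "J \<in> A2" for w J
  proof -
    have "(w, J) \<in> A1 \<times> A2" using that by (simp add: A_def)
    from subsetD[OF A(4) this] B(3) show ?thesis by auto
  qed
  have AD: "A \<subseteq> D"
  proof
    fix w assume "w \<in> A"
    from sing[OF this, of I] A(3) have "slice_emb I w \<in> \<Omega>" by (simp add: singular_set_def)
    then show "w \<in> D" using slice_emb_mem_iff[OF I] by simp
  qed
  have alt: "cq_Im (F w) = 0 \<or> cq_deriv F w = 0" if w: "w \<in> A" for w
  proof -
    define a b c where "a = cq_Re (cq_deriv F w)" and "b = cq_Im (cq_deriv F w)" and "c = cq_Im (F w)"
    have eqs: "inner (a + J * b) c = 0" "inner (a + J * b) (J * c) = 0"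
      if J: "J \<in> imag_units" "J \<in> A2" for J
    proof -
      have "Im w > 0" using w by (simp add: A_def)
      then have "qunit (slice_emb J w) = J" "qpolar (slice_emb J w) = w" "qvec (slice_emb J w) \<noteq> 0"
        using imag_units_nonzero[OF J(1)]
        by (simp_all add: qunit_slice_emb[OF J(1)] qpolar_slice_emb[OF J(1)] qvec_slice_emb[OF J(1)])
      moreover have "slice_emb J w \<in> singular_set \<Omega> f" using sing w J by blast
      moreover from this have "slice_emb J w \<in> \<Omega>" by (simp add: singular_set_def)
      ultimately show "inner (a + J * b) c = 0" "inner (a + J * b) (J * c) = 0"
        using singular_nonreal_iff[OF f, of "slice_emb J w"]
        by (simp_all add: a_def b_def c_def cq_eval_def)
    qed
    have lin: "linear (\<lambda>J. inner (J * b) c)" "linear (\<lambda>J. inner a (J * c))"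
      by (auto intro!: linearI simp: inner_add_left inner_add_right distrib_right)
    have c1: "inner (J * b) c = - inner a c" if "J \<in> imag_units" "J \<in> A2" for J
      using eqs(1)[OF that] by (simp add: inner_add_left)
    have c2: "inner a (J * c) = - inner b c" if "J \<in> imag_units" "J \<in> A2" for J
      using eqs(2)[OF that] inner_imag_unit_mult(1)[OF that(1)] by (simp add: inner_add_left)
    have I2: "I \<in> A2" using A(3) by simp
    note 1 = linear_constant_near_imag_unit[OF lin(1) I A(2) I2 c1]
    note 2 = linear_constant_near_imag_unit[OF lin(2) I A(2) I2 c2]
    \<comment> \<open>The constant values on the open set of units are \<open>- inner a c\<close>
      and \<open>- inner b c\<close>. That both are 0 supplies the pairing with the factor
      \<open>1\<close> that the purely imaginary factors leave open.\<close>
    have "b = 0 \<or> c = 0"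
      by (rule eq_0_if_orthogonal_to_all_multiples) (use 1 2 in auto)
    moreover have "c = 0 \<or> a = 0"
      by (rule eq_0_if_orthogonal_to_all_multiples) (use 1 2 in \<open>auto simp: inner_commute\<close>)
    ultimately show ?thesis by (auto simp: a_def b_def c_def cq_eq_0_iff)
  qed
  have "cq_deriv F w = 0" if w: "w \<in> A" for w
  proof (rule ccontr)
    \<comment> \<open>The derivative stays nonzero nearby, so by \<open>alt\<close> the stem is real
      valued there, which forces the derivative to vanish after all.\<close>
    assume nz: "cq_deriv F w \<noteq> 0"
    obtain V where V: "open V" "w \<in> V" "\<And>v. v \<in> V \<Longrightarrow> cq_deriv F v \<noteq> 0"
      using eventually_cq_deriv_nonzero[OF F _ nz] w AD unfolding eventually_nhds by blast
    have "cq_deriv F w = 0"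
      using alt V w AD
      by (intro cq_deriv_zero_if_real_valued[OF F open_Int[OF V(1) openA]]) auto
    with nz show False by simp
  qed
  then obtain c where c: "\<And>z. z \<in> D \<Longrightarrow> F z = c"
    using stem_constant_if_deriv_zero[OF F openA _ AD] zA by blast
  \<comment> \<open>A constant stem is a quaternion because it is one at a real point; its
    evaluation is then the same at all units.\<close>
  obtain r where r: "complex_of_real r \<in> D" using ex_real_D by blast
  then have "c = cq_of_quat (cq_Re c)" using stem_real(2)[OF F r] c by simp
  then have "f q = cq_Re c" if "q \<in> \<Omega>" for q
    using induces_polar[OF f that] that c mem_iff_qpolar cq_eval_of_quat by metis
  then show False using assms(2) by (auto simp: constant_on_def)
qed

end

section \<open>Counting zeros\<close>

text \<open>The general theorem weights zeros by winding numbers, which for the circle are 1 inside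
  and 0 outside. The larger radius \<open>R\<close> provides an open set around the circle with only
  finitely many zeros.\<close>

lemma Rouche_disc:
  fixes f g :: "complex \<Rightarrow> complex"
  assumes "f holomorphic_on A" "g holomorphic_on A" "open A" "connected A"
    and "0 < r" "r < R" "cball z0 R \<subseteq> A"
    and "\<not> f constant_on A" "\<not> g constant_on A"
    and less: "\<And>z. z \<in> sphere z0 r \<Longrightarrow> cmod (g z - f z) < cmod (f z)"
  shows "(\<Sum>p\<in>{p\<in>ball z0 r. g p = 0}. zorder g p) = (\<Sum>p\<in>{p\<in>ball z0 r. f p = 0}. zorder f p)"
proof -
  define s where "s = ball z0 R"
  have s: "s \<subseteq> A" using assms(7) ball_subset_cball unfolding s_def by blast
  have fin: "finite {p\<in>s. h p = 0}" if "h holomorphic_on A" "\<not> h constant_on A" for h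
    using holomorphic_compact_finite_zeros[OF that(1) assms(3,4) compact_cball assms(7) that(2)]
    by (rule rev_finite_subset) (auto simp: s_def)
  have sub: "(\<Sum>p\<in>{p\<in>s. h p = 0}. winding_number (circlepath z0 r) p * zorder h p) =
      of_int (\<Sum>p\<in>{p\<in>ball z0 r. h p = 0}. zorder h p)"
    if h: "h holomorphic_on A" "\<not> h constant_on A" "\<And>z. z \<in> sphere z0 r \<Longrightarrow> h z \<noteq> 0" for h
  proof -
    have "(\<Sum>p\<in>{p\<in>s. h p = 0}. winding_number (circlepath z0 r) p * zorder h p) =
        (\<Sum>p\<in>{p\<in>ball z0 r. h p = 0}. winding_number (circlepath z0 r) p * zorder h p)"
    proof (rule sum.mono_neutral_right[OF fin[OF h(1,2)]])
      show "{p \<in> ball z0 r. h p = 0} \<subseteq> {p \<in> s. h p = 0}" using assms(6) by (auto simp: s_def)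
      show "\<forall>p\<in>{p \<in> s. h p = 0} - {p \<in> ball z0 r. h p = 0}.
          winding_number (circlepath z0 r) p * of_int (zorder h p) = 0"
      proof
        fix p assume p: "p \<in> {p \<in> s. h p = 0} - {p \<in> ball z0 r. h p = 0}"
        then have "p \<notin> ball z0 r" "p \<notin> sphere z0 r" using h(3) by auto
        then have "p \<notin> cball z0 r" by (auto simp: sphere_def)
        then have "winding_number (circlepath z0 r) p = 0"
          using assms(5) by (intro winding_number_zero_outside[of _ "cball z0 r"]) auto
        then show "winding_number (circlepath z0 r) p * of_int (zorder h p) = 0" by simp
      qed
    qed
    also have "\<dots> = (\<Sum>p\<in>{p\<in>ball z0 r. h p = 0}. of_int (zorder h p))"
      by (rule sum.cong) (auto simp: winding_number_circlepath dist_norm norm_minus_commute)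
    finally show ?thesis by simp
  qed
  have f_nz: "f z \<noteq> 0" and g_nz: "g z \<noteq> 0" if "z \<in> sphere z0 r" for z
    using less[OF that] by auto
  have "(\<Sum>p\<in>{p\<in>s. f p + (g p - f p) = 0}.
        winding_number (circlepath z0 r) p * zorder (\<lambda>p. f p + (g p - f p)) p) =
      (\<Sum>p\<in>{p\<in>s. f p = 0}. winding_number (circlepath z0 r) p * zorder f p)"
  proof (rule Rouche_theorem)
    show "open s" "connected s" by (simp_all add: s_def)
    show "finite {p \<in> s. f p + (g p - f p) = 0}" using fin[OF assms(2,9)] by simp
    show "finite {p \<in> s. f p = 0}" by (rule fin[OF assms(1,8)])
    show "f holomorphic_on s" using assms(1) s by (rule holomorphic_on_subset)
    show "(\<lambda>p. g p - f p) holomorphic_on s"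
      using assms(1,2) s by (intro holomorphic_intros) (auto intro: holomorphic_on_subset)
    show "valid_path (circlepath z0 r)" "pathfinish (circlepath z0 r) = pathstart (circlepath z0 r)"
      by simp_all
    show "path_image (circlepath z0 r) \<subseteq> s" using assms(5,6) by (auto simp: s_def)
    show "\<forall>z\<in>path_image (circlepath z0 r). cmod (g z - f z) < cmod (f z)"
      using less assms(5) by simp
    show "\<forall>z. z \<notin> s \<longrightarrow> winding_number (circlepath z0 r) z = 0"
      using assms(5,6) by (auto simp: s_def intro!: winding_number_zero_outside[of _ "cball z0 r"])
  qed
  then have "(of_int (\<Sum>p\<in>{p\<in>ball z0 r. g p = 0}. zorder g p) :: complex) =
      of_int (\<Sum>p\<in>{p\<in>ball z0 r. f p = 0}. zorder f p)"
    using sub[OF assms(1,8) f_nz] sub[OF assms(2,9) g_nz] by simp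
  then show ?thesis by (simp only: of_int_eq_iff)
qed

section \<open>Dependence of the symmetrization on the subtracted value\<close>

lemma quat_component_le_norm:
  "\<bar>qRe q\<bar> \<le> norm q" "\<bar>qIm1 q\<bar> \<le> norm q" "\<bar>qIm2 q\<bar> \<le> norm q" "\<bar>qIm3 q\<bar> \<le> norm q"
  using Basis_le_norm[of 1 q] Basis_le_norm[of quat_i q] Basis_le_norm[of quat_j q] Basis_le_norm[of quat_k q]
  by (simp_all add: Basis_quat_def inner_quat_def)

text \<open>Each of the four components is a difference of squares from which a component of
  \<open>c' - c\<close> splits off. The bound is uniform in \<open>w\<close> and tends to 0 as
  \<open>c'\<close> tends to \<open>c\<close>.\<close>

lemma cq_norm_diff_bound:
  assumes "cmod (cq0 w) \<le> K" "cmod (cq1 w) \<le> K" "cmod (cq2 w) \<le> K" "cmod (cq3 w) \<le> K"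
  shows "cmod (cq_norm (w - cq_of_quat c) - cq_norm (w - cq_of_quat c')) \<le>
    norm (c' - c) * (8 * K + 4 * norm c + 4 * norm c')"
proof -
  have *: "cmod ((v - of_real a)\<^sup>2 - (v - of_real a')\<^sup>2) \<le> norm (c' - c) * (2 * K + norm c + norm c')"
    if "cmod v \<le> K" "\<bar>a\<bar> \<le> norm c" "\<bar>a'\<bar> \<le> norm c'" "\<bar>a' - a\<bar> \<le> norm (c' - c)" for v a a'
  proof -
    have "(v - of_real a)\<^sup>2 - (v - of_real a')\<^sup>2 = of_real (a' - a) * (2 * v - of_real a - of_real a')"
      by (simp add: power2_eq_square algebra_simps)
    then have "cmod ((v - of_real a)\<^sup>2 - (v - of_real a')\<^sup>2) = \<bar>a' - a\<bar> * cmod (2 * v - of_real a - of_real a')"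
      by (simp only: norm_mult norm_of_real)
    also have "\<dots> \<le> norm (c' - c) * cmod (2 * v - of_real a - of_real a')"
      using that(4) by (rule mult_right_mono) simp
    finally have 1: "cmod ((v - of_real a)\<^sup>2 - (v - of_real a')\<^sup>2) \<le>
      norm (c' - c) * cmod (2 * v - of_real a - of_real a')" .
    have "cmod (2 * v - of_real a - of_real a') \<le> cmod (2 * v) + cmod (of_real a) + cmod (of_real a')"
      using norm_triangle_ineq4[of "2 * v - of_real a" "of_real a'"] norm_triangle_ineq4[of "2 * v" "of_real a"]
      by linarith
    also have "\<dots> \<le> 2 * K + norm c + norm c'" using that by (simp add: norm_mult)
    finally have "norm (c' - c) * cmod (2 * v - of_real a - of_real a') \<le>
        norm (c' - c) * (2 * K + norm c + norm c')"
      by (rule mult_left_mono) simp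
    with 1 show ?thesis by simp
  qed
  have comp: "\<bar>qRe c' - qRe c\<bar> \<le> norm (c' - c)" "\<bar>qIm1 c' - qIm1 c\<bar> \<le> norm (c' - c)"
    "\<bar>qIm2 c' - qIm2 c\<bar> \<le> norm (c' - c)" "\<bar>qIm3 c' - qIm3 c\<bar> \<le> norm (c' - c)"
    using quat_component_le_norm[of "c' - c"] by simp_all
  define d0 d1 d2 d3 where
    "d0 = (cq0 w - of_real (qRe c))\<^sup>2 - (cq0 w - of_real (qRe c'))\<^sup>2" and
    "d1 = (cq1 w - of_real (qIm1 c))\<^sup>2 - (cq1 w - of_real (qIm1 c'))\<^sup>2" and
    "d2 = (cq2 w - of_real (qIm2 c))\<^sup>2 - (cq2 w - of_real (qIm2 c'))\<^sup>2" and
    "d3 = (cq3 w - of_real (qIm3 c))\<^sup>2 - (cq3 w - of_real (qIm3 c'))\<^sup>2"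
  have "cq_norm (w - cq_of_quat c) - cq_norm (w - cq_of_quat c') = d0 + d1 + d2 + d3"
    by (simp add: cq_norm_def d0_def d1_def d2_def d3_def)
  also have "cmod \<dots> \<le> cmod d0 + cmod d1 + cmod d2 + cmod d3"
    using norm_triangle_ineq[of "d0 + d1 + d2" d3] norm_triangle_ineq[of "d0 + d1" d2] norm_triangle_ineq[of d0 d1]
    by linarith
  also have "\<dots> \<le> 4 * (norm (c' - c) * (2 * K + norm c + norm c'))"
    using *[OF assms(1) quat_component_le_norm(1) quat_component_le_norm(1) comp(1)]
      *[OF assms(2) quat_component_le_norm(2) quat_component_le_norm(2) comp(2)]
      *[OF assms(3) quat_component_le_norm(3) quat_component_le_norm(3) comp(3)]
      *[OF assms(4) quat_component_le_norm(4) quat_component_le_norm(4) comp(4)]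
    by (simp add: d0_def d1_def d2_def d3_def)
  also have "\<dots> = norm (c' - c) * (8 * K + 4 * norm c + 4 * norm c')" by (simp add: algebra_simps)
  finally show ?thesis .
qed

lemma slice_sphere_of_mem:
  assumes "q \<in> slice_sphere x y"
  shows "slice_sphere x y = slice_sphere (Re (qpolar q)) (Im (qpolar q))"
  using assms by (simp add: mem_slice_sphere_iff slice_sphere_eq_iff)

lemma mem_slice_sphere_qpolar: "q \<in> slice_sphere (Re (qpolar q)) (Im (qpolar q))"
  using Im_qpolar_nonneg[of q] by (simp add: mem_slice_sphere_iff)

context symmetric_slice
begin

lemma symm_not_constant:
  assumes "slice_regular \<Omega> f" "\<not> f constant_on \<Omega>" "q \<in> \<Omega>"
  shows "\<not> symm (\<lambda>p. f p - f q) constant_on D"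
proof
  assume "symm (\<lambda>p. f p - f q) constant_on D"
  then obtain c where c: "\<And>z. z \<in> D \<Longrightarrow> symm (\<lambda>p. f p - f q) z = c"
    by (auto simp: constant_on_def)
  have "qpolar q \<in> D" using assms(3) mem_iff_qpolar by simp
  then have "c = 0" using c symm_zero_at_value[OF assms(1,3)] by metis
  then show False using symm_diff_const_nonzero[OF assms(1,2)] c by metis
qed

text \<open>Inside the domain a preimage under \<open>qpolar\<close> consists of whole spheres, and
  each sphere has exactly one representative in the closed upper half plane.\<close>

lemma zero_spheres_eq:
  assumes "slice_regular \<Omega> f" "E \<subseteq> D"
  shows "zero_spheres \<Omega> f (qpolar -` E) =
    (\<lambda>w. slice_sphere (Re w) (Im w)) ` {w\<in>E. symm f w = 0 \<and> Im w \<ge> 0}"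
proof
  have zero: "(\<exists>p\<in>slice_sphere (Re w) (Im w). f p = 0) \<longleftrightarrow> symm f w = 0" if "w \<in> D" for w
    using zero_on_sphere_iff[OF induces_stem_of[OF assms(1)], of "Re w" "Im w"] that
    by (simp add: symm_def)
  show "zero_spheres \<Omega> f (qpolar -` E) \<subseteq>
    (\<lambda>w. slice_sphere (Re w) (Im w)) ` {w\<in>E. symm f w = 0 \<and> Im w \<ge> 0}"
  proof
    fix C assume "C \<in> zero_spheres \<Omega> f (qpolar -` E)"
    then obtain x y q where C: "C = slice_sphere x y" "q \<in> C" "qpolar q \<in> E" "f q = 0"
      by (auto simp: zero_spheres_def)
    then have C_eq: "C = slice_sphere (Re (qpolar q)) (Im (qpolar q))"
      using slice_sphere_of_mem by blast
    moreover have "symm f (qpolar q) = 0"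
      using zero[of "qpolar q"] C assms(2) C_eq by blast
    ultimately show "C \<in> (\<lambda>w. slice_sphere (Re w) (Im w)) ` {w\<in>E. symm f w = 0 \<and> Im w \<ge> 0}"
      using C(3) Im_qpolar_nonneg by blast
  qed
  show "(\<lambda>w. slice_sphere (Re w) (Im w)) ` {w\<in>E. symm f w = 0 \<and> Im w \<ge> 0} \<subseteq>
    zero_spheres \<Omega> f (qpolar -` E)"
  proof
    fix C assume "C \<in> (\<lambda>w. slice_sphere (Re w) (Im w)) ` {w\<in>E. symm f w = 0 \<and> Im w \<ge> 0}"
    then obtain w where w: "C = slice_sphere (Re w) (Im w)" "w \<in> E" "symm f w = 0" "Im w \<ge> 0" by blast
    then obtain p where p: "p \<in> C" "f p = 0" using zero[of w] assms(2) by blast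
    then have "qpolar p = w" using w by (simp add: mem_slice_sphere_iff complex_eq_iff)
    then show "C \<in> zero_spheres \<Omega> f (qpolar -` E)"
      using p w assms(2) mem_iff_qpolar[of p] by (auto simp: zero_spheres_def)
  qed
qed

lemma sphere_inj_on: "inj_on (\<lambda>w. slice_sphere (Re w) (Im w)) {w. Im w \<ge> 0}"
  by (rule inj_onI) (simp add: slice_sphere_eq_iff complex_eq_iff)

text \<open>A non-real zero sphere corresponds to two conjugate zeros of the symmetrization, a real zero to
  one zero of twice the multiplicity.\<close>

lemma sum_multiplicities_eq_zorder:
  assumes "slice_regular \<Omega> f" "\<beta> \<in> D" "symm f \<beta> \<noteq> 0" "z0 \<in> D" "ball z0 r \<subseteq> D" "0 < r"
    and "Im z0 = 0 \<or> r \<le> Im z0" "finite {p\<in>ball z0 r. symm f p = 0}"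
  shows "finite (zero_spheres \<Omega> f (qpolar -` ball z0 r))"
    and "(\<Sum>p\<in>{p\<in>ball z0 r. symm f p = 0}. zorder (symm f) p) =
      int (\<Sum>C\<in>zero_spheres \<Omega> f (qpolar -` ball z0 r). total_multiplicity \<Omega> f C) *
        (if Im z0 = 0 then 2 else 1)"
proof -
  define Z where "Z = {p\<in>ball z0 r. symm f p = 0}"
  define mult where "mult = (\<lambda>w. total_multiplicity \<Omega> f (slice_sphere (Re w) (Im w)))"
  have fin: "finite Z" using assms(8) by (simp add: Z_def)
  have eq: "zero_spheres \<Omega> f (qpolar -` ball z0 r) = (\<lambda>w. slice_sphere (Re w) (Im w)) ` {w\<in>Z. Im w \<ge> 0}"
    using zero_spheres_eq[OF assms(1,5)] by (simp add: Z_def conj_assoc)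
  show "finite (zero_spheres \<Omega> f (qpolar -` ball z0 r))" using fin by (simp add: eq)
  have zo: "zorder (symm f) w = int (mult w) * (if Im w = 0 then 2 else 1)" if "w \<in> Z" for w
    using total_multiplicity_symm(1)[OF assms(1) _ assms(2,3), of "Re w" "Im w"] that assms(5)
    by (auto simp: Z_def mult_def)
  have sum: "(\<Sum>C\<in>zero_spheres \<Omega> f (qpolar -` ball z0 r). total_multiplicity \<Omega> f C) =
      (\<Sum>w\<in>{w\<in>Z. Im w \<ge> 0}. mult w)"
    unfolding eq mult_def
    by (subst sum.reindex) (auto intro: inj_on_subset[OF sphere_inj_on])
  have Im_near: "\<bar>Im w - Im z0\<bar> < r" if "w \<in> Z" for w
    using that abs_Im_le_cmod[of "w - z0"] by (auto simp: Z_def dist_norm norm_minus_commute)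
  show "(\<Sum>p\<in>{p\<in>ball z0 r. symm f p = 0}. zorder (symm f) p) =
      int (\<Sum>C\<in>zero_spheres \<Omega> f (qpolar -` ball z0 r). total_multiplicity \<Omega> f C) *
        (if Im z0 = 0 then 2 else 1)"
    unfolding Z_def[symmetric] sum
  proof (cases "Im z0 = 0")
    case False
    \<comment> \<open>By \<open>r \<le> Im z0\<close> the disc lies above the real axis, so each
      sphere is represented by a single zero.\<close>
    then have pos: "Im w > 0" if "w \<in> Z" for w using Im_near[OF that] assms(7) by auto
    then have "{w\<in>Z. Im w \<ge> 0} = Z" by force
    moreover have "(\<Sum>w\<in>Z. zorder (symm f) w) = (\<Sum>w\<in>Z. int (mult w))"
    proof (intro sum.cong refl)
      fix w assume "w \<in> Z"
      then show "zorder (symm f) w = int (mult w)" using zo[of w] pos[of w] by simp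
    qed
    ultimately show "(\<Sum>w\<in>Z. zorder (symm f) w) =
        int (\<Sum>w\<in>{w\<in>Z. Im w \<ge> 0}. mult w) * (if Im z0 = 0 then 2 else 1)"
      using False by simp
  next
    case True
    \<comment> \<open>A disc centred on the real axis is symmetric: lower zeros mirror the upper
      ones with equal multiplicity, and at real zeros the order is twice the multiplicity. Either
      way each sphere is counted twice.\<close>
    define P N R where "P = {w\<in>Z. Im w > 0}" and "N = {w\<in>Z. Im w < 0}" and "R = {w\<in>Z. Im w = 0}"
    have "cnj z0 = z0" using True by (simp add: complex_eq_iff)
    then have cnj_ball: "cnj w \<in> ball z0 r \<longleftrightarrow> w \<in> ball z0 r" for w
      by (metis complex_cnj_diff complex_mod_cnj dist_norm mem_ball)
    have cnj_symm: "symm f (cnj w) = cnj (symm f w)" if "w \<in> D" for w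
      using stem_cnj[OF stem_stem_of[OF assms(1)] that] by (simp add: symm_def cq_norm_cnj)
    have cnj_Z: "cnj w \<in> Z" if "w \<in> Z" for w
      using that cnj_ball cnj_symm[of w] assms(5) by (auto simp: Z_def)
    have mult_cnj: "mult (cnj w) = mult w" for w
      by (simp add: mult_def slice_sphere_uminus)
    have N: "N = cnj ` P"
    proof
      show "cnj ` P \<subseteq> N" using cnj_Z by (auto simp: P_def N_def)
      show "N \<subseteq> cnj ` P"
      proof
        fix w assume "w \<in> N"
        then have "cnj w \<in> P" using cnj_Z by (auto simp: P_def N_def)
        then show "w \<in> cnj ` P" by (metis complex_cnj_cnj imageI)
      qed
    qed
    have sumN: "(\<Sum>w\<in>N. int (mult w)) = (\<Sum>w\<in>P. int (mult w))"
      unfolding N by (subst sum.reindex) (auto simp: mult_cnj inj_on_def)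
    have "finite P" "finite N" "finite R" using fin by (simp_all add: P_def N_def R_def)
    have "Z = (P \<union> N) \<union> R" by (auto simp: P_def N_def R_def)
    moreover have "(P \<union> N) \<inter> R = {}" "P \<inter> N = {}" by (auto simp: P_def N_def R_def)
    ultimately have "(\<Sum>w\<in>Z. zorder (symm f) w) =
        (\<Sum>w\<in>P. zorder (symm f) w) + (\<Sum>w\<in>N. zorder (symm f) w) + (\<Sum>w\<in>R. zorder (symm f) w)"
      using \<open>finite P\<close> \<open>finite N\<close> \<open>finite R\<close> by (simp only: sum.union_disjoint finite_UnI)
    also have "(\<Sum>w\<in>P. zorder (symm f) w) = (\<Sum>w\<in>P. int (mult w))"
      by (intro sum.cong) (auto simp: zo P_def)
    also have "(\<Sum>w\<in>N. zorder (symm f) w) = (\<Sum>w\<in>N. int (mult w))"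
      by (intro sum.cong) (auto simp: zo N_def)
    also have "(\<Sum>w\<in>R. zorder (symm f) w) = 2 * (\<Sum>w\<in>R. int (mult w))"
      unfolding sum_distrib_left by (intro sum.cong) (auto simp: zo R_def)
    also have "(\<Sum>w\<in>P. int (mult w)) + (\<Sum>w\<in>N. int (mult w)) + 2 * (\<Sum>w\<in>R. int (mult w)) =
        2 * ((\<Sum>w\<in>P. int (mult w)) + (\<Sum>w\<in>R. int (mult w)))"
      by (simp add: sumN)
    also have "(\<Sum>w\<in>P. int (mult w)) + (\<Sum>w\<in>R. int (mult w)) = (\<Sum>w\<in>P \<union> R. int (mult w))"
      using \<open>finite P\<close> \<open>finite R\<close> by (intro sum.union_disjoint[symmetric]) (auto simp: P_def R_def)
    also have "P \<union> R = {w\<in>Z. Im w \<ge> 0}" by (auto simp: P_def R_def)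
    finally show "(\<Sum>w\<in>Z. zorder (symm f) w) =
        int (\<Sum>w\<in>{w\<in>Z. Im w \<ge> 0}. mult w) * (if Im z0 = 0 then 2 else 1)"
      using True by simp
  qed
qed

text \<open>Only the constant \<open>f q\<close> moves with \<open>q\<close>. The stem components
  are bounded on the compact set, so continuity of \<open>f\<close> at \<open>q0\<close> gives
  closeness uniformly in \<open>z\<close>.\<close>

lemma eventually_symm_close:
  assumes "slice_regular \<Omega> f" "q0 \<in> \<Omega>" "compact K" "K \<subseteq> D" "\<mu> > 0"
  shows "\<forall>\<^sub>F q in nhds q0. \<forall>z\<in>K. cmod (symm (\<lambda>p. f p - f q) z - symm (\<lambda>p. f p - f q0) z) < \<mu>"
proof -
  define F where "F = stem_of f"
  have hol: "cq_holomorphic_on F D" using stem_stem_of[OF assms(1)] by (simp add: F_def stem_def)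
  have bd: "\<exists>B. \<forall>z\<in>K. cmod (g z) \<le> B" if "g holomorphic_on D" for g
  proof -
    have "continuous_on K g"
      using that assms(4) holomorphic_on_imp_continuous_on continuous_on_subset by blast
    then have "bounded (g ` K)" using assms(3) compact_continuous_image compact_imp_bounded by blast
    then show ?thesis by (auto simp: bounded_iff)
  qed
  obtain B0 where B0: "\<forall>z\<in>K. cmod (cq0 (F z)) \<le> B0"
    using bd[of "\<lambda>z. cq0 (F z)"] hol by (auto simp: cq_holomorphic_on_def)
  obtain B1 where B1: "\<forall>z\<in>K. cmod (cq1 (F z)) \<le> B1"
    using bd[of "\<lambda>z. cq1 (F z)"] hol by (auto simp: cq_holomorphic_on_def)
  obtain B2 where B2: "\<forall>z\<in>K. cmod (cq2 (F z)) \<le> B2"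
    using bd[of "\<lambda>z. cq2 (F z)"] hol by (auto simp: cq_holomorphic_on_def)
  obtain B3 where B3: "\<forall>z\<in>K. cmod (cq3 (F z)) \<le> B3"
    using bd[of "\<lambda>z. cq3 (F z)"] hol by (auto simp: cq_holomorphic_on_def)
  define B where "B = max (max B0 B1) (max B2 B3)"
  have B: "cmod (symm (\<lambda>p. f p - f q) z - symm (\<lambda>p. f p - f q0) z) \<le>
      norm (f q0 - f q) * (8 * B + 4 * norm (f q) + 4 * norm (f q0))" if "z \<in> K" for q z
  proof -
    have "z \<in> D" using that assms(4) by blast
    show ?thesis
      unfolding symm_diff_const[OF assms(1) \<open>z \<in> D\<close>] F_def[symmetric]
      using B0 B1 B2 B3 that by (intro cq_norm_diff_bound) (auto simp: B_def le_max_iff_disj)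
  qed
  have "(f \<longlongrightarrow> f q0) (nhds q0)"
    using slice_regular_continuous[OF assms(1,2)] by (simp add: continuous_at tendsto_at_iff_tendsto_nhds)
  then have "((\<lambda>q. norm (f q0 - f q) * (8 * B + 4 * norm (f q) + 4 * norm (f q0))) \<longlongrightarrow>
      norm (f q0 - f q0) * (8 * B + 4 * norm (f q0) + 4 * norm (f q0))) (nhds q0)"
    by (intro tendsto_intros)
  then have "\<forall>\<^sub>F q in nhds q0. norm (f q0 - f q) * (8 * B + 4 * norm (f q) + 4 * norm (f q0)) < \<mu>"
    using assms(5) by (intro order_tendstoD(2)) auto
  then show ?thesis
    by eventually_elim (use B in \<open>auto intro: le_less_trans\<close>)
qed

theorem multiplicity_conservation:
  assumes "slice_regular \<Omega> f" "\<not> f constant_on \<Omega>" "q0 \<in> \<Omega>"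
  defines "C0 \<equiv> slice_sphere (Re (qpolar q0)) (Im (qpolar q0))"
  shows "\<exists>U T. open U \<and> q0 \<in> U \<and> U \<subseteq> \<Omega> \<and> U \<subseteq> T \<and> open T \<and> C0 \<subseteq> T \<and> T \<subseteq> \<Omega> \<and>
    (\<forall>q1\<in>U. finite (zero_spheres \<Omega> (\<lambda>q. f q - f q1) T) \<and>
      (\<Sum>C\<in>zero_spheres \<Omega> (\<lambda>q. f q - f q1) T. total_multiplicity \<Omega> (\<lambda>q. f q - f q1) C) =
      total_multiplicity \<Omega> (\<lambda>q. f q - f q0) C0)"
proof -
  define z0 where "z0 = qpolar q0"
  define s where "s = (\<lambda>q. symm (\<lambda>p. f p - f q))"
  have z0: "z0 \<in> D" using assms(3) mem_iff_qpolar by (simp add: z0_def)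
  have Im_z0: "Im z0 \<ge> 0" by (simp add: z0_def Im_qpolar_nonneg)
  have s_hol: "s q holomorphic_on D" for q
    unfolding s_def by (intro symm_holomorphic slice_regular_diff_const assms)
  have s_nc: "\<not> s q constant_on D" if "q \<in> \<Omega>" for q
    unfolding s_def by (rule symm_not_constant[OF assms(1,2) that])
  obtain \<beta> where \<beta>: "\<beta> \<in> D" "s q0 \<beta> \<noteq> 0"
    using symm_diff_const_nonzero[OF assms(1,2)] unfolding s_def by blast
  have s_z0: "s q0 z0 = 0" unfolding s_def z0_def by (rule symm_zero_at_value[OF assms(1,3)])
  obtain e1 where e1: "e1 > 0" "cball z0 e1 \<subseteq> D" using open_D z0 open_contains_cball by blast
  obtain e2 where e2: "e2 > 0" "ball z0 e2 \<subseteq> D" "\<And>w. w \<in> ball z0 e2 - {z0} \<Longrightarrow> s q0 w \<noteq> 0"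
    using isolated_zeros[OF s_hol open_D connected_D z0 s_z0 \<beta>] by metis
  define e3 where "e3 = (if Im z0 = 0 then 1 else Im z0)"
  have e3: "e3 > 0" using Im_z0 by (auto simp: e3_def)
  \<comment> \<open>\<open>e1\<close> leaves room for a closed disc in \<open>D\<close>,
    \<open>e2\<close> isolates the zero \<open>z0\<close>, and \<open>e3\<close> keeps the disc
    above the real axis if \<open>z0\<close> is not real.\<close>
  define r where "r = min e1 (min e2 e3) / 2"
  have r: "r > 0" "r < e1" "r < e2" "r \<le> e3" using e1(1) e2(1) e3 by (auto simp: r_def)
  have ball_D: "ball z0 r \<subseteq> D" and sphere_D: "sphere z0 r \<subseteq> D" using r e1(2) by (auto simp: subset_iff)
  have Im_r: "Im z0 = 0 \<or> r \<le> Im z0" using r(4) by (cases "Im z0 = 0") (simp_all add: e3_def)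
  have "\<exists>\<mu>>0. \<forall>z\<in>sphere z0 r. \<mu> \<le> cmod (s q0 z)"
  proof -
    have cont: "continuous_on (sphere z0 r) (\<lambda>z. cmod (s q0 z))"
      using continuous_on_subset[OF holomorphic_on_imp_continuous_on[OF s_hol] sphere_D]
      by (intro continuous_intros)
    obtain x where x: "x \<in> sphere z0 r" "\<forall>z\<in>sphere z0 r. cmod (s q0 x) \<le> cmod (s q0 z)"
      using continuous_attains_inf[OF compact_sphere _ cont] r(1) by auto
    have "s q0 x \<noteq> 0" using x(1) r by (intro e2(3)) auto
    with x(2) show ?thesis by (intro exI[of _ "cmod (s q0 x)"]) auto
  qed
  then obtain \<mu> where \<mu>: "\<mu> > 0" "\<And>z. z \<in> sphere z0 r \<Longrightarrow> \<mu> \<le> cmod (s q0 z)" by blast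
  have "\<forall>\<^sub>F q in nhds q0. \<forall>z\<in>sphere z0 r. cmod (s q z - s q0 z) < \<mu>"
    unfolding s_def by (rule eventually_symm_close[OF assms(1,3) compact_sphere sphere_D \<mu>(1)])
  then obtain V where V: "open V" "q0 \<in> V"
      "\<And>q z. \<lbrakk>q \<in> V; z \<in> sphere z0 r\<rbrakk> \<Longrightarrow> cmod (s q z - s q0 z) < \<mu>"
    unfolding eventually_nhds by blast
  define T where "T = qpolar -` ball z0 r"
  \<comment> \<open>Intersecting with \<open>T\<close> puts \<open>q1\<close> itself in
    \<open>T\<close>, where it will be one of the two preimages.\<close>
  define U where "U = V \<inter> \<Omega> \<inter> T"
  have openT: "open T"
    unfolding T_def using continuous_on_open_vimage[of UNIV qpolar] continuous_qpolar by auto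
  have T\<Omega>: "T \<subseteq> \<Omega>" using ball_D mem_iff_qpolar by (auto simp: T_def)
  have C0T: "C0 \<subseteq> T"
    using r(1) Im_z0 by (auto simp: C0_def T_def mem_slice_sphere_iff simp flip: z0_def)
  have q0T: "q0 \<in> T" using r(1) by (simp add: T_def z0_def)
  have fin: "finite {p\<in>ball z0 r. s q p = 0}" if "q \<in> \<Omega>" for q
    using holomorphic_compact_finite_zeros[OF s_hol open_D connected_D compact_cball e1(2) s_nc[OF that]]
    by (rule rev_finite_subset) (use r in auto)
  have count: "finite (zero_spheres \<Omega> (\<lambda>q. f q - f q1) T) \<and>
      (\<Sum>C\<in>zero_spheres \<Omega> (\<lambda>q. f q - f q1) T. total_multiplicity \<Omega> (\<lambda>q. f q - f q1) C) =
      total_multiplicity \<Omega> (\<lambda>q. f q - f q0) C0" if q1: "q1 \<in> U" for q1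
  proof -
    have q1': "q1 \<in> V" "q1 \<in> \<Omega>" using q1 by (auto simp: U_def)
    obtain \<beta>1 where \<beta>1: "\<beta>1 \<in> D" "s q1 \<beta>1 \<noteq> 0"
      using symm_diff_const_nonzero[OF assms(1,2)] unfolding s_def by blast
    note sm = sum_multiplicities_eq_zorder[OF slice_regular_diff_const[OF assms(1), of "f q1"]
        \<beta>1(1) \<beta>1(2)[unfolded s_def] z0 ball_D r(1) Im_r fin[OF q1'(2), unfolded s_def], folded T_def]
    have sm': "finite (zero_spheres \<Omega> (\<lambda>q. f q - f q1) T)"
      "(\<Sum>p\<in>{p\<in>ball z0 r. s q1 p = 0}. zorder (s q1) p) =
       int (\<Sum>C\<in>zero_spheres \<Omega> (\<lambda>q. f q - f q1) T. total_multiplicity \<Omega> (\<lambda>q. f q - f q1) C) *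
        (if Im z0 = 0 then 2 else 1)"
      using sm unfolding s_def by simp_all
    have "(\<Sum>p\<in>{p\<in>ball z0 r. s q1 p = 0}. zorder (s q1) p) =
        (\<Sum>p\<in>{p\<in>ball z0 r. s q0 p = 0}. zorder (s q0) p)"
    proof (rule Rouche_disc[OF s_hol s_hol open_D connected_D r(1,2) e1(2) s_nc[OF assms(3)] s_nc[OF q1'(2)]])
      fix z assume z: "z \<in> sphere z0 r"
      show "cmod (s q1 z - s q0 z) < cmod (s q0 z)"
        using V(3)[OF q1'(1) z] \<mu>(2)[OF z] by simp
    qed
    also have "{p\<in>ball z0 r. s q0 p = 0} = {z0}"
    proof -
      have "p = z0" if "p \<in> ball z0 r" "s q0 p = 0" for p
        using e2(3)[of p] that r(3) by auto
      then show ?thesis using s_z0 r(1) by auto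
    qed
    also have "(\<Sum>p\<in>{z0}. zorder (s q0) p) =
        int (total_multiplicity \<Omega> (\<lambda>q. f q - f q0) C0) * (if Im z0 = 0 then 2 else 1)"
      using total_multiplicity_symm(1)[OF slice_regular_diff_const[OF assms(1)] _ \<beta>(1), of "Re z0" "Im z0" "f q0"]
        \<beta>(2) z0 by (simp add: s_def C0_def z0_def)
    finally have "int (\<Sum>C\<in>zero_spheres \<Omega> (\<lambda>q. f q - f q1) T. total_multiplicity \<Omega> (\<lambda>q. f q - f q1) C) *
        (if Im z0 = 0 then 2 else 1) =
        int (total_multiplicity \<Omega> (\<lambda>q. f q - f q0) C0) * (if Im z0 = 0 then 2 else 1)"
      by (simp only: sm'(2))
    \<comment> \<open>The factor 1 or 2 depends on the centre of the disc only and cancels.\<close>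
    then have "int (\<Sum>C\<in>zero_spheres \<Omega> (\<lambda>q. f q - f q1) T. total_multiplicity \<Omega> (\<lambda>q. f q - f q1) C) =
        int (total_multiplicity \<Omega> (\<lambda>q. f q - f q0) C0)"
      by (cases "Im z0 = 0") simp_all
    with sm'(1) show ?thesis by (simp only: of_nat_eq_iff simp_thms)
  qed
  show ?thesis
    using count V(1,2) openT open_domain q0T C0T T\<Omega> assms(3)
    by (intro exI[of _ U] exI[of _ T]) (auto simp: U_def)
qed

lemma two_preimages:
  assumes "slice_regular \<Omega> f" "\<not> f constant_on \<Omega>" "q \<in> \<Omega> - singular_set \<Omega> f" "q \<in> T"
    and "T \<subseteq> \<Omega>"
    and "1 < (\<Sum>C\<in>zero_spheres \<Omega> (\<lambda>p. f p - f q) T. total_multiplicity \<Omega> (\<lambda>p. f p - f q) C)"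
  shows "\<exists>a\<in>T. \<exists>b\<in>T. a \<noteq> b \<and> f a = f q \<and> f b = f q"
proof -
  define Z mult where "Z = zero_spheres \<Omega> (\<lambda>p. f p - f q) T"
    and "mult = total_multiplicity \<Omega> (\<lambda>p. f p - f q)"
  define C where "C = slice_sphere (Re (qpolar q)) (Im (qpolar q))"
  have qC: "q \<in> C" unfolding C_def by (rule mem_slice_sphere_qpolar)
  have "mult C \<le> 1"
    using singular_iff_multiplicity[OF assms(1,2)] assms(3) unfolding mult_def C_def by force
  have "\<exists>C'\<in>Z. C' \<noteq> C"
  proof (rule ccontr)
    assume "\<not> (\<exists>C'\<in>Z. C' \<noteq> C)"
    \<comment> \<open>If no other sphere carried a zero, the whole sum would be at most the
      multiplicity at the sphere of \<open>q\<close>, which is at most 1.\<close>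
    then have "Z \<subseteq> {C}" by blast
    then have "sum mult Z \<le> sum mult {C}" by (intro sum_mono2) auto
    then show False using assms(6) \<open>mult C \<le> 1\<close> by (simp add: Z_def mult_def)
  qed
  then obtain C' where C': "C' \<in> Z" "C' \<noteq> C" by blast
  then obtain x y b where b: "C' = slice_sphere x y" "b \<in> C'" "b \<in> T" "f b = f q"
    by (auto simp: Z_def zero_spheres_def)
  have "b \<noteq> q"
  proof
    assume "b = q"
    then show False using slice_sphere_of_mem b C'(2) by (simp add: C_def)
  qed
  then show ?thesis using b assms(4) by blast
qed

end

theorem theorem3p9:
  fixes \<Omega> :: "quat set" and f :: "quat \<Rightarrow> quat"
  assumes "symmetric_slice_domain \<Omega>"
    and "slice_regular \<Omega> f"
    and "\<not> f constant_on \<Omega>"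
  shows "interior (singular_set \<Omega> f) = {} \<and>
    (\<forall>x0 y0 I q0 n. I \<in> imag_units \<longrightarrow> q0 = of_real x0 + of_real y0 * I \<longrightarrow>
      q0 \<in> singular_set \<Omega> f \<longrightarrow>
      n = total_multiplicity \<Omega> (\<lambda>q. f q - f q0) (slice_sphere x0 y0) \<longrightarrow>
      n > 1 \<and>
      (\<exists>U T. open U \<and> q0 \<in> U \<and> U \<subseteq> \<Omega> \<and> open T \<and> slice_sphere x0 y0 \<subseteq> T \<and> T \<subseteq> \<Omega> \<and>
        (\<forall>q1\<in>U. finite (zero_spheres \<Omega> (\<lambda>q. f q - f q1) T) \<and>
          (\<Sum>C\<in>zero_spheres \<Omega> (\<lambda>q. f q - f q1) T.
             total_multiplicity \<Omega> (\<lambda>q. f q - f q1) C) = n) \<and>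
        (\<forall>q1\<in>U - singular_set \<Omega> f. \<exists>a\<in>T. \<exists>b\<in>T. a \<noteq> b \<and> f a = f q1 \<and> f b = f q1)))"
proof -
  interpret symmetric_slice \<Omega> by (rule symmetric_slice.intro[OF assms(1)])
  show ?thesis
  proof (intro conjI allI impI)
    show "interior (singular_set \<Omega> f) = {}" by (rule interior_singular_set[OF assms(2,3)])
  next
    fix x0 y0 I q0 n
    assume I: "I \<in> imag_units" and q0: "q0 = of_real x0 + of_real y0 * I"
      and sing: "q0 \<in> singular_set \<Omega> f"
      and n: "n = total_multiplicity \<Omega> (\<lambda>q. f q - f q0) (slice_sphere x0 y0)"
    have q0\<Omega>: "q0 \<in> \<Omega>" using sing by (simp add: singular_set_def)
    have "q0 \<in> slice_sphere x0 y0" using I q0 by (auto simp: slice_sphere_def)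
    \<comment> \<open>\<open>y0\<close> may be negative, while polar coordinates have nonnegative
      imaginary part; both describe the same sphere.\<close>
    then have C: "slice_sphere x0 y0 = slice_sphere (Re (qpolar q0)) (Im (qpolar q0))"
      by (rule slice_sphere_of_mem)
    show n1: "n > 1"
      using singular_iff_multiplicity[OF assms(2,3) q0\<Omega>] sing n C by simp
    obtain U T where UT: "open U" "q0 \<in> U" "U \<subseteq> \<Omega>" "U \<subseteq> T" "open T" "slice_sphere x0 y0 \<subseteq> T" "T \<subseteq> \<Omega>"
      "\<forall>q1\<in>U. finite (zero_spheres \<Omega> (\<lambda>q. f q - f q1) T) \<and>
        (\<Sum>C\<in>zero_spheres \<Omega> (\<lambda>q. f q - f q1) T. total_multiplicity \<Omega> (\<lambda>q. f q - f q1) C) = n"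
      using multiplicity_conservation[OF assms(2,3) q0\<Omega>] unfolding n C by blast
    have two: "\<exists>a\<in>T. \<exists>b\<in>T. a \<noteq> b \<and> f a = f q1 \<and> f b = f q1" if "q1 \<in> U - singular_set \<Omega> f" for q1
    proof (rule two_preimages[OF assms(2,3)])
      have "q1 \<in> U" using that by simp
      with UT(8) show "1 < (\<Sum>C\<in>zero_spheres \<Omega> (\<lambda>p. f p - f q1) T. total_multiplicity \<Omega> (\<lambda>p. f p - f q1) C)"
        using n1 by simp
    qed (use that UT(3,4,7) in auto)
    show "\<exists>U T. open U \<and> q0 \<in> U \<and> U \<subseteq> \<Omega> \<and> open T \<and> slice_sphere x0 y0 \<subseteq> T \<and> T \<subseteq> \<Omega> \<and>
        (\<forall>q1\<in>U. finite (zero_spheres \<Omega> (\<lambda>q. f q - f q1) T) \<and>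
          (\<Sum>C\<in>zero_spheres \<Omega> (\<lambda>q. f q - f q1) T.
             total_multiplicity \<Omega> (\<lambda>q. f q - f q1) C) = n) \<and>
        (\<forall>q1\<in>U - singular_set \<Omega> f. \<exists>a\<in>T. \<exists>b\<in>T. a \<noteq> b \<and> f a = f q1 \<and> f b = f q1)"
      by (intro exI[of _ U] exI[of _ T] conjI UT ballI two)
  qed
qed

end
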